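(* Let $l>1$ be an integer, let $t_1<t_2<\cdots<t_l$ be real numbers, and let $\lambda:\{1,\dots,l-1\}\to\{0,1\}$ be a map. Then there is a suitable integer $n>1$ such that for every sufficiently large integer $m>n$ there exist an $m$-dimensional non-singular real algebraic connected manifold $M$ with no boundary and a smooth real algebraic map $g:M\to\mathbb{R}^n$ such that the function $f:=\pi_{n,1}\circ g:M\to\mathbb{R}$, where $\pi_{n,1}(x_1,\dots,x_n)=x_1$, satisfies: (i) $f(M)=[t_1,t_l]$ and $f(S(f))=\{t_1,\dots,t_l\}$; (ii) for $1\le j\le l-1$ and $t\in(t_j,t_{j+1})$: if $\lambda(j)=0$, then $f^{-1}(t)$ is closed (compact without boundary) and connected; if $\lambda(j)=1$, then $f^{-1}(t)$ is connected and non-compact and has no boundary; and for every $t\in f(M)$, $f^{-1}(t)$ is connected and homeomorphic to a CW complex of dimension at most $m-1$; and the map $g$ has the following properties: (1) The image $g(M)$ is the closure $\overline{D}$ of a normal and convenient domain (NCD) $D\subset\mathbb{R}^n$, with associated family of hypersurfaces $\{S_j\}$. (2) $\overline{D}-D$ is a union of finitely many $(n-1)$-dimensional smooth connected submanifolds of the hypersurfaces $S_j$. Each $S_j$ is a connected component of the real algebraic set defined by a single real polynomial of degree at most $2$. More precisely: (a) each $S_j$ is an affine subspace of $\mathbb{R}^n$, a connected component of an $(n-1)$-dimensional cylinder of a hyperbola in $\mathbb{R}^n$, or the boundary of some $n$-dimensional ellipsoid in $\mathbb{R}^n$; (b) if $S_{j_0}$ is the boundary of some $n$-dimensional ellipsoid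 in $\mathbb{R}^n$, then $S_j\cap S_{j_0}=\emptyset$ for every $j\ne j_0$.
   Context: The real algebraic set in $\mathbb{R}^k$ defined by finitely many real polynomials is the common zero set of these polynomials. A real algebraic manifold means a union of connected components of a real algebraic set in some $\mathbb{R}^k$ defined by finitely many real polynomials. It is non-singular if it is a smooth manifold by the implicit function theorem applied to the map whose components are the defining polynomials, i.e. at each of its points that map has differential of full rank (equal to the number of polynomials). A smooth real algebraic map from such a manifold to $\mathbb{R}^n$ has its standard meaning (a regular map, for example the restriction of a polynomial map on the ambient affine space). For a smooth map $c:X\to Y$ between smooth manifolds, a point $x\in X$ is singular if the rank of the differential of $c$ at $x$ is smaller than $\min(\dim X,\dim Y)$; $S(c)$ denotes the set of all singular points of $c$. Normal and convenient domain (NCD): a connected open set $D\subset\mathbb{R}^n$ for which there exist an integer $k>0$, real polynomials $f_1,\dots,f_k$ in $n$ variables, and sets $S_1,\dots,S_k$ such that: - $D=\bigcap_{j=1}^k\{x\in\mathbb{R}^n\mid f_j(x)>0\}$ and its closure is $\overline{D}=\bigcap_{j=1}^k\{x\in\mathbb{R}^n\mid f_j(x)\ge 0\}$; - $S_j$ is a connected component of $\{x\in\mathbb{R}^n\mid f_j(x)=0\}$ and is a non-singular connected real algebraic hypersurface; - $(\{x\in\mathbb{R}^n\mid f_j(x)=0\}-S_j)\cap\overline{D}=\emptyset$, and $\overline{D}$ is contained in $\mathbb{R}^n-(\{x\in\mathbb{R}^n\mid f_j(x)=0\}-S_j)$, which is an open set; - (transversality) for every non-empty $\Lambda\subset\{1,\dots,k\}$,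 the intersection $\bigcap_{j\in\Lambda}S_j$ is empty or a non-singular real algebraic submanifold without boundary of dimension $n-|\Lambda|$, and at each of its points $p$ its tangent space (the image of the differential of its inclusion into $\mathbb{R}^n$) equals the intersection of the tangent spaces at $p$ of the $S_j$, $j\in\Lambda$ (the images of the differentials of the inclusions $S_j\to\mathbb{R}^n$). An affine transformation of $\mathbb{R}^n$ is an invertible linear map composed with a translation. An affine subspace of $\mathbb{R}^n$ is $\mathbb{R}^n$ itself or a set which is mapped by some affine transformation onto $\mathbb{R}^{k_1}\times\{0\}\subset\mathbb{R}^{k_1}\times\mathbb{R}^{k_2}=\mathbb{R}^n$ with $k_1,k_2>0$. An $(n-1)$-dimensional cylinder of a hyperbola in $\mathbb{R}^n$ is a set which is mapped by some affine transformation of $\mathbb{R}^n$ onto a set of the form $\{(x_1,x_2)\in\mathbb{R}^2\mid (x_1-a)(x_2-b)=c\}\times\mathbb{R}^{n-2}$ with $a,b,c\in\mathbb{R}$, $c\neq0$ (for $n=2$ there is no second factor). An $n$-dimensional ellipsoid in $\mathbb{R}^n$ is a set which is mapped by some affine transformation of $\mathbb{R}^n$ onto a set of the form $\{x\in\mathbb{R}^n\mid\sum_{j=1}^n\frac{(x_j-a_j)^2}{r_j}\le1\}$ with $a_j\in\mathbb{R}$, $r_j>0$. *)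

theory Defs
  imports
    "HOL-Analysis.Analysis"
    "HOL-Library.Poly_Mapping"
    "HOL-Library.Function_Algebras"
begin

text \<open>
  The dimensions of the spaces involved are existentially quantified, so \<open>\<real>\<^sup>n\<close> is
  \<^const>\<open>Euclidean_space\<close> \<open>n\<close>: functions \<open>nat \<Rightarrow> real\<close> that vanish at all indices
  \<open>\<ge> n\<close>. Coordinates are numbered from \<open>0\<close>, and
  \<open>\<real>\<^sup>k = \<real>\<^sup>k \<times> {0} \<subseteq> \<real>\<^sup>n\<close> for \<open>k \<le> n\<close>.
\<close>

abbreviation Rn :: "nat \<Rightarrow> (nat \<Rightarrow> real) set"
  where "Rn n \<equiv> topspace (Euclidean_space n)"

definition tuple :: "nat \<Rightarrow> (nat \<Rightarrow> 'a \<Rightarrow> real) \<Rightarrow> 'a \<Rightarrow> nat \<Rightarrow> real"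
  where "tuple r h x = (\<lambda>j. if j < r then h j x else 0)"

lemma tuple_in_Rn: "tuple r h x \<in> Rn r"
  by (simp add: tuple_def topspace_Euclidean_space)

definition scale_fun :: "real \<Rightarrow> (nat \<Rightarrow> real) \<Rightarrow> nat \<Rightarrow> real"
  where "scale_fun c v = (\<lambda>i. c * v i)"

lemma vector_space_scale_fun: "vector_space scale_fun"
  by unfold_locales (auto simp: scale_fun_def algebra_simps)

definition fun_dim :: "(nat \<Rightarrow> real) set \<Rightarrow> nat"
  where "fun_dim = vector_space.dim scale_fun"


subsection \<open>Real polynomials in several variables\<close>

text \<open>A polynomial maps each monomial (its exponents) to its coefficient.\<close>

type_synonym rpoly = "(nat \<Rightarrow>\<^sub>0 nat) \<Rightarrow>\<^sub>0 real"

definition peval :: "rpoly \<Rightarrow> (nat \<Rightarrow> real) \<Rightarrow> real"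
  where "peval p x =
    (\<Sum>\<mu>\<in>Poly_Mapping.keys p. Poly_Mapping.lookup p \<mu> *
       (\<Prod>i\<in>Poly_Mapping.keys \<mu>. x i ^ Poly_Mapping.lookup \<mu> i))"

definition poly_in :: "nat \<Rightarrow> rpoly \<Rightarrow> bool"
  where "poly_in n p \<longleftrightarrow> (\<forall>\<mu>\<in>Poly_Mapping.keys p. Poly_Mapping.keys \<mu> \<subseteq> {..<n})"

definition total_deg :: "rpoly \<Rightarrow> nat"
  where "total_deg p =
    Max (insert 0 ((\<lambda>\<mu>. \<Sum>i\<in>Poly_Mapping.keys \<mu>. Poly_Mapping.lookup \<mu> i) ` Poly_Mapping.keys p))"

definition zero_set :: "nat \<Rightarrow> nat \<Rightarrow> (nat \<Rightarrow> rpoly) \<Rightarrow> (nat \<Rightarrow> real) set"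
  where "zero_set k r h = {x \<in> Rn k. \<forall>j<r. peval (h j) x = 0}"

abbreviation zeros :: "nat \<Rightarrow> rpoly \<Rightarrow> (nat \<Rightarrow> real) set"
  where "zeros k p \<equiv> zero_set k 1 (\<lambda>_. p)"

definition conn_comps :: "nat \<Rightarrow> (nat \<Rightarrow> real) set \<Rightarrow> (nat \<Rightarrow> real) set set"
  where "conn_comps k Z = connected_components_of (subtopology (Euclidean_space k) Z)"


subsection \<open>Differentials\<close>

definition has_velocity :: "(real \<Rightarrow> nat \<Rightarrow> real) \<Rightarrow> (nat \<Rightarrow> real) \<Rightarrow> bool"
  where "has_velocity \<gamma> v \<longleftrightarrow> (\<forall>i. ((\<lambda>s. \<gamma> s i) has_real_derivative v i) (at 0))"

text \<open>
  Tangent vectors at \<open>x\<close> of a smooth submanifold \<open>X\<close> are velocities at time \<open>0\<close> of curves in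
  \<open>X\<close> through \<open>x\<close>, and the differential of a smooth map \<open>c\<close> takes the velocity of \<open>\<gamma>\<close> to
  the velocity of \<open>c \<circ> \<gamma>\<close>. Differentiability of the curves at \<open>0\<close> suffices: in a
  submanifold such curves have the same velocities as smooth ones.
\<close>

definition differential_image ::
    "(nat \<Rightarrow> real) set \<Rightarrow> ((nat \<Rightarrow> real) \<Rightarrow> nat \<Rightarrow> real) \<Rightarrow> (nat \<Rightarrow> real) \<Rightarrow> (nat \<Rightarrow> real) set"
  where "differential_image X c x =
    {w. \<exists>\<gamma> v. \<gamma> 0 = x \<and> (\<forall>\<^sub>F s in nhds 0. \<gamma> s \<in> X) \<and>
              has_velocity \<gamma> v \<and> has_velocity (c \<circ> \<gamma>) w}"

definition diff_rank ::
    "(nat \<Rightarrow> real) set \<Rightarrow> ((nat \<Rightarrow> real) \<Rightarrow> nat \<Rightarrow> real) \<Rightarrow> (nat \<Rightarrow> real) \<Rightarrow> nat"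
  where "diff_rank X c x = fun_dim (differential_image X c x)"

definition tangent_space :: "(nat \<Rightarrow> real) set \<Rightarrow> (nat \<Rightarrow> real) \<Rightarrow> (nat \<Rightarrow> real) set"
  where "tangent_space X x = differential_image X (\<lambda>y. y) x"

text \<open>Singular points of a smooth map from an \<open>m\<close>-dimensional \<open>X\<close> to \<open>\<real>\<^sup>n\<close>.\<close>

definition singular_points ::
    "nat \<Rightarrow> nat \<Rightarrow> (nat \<Rightarrow> real) set \<Rightarrow> ((nat \<Rightarrow> real) \<Rightarrow> nat \<Rightarrow> real) \<Rightarrow> (nat \<Rightarrow> real) set"
  where "singular_points m n X c = {x \<in> X. diff_rank X c x < min m n}"


subsection \<open>Real algebraic manifolds and maps\<close>

definition nonsingular_wrt :: "nat \<Rightarrow> nat \<Rightarrow> (nat \<Rightarrow> rpoly) \<Rightarrow> (nat \<Rightarrow> real) set \<Rightarrow> bool"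
  where "nonsingular_wrt k r h M \<longleftrightarrow>
    (\<forall>j<r. poly_in k (h j)) \<and>
    (\<exists>\<C>\<subseteq>conn_comps k (zero_set k r h). M = \<Union>\<C>) \<and>
    (\<forall>x\<in>M. diff_rank (Rn k) (tuple r (\<lambda>j. peval (h j))) x = r)"

text \<open>\<open>m\<close>-dimensional, in \<open>\<real>\<^sup>k\<close>; such a manifold never has a boundary.\<close>

definition nonsingular_alg_manifold :: "nat \<Rightarrow> nat \<Rightarrow> (nat \<Rightarrow> real) set \<Rightarrow> bool"
  where "nonsingular_alg_manifold k m M \<longleftrightarrow> (\<exists>r h. k = m + r \<and> nonsingular_wrt k r h M)"

text \<open>
  Regular maps: over \<open>\<real>\<close> a function that is locally a quotient of polynomials is globally one,
  with a denominator vanishing nowhere on \<open>M\<close>.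
\<close>

definition real_algebraic_map ::
    "nat \<Rightarrow> nat \<Rightarrow> (nat \<Rightarrow> real) set \<Rightarrow> ((nat \<Rightarrow> real) \<Rightarrow> nat \<Rightarrow> real) \<Rightarrow> bool"
  where "real_algebraic_map k n M g \<longleftrightarrow>
    g ` M \<subseteq> Rn n \<and>
    (\<forall>i<n. \<exists>p q. poly_in k p \<and> poly_in k q \<and>
       (\<forall>x\<in>M. peval q x \<noteq> 0 \<and> g x i = peval p x / peval q x))"


subsection \<open>Smooth submanifolds\<close>

primrec Ck_on :: "nat \<Rightarrow> nat \<Rightarrow> (nat \<Rightarrow> real) set \<Rightarrow> ((nat \<Rightarrow> real) \<Rightarrow> real) \<Rightarrow> bool" where
  "Ck_on n 0 U f \<longleftrightarrow> continuous_on U f"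
| "Ck_on n (Suc r) U f \<longleftrightarrow> continuous_on U f \<and>
     (\<exists>f'. \<forall>i<n. (\<forall>x\<in>U. ((\<lambda>s. f (x(i := s))) has_real_derivative f' i x) (at (x i))) \<and>
                  Ck_on n r U (f' i))"

definition smooth_fun_on :: "nat \<Rightarrow> (nat \<Rightarrow> real) set \<Rightarrow> ((nat \<Rightarrow> real) \<Rightarrow> real) \<Rightarrow> bool"
  where "smooth_fun_on n U f \<longleftrightarrow> (\<forall>r. Ck_on n r U f)"

text \<open>
  \<open>d\<close>-dimensional smooth submanifolds of \<open>\<real>\<^sup>n\<close>, given near each point \<open>p\<close> by \<open>n - d\<close>
  equations and \<open>s\<close> inequalities, all active at \<open>p\<close>, whose differentials at \<open>p\<close> are linearly
  independent. The bound \<open>s \<le> c\<close> means: no boundary for \<open>c = 0\<close>, smooth boundary for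
  \<open>c = 1\<close>, arbitrary corners for \<open>c = d\<close>.
\<close>

definition smooth_submanifold :: "nat \<Rightarrow> nat \<Rightarrow> nat \<Rightarrow> (nat \<Rightarrow> real) set \<Rightarrow> bool"
  where "smooth_submanifold n d c P \<longleftrightarrow> d \<le> n \<and> P \<subseteq> Rn n \<and>
    (\<forall>p\<in>P. \<exists>U s h. openin (Euclidean_space n) U \<and> p \<in> U \<and> s \<le> c \<and>
       (\<forall>j<n - d + s. smooth_fun_on n U (h j) \<and> h j p = 0) \<and>
       diff_rank U (tuple (n - d + s) h) p = n - d + s \<and>
       P \<inter> U = {x \<in> U. (\<forall>j<n - d. h j x = 0) \<and> (\<forall>j\<in>{n - d..<n - d + s}. 0 \<le> h j x)})"


subsection \<open>Normal and convenient domains\<close>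

definition NCD ::
    "nat \<Rightarrow> (nat \<Rightarrow> real) set \<Rightarrow> nat \<Rightarrow> (nat \<Rightarrow> rpoly) \<Rightarrow> (nat \<Rightarrow> (nat \<Rightarrow> real) set) \<Rightarrow> bool"
  where "NCD n D k f S \<longleftrightarrow>
    openin (Euclidean_space n) D \<and> connectedin (Euclidean_space n) D \<and> k > 0 \<and>
    (\<forall>j\<in>{1..k}. poly_in n (f j)) \<and>
    D = {x \<in> Rn n. \<forall>j\<in>{1..k}. peval (f j) x > 0} \<and>
    Euclidean_space n closure_of D = {x \<in> Rn n. \<forall>j\<in>{1..k}. peval (f j) x \<ge> 0} \<and>
    (\<forall>j\<in>{1..k}. S j \<in> conn_comps n (zeros n (f j)) \<and> nonsingular_wrt n 1 (\<lambda>_. f j) (S j)) \<and>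
    (\<forall>j\<in>{1..k}.
       (zeros n (f j) - S j) \<inter> (Euclidean_space n closure_of D) = {} \<and>
       Euclidean_space n closure_of D \<subseteq> Rn n - (zeros n (f j) - S j) \<and>
       openin (Euclidean_space n) (Rn n - (zeros n (f j) - S j))) \<and>
    (\<forall>\<Lambda>\<subseteq>{1..k}. \<Lambda> \<noteq> {} \<longrightarrow>
       (\<Inter>j\<in>\<Lambda>. S j) = {} \<or>
       (card \<Lambda> \<le> n \<and> nonsingular_alg_manifold n (n - card \<Lambda>) (\<Inter>j\<in>\<Lambda>. S j) \<and>
        (\<forall>p\<in>(\<Inter>j\<in>\<Lambda>. S j).
           tangent_space (\<Inter>j\<in>\<Lambda>. S j) p = (\<Inter>j\<in>\<Lambda>. tangent_space (S j) p))))"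


subsection \<open>Affine subspaces, cylinders of hyperbolas, ellipsoids\<close>

definition linear_iso :: "nat \<Rightarrow> (nat \<Rightarrow> nat \<Rightarrow> real) \<Rightarrow> bool"
  where "linear_iso n A \<longleftrightarrow>
    bij_betw (tuple n (\<lambda>i x. \<Sum>j<n. A i j * x j)) (Rn n) (Rn n)"

definition affine_transformation :: "nat \<Rightarrow> ((nat \<Rightarrow> real) \<Rightarrow> nat \<Rightarrow> real) \<Rightarrow> bool"
  where "affine_transformation n T \<longleftrightarrow>
    (\<exists>A b. linear_iso n A \<and>
       (\<forall>x\<in>Rn n. T x = tuple n (\<lambda>i x. (\<Sum>j<n. A i j * x j) + b i) x))"

definition affinely_equivalent :: "nat \<Rightarrow> (nat \<Rightarrow> real) set \<Rightarrow> (nat \<Rightarrow> real) set \<Rightarrow> bool"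
  where "affinely_equivalent n A B \<longleftrightarrow>
    A \<subseteq> Rn n \<and> (\<exists>T. affine_transformation n T \<and> T ` A = B)"

definition affine_subspace :: "nat \<Rightarrow> (nat \<Rightarrow> real) set \<Rightarrow> bool"
  where "affine_subspace n A \<longleftrightarrow>
    A = Rn n \<or> (\<exists>k1 k2. k1 > 0 \<and> k2 > 0 \<and> k1 + k2 = n \<and> affinely_equivalent n A (Rn k1))"

definition hyperbola_cylinder :: "nat \<Rightarrow> (nat \<Rightarrow> real) set \<Rightarrow> bool"
  where "hyperbola_cylinder n H \<longleftrightarrow> n \<ge> 2 \<and>
    (\<exists>a b c. c \<noteq> 0 \<and> affinely_equivalent n H {x \<in> Rn n. (x 0 - a) * (x 1 - b) = c})"

definition ellipsoid :: "nat \<Rightarrow> (nat \<Rightarrow> real) set \<Rightarrow> bool"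
  where "ellipsoid n E \<longleftrightarrow>
    (\<exists>a r. (\<forall>j<n. r j > 0) \<and>
       affinely_equivalent n E {x \<in> Rn n. (\<Sum>j<n. (x j - a j)\<^sup>2 / r j) \<le> 1})"

definition ellipsoid_boundary :: "nat \<Rightarrow> (nat \<Rightarrow> real) set \<Rightarrow> bool"
  where "ellipsoid_boundary n B \<longleftrightarrow> (\<exists>E. ellipsoid n E \<and> B = Euclidean_space n frontier_of E)"


subsection \<open>CW complexes\<close>

definition closed_disc :: "nat \<Rightarrow> (nat \<Rightarrow> real) set"
  where "closed_disc e = {x \<in> Rn e. (\<Sum>i<e. (x i)\<^sup>2) \<le> 1}"

definition open_disc :: "nat \<Rightarrow> (nat \<Rightarrow> real) set"
  where "open_disc e = {x \<in> Rn e. (\<Sum>i<e. (x i)\<^sup>2) < 1}"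

text \<open>
  \<open>C\<close> is the set of cells, each given by its dimension and its characteristic map. The last two
  conditions are closure-finiteness and the weak topology.
\<close>

definition CW_structure :: "'a topology \<Rightarrow> (nat \<times> ((nat \<Rightarrow> real) \<Rightarrow> 'a)) set \<Rightarrow> bool"
  where "CW_structure X C \<longleftrightarrow>
    Hausdorff_space X \<and>
    (\<forall>(e, \<phi>)\<in>C. continuous_map (subtopology (Euclidean_space e) (closed_disc e)) X \<phi> \<and>
                 embedding_map (subtopology (Euclidean_space e) (open_disc e)) X \<phi>) \<and>
    topspace X = (\<Union>(e, \<phi>)\<in>C. \<phi> ` open_disc e) \<and>
    pairwise (\<lambda>(e, \<phi>) (e', \<phi>'). disjnt (\<phi> ` open_disc e) (\<phi>' ` open_disc e')) C \<and>
    (\<forall>(e, \<phi>)\<in>C. \<exists>F\<subseteq>C. finite F \<and> (\<forall>(e', \<phi>')\<in>F. e' < e) \<and>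
       \<phi> ` (closed_disc e - open_disc e) \<subseteq> (\<Union>(e', \<phi>')\<in>F. \<phi>' ` open_disc e')) \<and>
    (\<forall>A\<subseteq>topspace X. closedin X A \<longleftrightarrow> (\<forall>(e, \<phi>)\<in>C. closedin X (A \<inter> \<phi> ` closed_disc e)))"

definition CW_complex_dim_le :: "nat \<Rightarrow> 'a topology \<Rightarrow> bool"
  where "CW_complex_dim_le d X \<longleftrightarrow> (\<exists>C. CW_structure X C \<and> (\<forall>(e, \<phi>)\<in>C. e \<le> d))"

end

theory Submission
  imports Defs
begin

text \<open>
  Only the image of the map is tied to the plane domain, so we take \<open>n = 2\<close>, let \<open>D\<close> be the open disc
  with the segment from \<open>(t\<^sub>1, 0)\<close> to \<open>(t\<^sub>l, 0)\<close> as a diameter, and put all the complexity into \<open>M\<close>.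
  In \<open>\<real>\<^sup>m\<^sup>+\<^sup>2\<close> with coordinates \<open>s, x, z, w\<close> (\<open>w \<in> \<real>\<^sup>m\<^sup>-\<^sup>1\<close>) let \<open>M\<close> be given by
  \<open>x\<^sup>3 = q(s)\<close> and \<open>|w|\<^sup>2 = b(s) (1 + c(s) z\<^sup>2)\<close>, where \<open>b(s) = (s - t\<^sub>1) (t\<^sub>l - s)\<close>,
  \<open>q(s) = \<Prod>\<^bsub>1 < j < l\<^esub> (s - t\<^sub>j)\<close> and \<open>c(s) = \<Prod>\<^bsub>\<lambda>(j) = 0\<^esub> (s - t\<^sub>j) (s - t\<^sub>j\<^sub>+\<^sub>1)\<close>, and let \<open>f = s\<close>.

  The polynomial \<open>c\<close> is negative exactly on the intervals \<open>(t\<^sub>j, t\<^sub>j\<^sub>+\<^sub>1)\<close> with \<open>\<lambda>(j) = 0\<close>. So over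
  \<open>(t\<^sub>1, t\<^sub>l)\<close> the fiber is a sphere \<open>S\<^sup>m\<^sup>-\<^sup>1\<close> where \<open>c(s) < 0\<close> and \<open>\<real> \<times> S\<^sup>m\<^sup>-\<^sup>2\<close> where \<open>c(s) \<ge> 0\<close>; over the two end
  points it is a line, and outside \<open>[t\<^sub>1, t\<^sub>l]\<close> it is empty because \<open>b < 0 \<le> c\<close> there. The second equation
  alone has no critical points of \<open>s\<close> over the open interval, and the first one makes \<open>s\<close> critical
  exactly where \<open>x = 0\<close>, that is over the simple roots of \<open>q\<close>.

  Finally \<open>g = (s, w\<^sub>1 / (1 + (1 + c(s)\<^sup>2) z\<^sup>2))\<close> maps \<open>M\<close> onto the closed disc: \<open>|w\<^sub>1|\<close> is at most
  \<open>b(s)\<^sup>1\<^sup>/\<^sup>2\<close> times the denominator, and all values allowed by this occur at \<open>z = 0\<close>.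
\<close>

subsection \<open>Euclidean spaces as subspaces of a function space\<close>

text \<open>The cubic equation separates topology from smoothness. Cubing is a homeomorphism of the
  line, so \<open>x\<close> is a continuous function of \<open>s\<close> and the fibers keep the
  shape dictated by the second equation; but the cube is flat at \<open>x = 0\<close>, so there a
  differentiable curve in \<open>M\<close> has velocity 0 in \<open>s\<close>. Since the roots of
  \<open>q\<close> are simple, \<open>M\<close> stays non-singular at these points. Thus every inner
  \<open>t j\<close> becomes a critical value, even between two intervals with equal \<lambda>,
  where the type of the fiber is the same on both sides. Where \<open>c\<close> changes sign, the
  extent of the spheres in \<open>z\<close> tends to infinity, so they open up into cylinders
  without a singularity of the second equation. At the two ends \<open>b\<close> vanishes, but its
  derivative does not, and \<open>1 + c z\<^sup>2\<close> is positive there. For \<open>m\<close> at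
  least 3, \<open>w\<close> has two or more coordinates. This makes the spheres of \<open>w\<close>
  connected, and once the first coordinate is prescribed another one can take up the rest of the
  radius, which gives surjectivity onto the disc.\<close>

lemma Euclidean_space_eq: "Euclidean_space n = top_of_set {x. \<forall>i\<ge>n. x i = 0}"
  by (simp add: Euclidean_space_def euclidean_product_topology)

lemma Rn_iff: "x \<in> Rn n \<longleftrightarrow> (\<forall>i\<ge>n. x i = 0)"
  by (simp add: topspace_Euclidean_space)

text \<open>With the previous lemma this replaces the abstract topologies of the statement by the
  topology of the type \<open>nat \<Rightarrow> real\<close>, where the usual facts on continuity
  and compactness apply.\<close>

lemma subtopology_Euclidean_space:
  "S \<subseteq> Rn n \<Longrightarrow> subtopology (Euclidean_space n) S = top_of_set S"
  by (simp add: Euclidean_space_eq subtopology_subtopology Int_absorb1)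

lemma connectedin_Euclidean_space:
  "connectedin (Euclidean_space n) S \<longleftrightarrow> S \<subseteq> Rn n \<and> connected S"
  by (auto simp: Euclidean_space_eq connectedin_subtopology)

lemma compactin_Euclidean_space:
  "compactin (Euclidean_space n) S \<longleftrightarrow> S \<subseteq> Rn n \<and> compact S"
  by (auto simp: Euclidean_space_eq compactin_subtopology)

lemma closed_Rn: "closed (Rn n)"
  by (rule closedin_Euclidean_imp_closed [of n]) simp

lemma closure_of_Euclidean_space:
  assumes "S \<subseteq> Rn n"
  shows "Euclidean_space n closure_of S = closure S"
  using closure_minimal[OF assms closed_Rn] assms
  by (auto simp: Euclidean_space_eq closure_of_subtopology Int_absorb1)

lemma connected_conn_comps:
  assumes "S \<subseteq> Rn n" "connected S" "S \<noteq> {}"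
  shows "S \<in> conn_comps n S"
proof -
  have "connected_space (top_of_set S)"
    using assms(2) by (metis connectedin_def connectedin_iff_connected)
  then have "conn_comps n S = {S}"
    using assms by (simp add: conn_comps_def subtopology_Euclidean_space
      connected_components_of_connected_space
      flip: null_topspace_iff_trivial)
  then show ?thesis by simp
qed

lemma Union_conn_comps: "S \<subseteq> Rn n \<Longrightarrow> \<Union>(conn_comps n S) = S"
  by (simp add: conn_comps_def Union_connected_components_of Int_absorb1)

lemma continuous_on_coord [continuous_intros]: "continuous_on S (\<lambda>x :: nat \<Rightarrow> real. x i)"
  by (rule continuous_on_subset[OF continuous_on_product_coordinates]) simp

subsection \<open>Polynomial functions\<close>

definition meval :: "(nat \<Rightarrow>\<^sub>0 nat) \<Rightarrow> (nat \<Rightarrow> real) \<Rightarrow> real"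
  where "meval \<mu> x = (\<Prod>i\<in>Poly_Mapping.keys \<mu>. x i ^ Poly_Mapping.lookup \<mu> i)"

text \<open>Exponents outside the keys are 0 and give factors 1, so \<open>\<mu>\<close>,
  \<open>\<nu>\<close> and \<open>\<mu> + \<nu>\<close> can be compared over one common index
  set.\<close>

lemma meval_superset:
  assumes "finite A" "Poly_Mapping.keys \<mu> \<subseteq> A"
  shows "meval \<mu> x = (\<Prod>i\<in>A. x i ^ Poly_Mapping.lookup \<mu> i)"
  unfolding meval_def
  by (rule prod.mono_neutral_left) (use assms in \<open>auto simp: in_keys_iff\<close>)

lemma meval_add: "meval (\<mu> + \<nu>) x = meval \<mu> x * meval \<nu> x"
proof -
  let ?A = "Poly_Mapping.keys \<mu> \<union> Poly_Mapping.keys \<nu>"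
  have "meval (\<mu> + \<nu>) x = (\<Prod>i\<in>?A. x i ^ Poly_Mapping.lookup (\<mu> + \<nu>) i)"
    by (rule meval_superset) (use Poly_Mapping.keys_add[of \<mu> \<nu>] in auto)
  also have "\<dots> = (\<Prod>i\<in>?A. x i ^ Poly_Mapping.lookup \<mu> i) * (\<Prod>i\<in>?A. x i ^ Poly_Mapping.lookup \<nu> i)"
    by (simp add: lookup_add power_add prod.distrib)
  also have "\<dots> = meval \<mu> x * meval \<nu> x"
    by (simp add: meval_superset[of ?A])
  finally show ?thesis .
qed

text \<open>The same device for coefficients; terms of \<open>p + q\<close> may cancel, so its keys
  need not be the union of the keys.\<close>

lemma peval_superset:
  assumes "finite A" "Poly_Mapping.keys p \<subseteq> A"
  shows "peval p x = (\<Sum>\<mu>\<in>A. Poly_Mapping.lookup p \<mu> * meval \<mu> x)"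
  unfolding peval_def meval_def [symmetric]
  by (rule sum.mono_neutral_left) (use assms in \<open>auto simp: in_keys_iff\<close>)

lemma peval_add: "peval (p + q) x = peval p x + peval q x"
proof -
  let ?A = "Poly_Mapping.keys p \<union> Poly_Mapping.keys q"
  have "peval (p + q) x = (\<Sum>\<mu>\<in>?A. Poly_Mapping.lookup (p + q) \<mu> * meval \<mu> x)"
    by (rule peval_superset) (use Poly_Mapping.keys_add[of p q] in auto)
  then show ?thesis
    by (simp add: lookup_add algebra_simps sum.distrib peval_superset[of ?A])
qed

lemma peval_0: "peval 0 x = 0"
  by (simp add: peval_def)

lemma peval_sum: "peval (\<Sum>i\<in>I. p i) x = (\<Sum>i\<in>I. peval (p i) x)"
  by (induction I rule: infinite_finite_induct) (auto simp: peval_add peval_0)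

lemma peval_single: "peval (Poly_Mapping.single \<mu> a) x = a * meval \<mu> x"
  by (cases "a = 0") (auto simp: peval_def meval_def)

lemma poly_mapping_eq_sum_single:
  "(\<Sum>\<mu>\<in>Poly_Mapping.keys p. Poly_Mapping.single \<mu> (Poly_Mapping.lookup p \<mu>)) = p"
proof (rule poly_mapping_eqI)
  fix \<kappa>
  have "(\<Sum>\<mu>\<in>Poly_Mapping.keys p. Poly_Mapping.lookup p \<mu> when \<mu> = \<kappa>)
      = (if \<kappa> \<in> Poly_Mapping.keys p then Poly_Mapping.lookup p \<kappa> else 0)"
    unfolding when_def by (subst sum.delta) auto
  then show "Poly_Mapping.lookup (\<Sum>\<mu>\<in>Poly_Mapping.keys p.
      Poly_Mapping.single \<mu> (Poly_Mapping.lookup p \<mu>)) \<kappa> = Poly_Mapping.lookup p \<kappa>"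
    by (simp add: lookup_sum lookup_single in_keys_iff)
qed

text \<open>Both factors are decomposed into single terms, for which the claim is
  \<open>meval_add\<close>; the terms of the product itself may merge or cancel.\<close>

lemma peval_mult: "peval (p * q) x = peval p x * peval q x"
proof -
  let ?s = "\<lambda>r \<mu>. Poly_Mapping.single \<mu> (Poly_Mapping.lookup r \<mu>) :: rpoly"
  have single: "peval (?s p \<mu> * ?s q \<nu>) x = peval (?s p \<mu>) x * peval (?s q \<nu>) x" for \<mu> \<nu>
    by (simp add: mult_single peval_single meval_add)
  have "p * q = (\<Sum>\<mu>\<in>Poly_Mapping.keys p. ?s p \<mu>) * (\<Sum>\<nu>\<in>Poly_Mapping.keys q. ?s q \<nu>)"
    by (simp only: poly_mapping_eq_sum_single)
  also have "\<dots> = (\<Sum>\<mu>\<in>Poly_Mapping.keys p. \<Sum>\<nu>\<in>Poly_Mapping.keys q. ?s p \<mu> * ?s q \<nu>)"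
    by (rule sum_product)
  finally have "peval (p * q) x = (\<Sum>\<mu>\<in>Poly_Mapping.keys p. \<Sum>\<nu>\<in>Poly_Mapping.keys q.
      peval (?s p \<mu>) x * peval (?s q \<nu>) x)"
    by (simp only: peval_sum single)
  also have "\<dots> = peval (\<Sum>\<mu>\<in>Poly_Mapping.keys p. ?s p \<mu>) x * peval (\<Sum>\<nu>\<in>Poly_Mapping.keys q. ?s q \<nu>) x"
    by (simp only: sum_product peval_sum)
  finally show ?thesis
    by (simp only: poly_mapping_eq_sum_single)
qed

definition mdeg :: "(nat \<Rightarrow>\<^sub>0 nat) \<Rightarrow> nat"
  where "mdeg \<mu> = (\<Sum>i\<in>Poly_Mapping.keys \<mu>. Poly_Mapping.lookup \<mu> i)"

lemma mdeg_add: "mdeg (\<mu> + \<nu>) = mdeg \<mu> + mdeg \<nu>"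
proof -
  have *: "mdeg \<kappa> = (\<Sum>i\<in>A. Poly_Mapping.lookup \<kappa> i)"
    if "finite A" "Poly_Mapping.keys \<kappa> \<subseteq> A" for A and \<kappa> :: "nat \<Rightarrow>\<^sub>0 nat"
    unfolding mdeg_def
  proof (rule sum.mono_neutral_left)
    show "\<forall>i\<in>A - Poly_Mapping.keys \<kappa>. Poly_Mapping.lookup \<kappa> i = 0"
      by (simp add: in_keys_iff)
  qed (use that in simp_all)
  let ?A = "Poly_Mapping.keys \<mu> \<union> Poly_Mapping.keys \<nu>"
  have "mdeg (\<mu> + \<nu>) = (\<Sum>i\<in>?A. Poly_Mapping.lookup (\<mu> + \<nu>) i)"
    by (rule *[OF _ Poly_Mapping.keys_add]) simp
  also have "\<dots> = (\<Sum>i\<in>?A. Poly_Mapping.lookup \<mu> i) + (\<Sum>i\<in>?A. Poly_Mapping.lookup \<nu> i)"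
    by (simp only: lookup_add sum.distrib)
  also have "\<dots> = mdeg \<mu> + mdeg \<nu>"
    using *[of ?A \<mu>] *[of ?A \<nu>] by simp
  finally show ?thesis .
qed

lemma total_deg_le_iff: "total_deg p \<le> d \<longleftrightarrow> (\<forall>\<mu>\<in>Poly_Mapping.keys p. mdeg \<mu> \<le> d)"
  by (simp add: total_deg_def mdeg_def)

text \<open>Recognises polynomial functions by their shape, so that no \<open>rpoly\<close> has to
  be written down. The second argument is an upper bound for the degree, which rule
  \<open>le\<close> may raise; it serves the circle, where degree at most 2 is demanded.\<close>

inductive polyfun :: "nat \<Rightarrow> nat \<Rightarrow> ((nat \<Rightarrow> real) \<Rightarrow> real) \<Rightarrow> bool" for k where
  const: "polyfun k d (\<lambda>x. c)"
| coord: "i < k \<Longrightarrow> polyfun k 1 (\<lambda>x. x i)"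
| add: "polyfun k d F \<Longrightarrow> polyfun k d G \<Longrightarrow> polyfun k d (\<lambda>x. F x + G x)"
| mult: "polyfun k d F \<Longrightarrow> polyfun k e G \<Longrightarrow> polyfun k (d + e) (\<lambda>x. F x * G x)"
| le: "polyfun k d F \<Longrightarrow> d \<le> e \<Longrightarrow> polyfun k e F"

lemma polyfun_peval:
  assumes "polyfun k d F"
  shows "\<exists>p. poly_in k p \<and> total_deg p \<le> d \<and> peval p = F"
  using assms
proof induction
  case (const d c)
  have "peval (Poly_Mapping.single 0 c) = (\<lambda>x. c)"
    by (auto simp: fun_eq_iff peval_single meval_def)
  then show ?case
    by (intro exI[of _ "Poly_Mapping.single 0 c"])
       (auto simp: poly_in_def total_deg_le_iff mdeg_def)
next
  case (coord i)
  have "peval (Poly_Mapping.single (Poly_Mapping.single i 1) 1) = (\<lambda>x. x i)"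
    by (auto simp: fun_eq_iff peval_single meval_def)
  then show ?case
    using coord by (intro exI[of _ "Poly_Mapping.single (Poly_Mapping.single i 1) 1"])
       (auto simp: poly_in_def total_deg_le_iff mdeg_def)
next
  case (add d F G)
  then obtain p q where "poly_in k p" "total_deg p \<le> d" "peval p = F"
    "poly_in k q" "total_deg q \<le> d" "peval q = G" by auto
  moreover have "Poly_Mapping.keys (p + q) \<subseteq> Poly_Mapping.keys p \<union> Poly_Mapping.keys q"
    by (rule Poly_Mapping.keys_add)
  ultimately show ?case
    by (intro exI[of _ "p + q"], unfold poly_in_def total_deg_le_iff) (auto simp: peval_add; blast)
next
  case (mult d F e G)
  then obtain p q where pq: "poly_in k p" "total_deg p \<le> d" "peval p = F"
    "poly_in k q" "total_deg q \<le> e" "peval q = G" by auto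
  \<comment> \<open>Every key of a product is a sum of keys of the factors, so the variables stay
    bounded and the degrees add up.\<close>
  have "Poly_Mapping.keys \<kappa> \<subseteq> {..<k} \<and> mdeg \<kappa> \<le> d + e" if \<kappa>: "\<kappa> \<in> Poly_Mapping.keys (p * q)" for \<kappa>
  proof -
    obtain \<mu> \<nu> where "\<kappa> = \<mu> + \<nu>" "\<mu> \<in> Poly_Mapping.keys p" "\<nu> \<in> Poly_Mapping.keys q"
      using \<kappa> Poly_Mapping.keys_mult[of p q] by blast
    then show ?thesis
      using pq Poly_Mapping.keys_add[of \<mu> \<nu>]
      by (fastforce simp: poly_in_def total_deg_le_iff mdeg_add intro: add_mono)
  qed
  then show ?case
    using pq by (intro exI[of _ "p * q"]) (auto simp: poly_in_def total_deg_le_iff peval_mult fun_eq_iff)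
next
  case (le d F e)
  then show ?case using order_trans by blast
qed

text \<open>Forgets the degree, so that sums of terms of different degree need no
  bookkeeping.\<close>

definition polynomial_fun :: "nat \<Rightarrow> ((nat \<Rightarrow> real) \<Rightarrow> real) \<Rightarrow> bool"
  where "polynomial_fun k F \<longleftrightarrow> (\<exists>d. polyfun k d F)"

named_theorems polynomial_intros

lemma polynomial_fun_const [polynomial_intros]: "polynomial_fun k (\<lambda>x. c)"
  using polyfun.const by (auto simp: polynomial_fun_def)

lemma polynomial_fun_coord [polynomial_intros]: "i < k \<Longrightarrow> polynomial_fun k (\<lambda>x. x i)"
  using polyfun.coord by (auto simp: polynomial_fun_def)

lemma polynomial_fun_add [polynomial_intros]:
  assumes "polynomial_fun k F" "polynomial_fun k G"
  shows "polynomial_fun k (\<lambda>x. F x + G x)"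
proof -
  obtain d e where "polyfun k d F" "polyfun k e G"
    using assms by (auto simp: polynomial_fun_def)
  then have "polyfun k (max d e) F" "polyfun k (max d e) G"
    by (auto intro: polyfun.le)
  then show ?thesis
    by (auto simp: polynomial_fun_def intro: polyfun.add)
qed

lemma polynomial_fun_mult [polynomial_intros]:
  "polynomial_fun k F \<Longrightarrow> polynomial_fun k G \<Longrightarrow> polynomial_fun k (\<lambda>x. F x * G x)"
  by (auto simp: polynomial_fun_def intro: polyfun.mult)

lemma polynomial_fun_diff [polynomial_intros]:
  assumes "polynomial_fun k F" "polynomial_fun k G"
  shows "polynomial_fun k (\<lambda>x. F x - G x)"
  using polynomial_fun_add[OF assms(1) polynomial_fun_mult[OF polynomial_fun_const[of k "-1"] assms(2)]]
  by simp

lemma polynomial_fun_power [polynomial_intros]: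
  "polynomial_fun k F \<Longrightarrow> polynomial_fun k (\<lambda>x. F x ^ r)"
  by (induction r) (auto intro: polynomial_intros)

lemma polynomial_fun_sum [polynomial_intros]:
  "(\<And>i. i \<in> I \<Longrightarrow> polynomial_fun k (F i)) \<Longrightarrow> polynomial_fun k (\<lambda>x. \<Sum>i\<in>I. F i x)"
  by (induction I rule: infinite_finite_induct) (auto intro: polynomial_intros)

lemma polynomial_fun_poly [polynomial_intros]:
  "polynomial_fun k F \<Longrightarrow> polynomial_fun k (\<lambda>x. poly p (F x))"
  by (induction p) (auto intro: polynomial_intros)

lemma polynomial_fun_peval:
  assumes "polynomial_fun k F"
  obtains p where "poly_in k p" "peval p = F"
  using assms polyfun_peval unfolding polynomial_fun_def by metis

lemma polynomial_fun_continuous: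
  assumes "polynomial_fun k F"
  shows "continuous_on S F"
proof -
  obtain d where "polyfun k d F"
    using assms by (auto simp: polynomial_fun_def)
  then show ?thesis
  proof induction
    case (coord i)
    show ?case
      by (rule continuous_on_coord)
  qed (auto intro: continuous_on_add continuous_on_mult continuous_on_const)
qed

lemma polynomial_fun_partial_derivative:
  assumes "polynomial_fun k F"
  shows "\<exists>F'. polynomial_fun k F' \<and>
    (\<forall>x. ((\<lambda>s. F (x(i := s))) has_real_derivative F' x) (at (x i)))"
proof -
  obtain d where "polyfun k d F"
    using assms by (auto simp: polynomial_fun_def)
  then show ?thesis
  proof induction
    case (const d c)
    show ?case
      by (intro exI[of _ "\<lambda>x. 0"]) (auto intro: polynomial_intros)
  next
    case (coord j)
    show ?case
      by (intro exI[of _ "\<lambda>x. if i = j then 1 else 0"]) (auto intro: polynomial_intros)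
  next
    case (add d F G)
    then obtain F' G' where "polynomial_fun k F'" "polynomial_fun k G'"
      "\<And>x. ((\<lambda>s. F (x(i := s))) has_real_derivative F' x) (at (x i))"
      "\<And>x. ((\<lambda>s. G (x(i := s))) has_real_derivative G' x) (at (x i))" by blast
    then show ?case
      by (intro exI[of _ "\<lambda>x. F' x + G' x"] conjI allI polynomial_fun_add DERIV_add)
  next
    case (mult d F e G)
    then obtain F' G' where *: "polynomial_fun k F'" "polynomial_fun k G'"
      "\<And>x. ((\<lambda>s. F (x(i := s))) has_real_derivative F' x) (at (x i))"
      "\<And>x. ((\<lambda>s. G (x(i := s))) has_real_derivative G' x) (at (x i))" by blast
    have "polynomial_fun k F" "polynomial_fun k G"
      using mult.hyps by (auto simp: polynomial_fun_def)
    moreover have "((\<lambda>s. F (x(i := s)) * G (x(i := s))) has_real_derivative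
        F' x * G x + G' x * F x) (at (x i))" for x
      using DERIV_mult[OF *(3)[of x] *(4)[of x]] by simp
    ultimately show ?case
      using *(1,2)
      by (intro exI[of _ "\<lambda>x. F' x * G x + G' x * F x"] conjI allI)
         (auto intro: polynomial_intros simp del: fun_upd_apply)
  qed auto
qed

text \<open>Partial derivatives of polynomial functions are polynomial again, so the induction on
  the order has to run over all polynomial functions at once.\<close>

lemma polynomial_fun_smooth:
  assumes "polynomial_fun k F"
  shows "smooth_fun_on n U F"
proof -
  have "Ck_on n r U F" if "polynomial_fun k F" for r F
    using that
  proof (induction r arbitrary: F)
    case 0
    then show ?case by (simp add: polynomial_fun_continuous)
  next
    case (Suc r)
    obtain F' where "\<And>i. polynomial_fun k (F' i)"
      "\<And>i x. ((\<lambda>s. F (x(i := s))) has_real_derivative F' i x) (at (x i))"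
      using polynomial_fun_partial_derivative[OF Suc.prems] by metis
    then show ?case
      using Suc by (auto intro!: exI[of _ F'] polynomial_fun_continuous)
  qed
  with assms show ?thesis by (auto simp: smooth_fun_on_def)
qed

subsection \<open>Ranks\<close>

lemma fun_dim_zero: "A \<subseteq> {0} \<Longrightarrow> fun_dim A = 0"
proof -
  interpret vector_space scale_fun by (rule vector_space_scale_fun)
  assume "A \<subseteq> {0}"
  \<comment> \<open>The right-hand side is a roundabout 0: \<open>A\<close> lies in the span of the
    empty set.\<close>
  then have "dim A \<le> card {0 :: nat \<Rightarrow> real} - 1"
    using dim_le_card[of A "{}"] by (auto simp: span_empty)
  then show ?thesis by (simp add: fun_dim_def)
qed

lemma fun_dim_Rn: "fun_dim (Rn r) = r"
proof -
  interpret vector_space scale_fun by (rule vector_space_scale_fun)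
  define e where "e i = (\<lambda>j. if j = i then 1 else 0 :: real)" for i :: nat
  have sum_apply: "(\<Sum>i\<in>I. F i) j = (\<Sum>i\<in>I. F i j :: real)" for I :: "nat set" and F and j :: nat
    by (induction I rule: infinite_finite_induct) auto
  have sum_e: "(\<Sum>i<r. scale_fun (x i) (e i)) = (\<lambda>j. if j < r then x j else 0)" for x
    by (auto simp: fun_eq_iff sum_apply scale_fun_def e_def if_distrib cong: if_cong)
  have inj: "inj_on e {..<r}"
    by (auto simp: inj_on_def e_def fun_eq_iff split: if_splits)
  have "independent (e ` {..<r})"
  proof (rule independent_if_scalars_zero)
    fix f x assume "(\<Sum>x\<in>e ` {..<r}. scale_fun (f x) x) = 0" "x \<in> e ` {..<r}"
    then show "f x = 0"
      using sum_e[of "\<lambda>i. f (e i)"] by (auto simp: sum.reindex[OF inj] fun_eq_iff split: if_splits)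
  qed simp
  moreover have "span (e ` {..<r}) = Rn r"
  proof
    have "subspace (Rn r)"
      by (auto simp: subspace_def Rn_iff scale_fun_def)
    then show "span (e ` {..<r}) \<subseteq> Rn r"
      by (rule span_minimal[rotated]) (auto simp: Rn_iff e_def)
    show "Rn r \<subseteq> span (e ` {..<r})"
    proof
      fix x assume "x \<in> Rn r"
      then have "x = (\<Sum>i<r. scale_fun (x i) (e i))"
        by (auto simp: sum_e Rn_iff fun_eq_iff)
      then show "x \<in> span (e ` {..<r})"
        by (metis (no_types, lifting) imageI span_base span_scale span_sum)
    qed
  qed
  ultimately have "dim (Rn r) = card (e ` {..<r})"
    by (metis dim_eq_card_independent dim_span)
  then show ?thesis
    by (simp add: fun_dim_def card_image[OF inj])
qed

text \<open>From index \<open>r\<close> on the coordinates of \<open>tuple r h\<close> are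
  constantly 0, and velocities are unique. This is the upper bound in every rank
  computation.\<close>

lemma differential_image_tuple_subset: "differential_image X (tuple r h) x \<subseteq> Rn r"
proof
  fix w assume "w \<in> differential_image X (tuple r h) x"
  then obtain \<gamma> where \<gamma>: "has_velocity (tuple r h \<circ> \<gamma>) w"
    by (auto simp: differential_image_def)
  have "w i = 0" if "i \<ge> r" for i
  proof -
    have "((\<lambda>s. 0) has_real_derivative w i) (at (0::real))"
      using \<gamma>[unfolded has_velocity_def, rule_format, of i] that by (simp add: tuple_def)
    then show ?thesis
      using DERIV_unique[OF _ DERIV_const] by blast
  qed
  then show "w \<in> Rn r" by (simp add: Rn_iff)
qed

text \<open>Once every \<open>\<omega>\<close> is realised by a curve, the differential image is all
  of \<open>Rn r\<close>, so its dimension is read off without a separate proof that the image is a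
  linear subspace.\<close>

lemma diff_rank_full:
  assumes "\<And>\<omega>. \<exists>\<gamma> v. \<gamma> 0 = x \<and> (\<forall>\<^sub>F s in nhds 0. \<gamma> s \<in> X) \<and> has_velocity \<gamma> v \<and>
    (\<forall>j<r. ((\<lambda>s. h j (\<gamma> s)) has_real_derivative \<omega> j) (at 0))"
  shows "diff_rank X (tuple r h) x = r"
proof -
  have "\<omega> \<in> differential_image X (tuple r h) x" if "\<omega> \<in> Rn r" for \<omega>
  proof -
    obtain \<gamma> v where *: "\<gamma> 0 = x" "\<forall>\<^sub>F s in nhds 0. \<gamma> s \<in> X" "has_velocity \<gamma> v"
      "\<forall>j<r. ((\<lambda>s. h j (\<gamma> s)) has_real_derivative \<omega> j) (at 0)"
      using assms[of \<omega>] by blast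
    have "((\<lambda>s. (tuple r h \<circ> \<gamma>) s i) has_real_derivative \<omega> i) (at 0)" for i
      using *(4) that by (cases "i < r") (auto simp: tuple_def Rn_iff)
    with * show ?thesis
      by (auto simp: differential_image_def has_velocity_def)
  qed
  then have "differential_image X (tuple r h) x = Rn r"
    using differential_image_tuple_subset by blast
  then show ?thesis
    by (simp add: diff_rank_def fun_dim_Rn)
qed

text \<open>In the whole space straight lines can serve as the curves.\<close>

lemma diff_rank_full_line:
  assumes "x \<in> Rn k"
    and "\<And>\<omega>. \<exists>v\<in>Rn k. \<forall>j<r. ((\<lambda>s. h j (\<lambda>i. x i + s * v i)) has_real_derivative \<omega> j) (at 0)"
  shows "diff_rank (Rn k) (tuple r h) x = r"
proof (rule diff_rank_full)
  fix \<omega>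
  obtain v where v: "v \<in> Rn k"
    "\<forall>j<r. ((\<lambda>s. h j (\<lambda>i. x i + s * v i)) has_real_derivative \<omega> j) (at 0)"
    using assms(2) by blast
  have "has_velocity (\<lambda>s i. x i + s * v i) v"
    unfolding has_velocity_def by (auto intro!: derivative_eq_intros)
  moreover have "(\<lambda>i. x i + s * v i) \<in> Rn k" for s
    using v(1) assms(1) by (simp add: Rn_iff)
  ultimately show "\<exists>\<gamma> v. \<gamma> 0 = x \<and> (\<forall>\<^sub>F s in nhds 0. \<gamma> s \<in> Rn k) \<and> has_velocity \<gamma> v \<and>
    (\<forall>j<r. ((\<lambda>s. h j (\<gamma> s)) has_real_derivative \<omega> j) (at 0))"
    by (intro exI[of _ "\<lambda>s i. x i + s * v i"] exI[of _ v] conjI v(2) always_eventually allI) simp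
qed

lemma diff_rank_zero:
  assumes "\<And>\<gamma> v w. \<gamma> 0 = x \<Longrightarrow> \<forall>\<^sub>F s in nhds 0. \<gamma> s \<in> X \<Longrightarrow> has_velocity \<gamma> v \<Longrightarrow>
    ((\<lambda>s. f (\<gamma> s)) has_real_derivative w) (at 0) \<Longrightarrow> w = 0"
  shows "diff_rank X (tuple 1 (\<lambda>_. f)) x = 0"
  unfolding diff_rank_def
proof (rule fun_dim_zero, rule subsetI)
  fix w assume w: "w \<in> differential_image X (tuple 1 (\<lambda>_. f)) x"
  then obtain \<gamma> v where "\<gamma> 0 = x" "\<forall>\<^sub>F s in nhds 0. \<gamma> s \<in> X" "has_velocity \<gamma> v"
    and "has_velocity (tuple 1 (\<lambda>_. f) \<circ> \<gamma>) w"
    by (auto simp: differential_image_def)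
  moreover from this have "((\<lambda>s. f (\<gamma> s)) has_real_derivative w 0) (at 0)"
    unfolding has_velocity_def by (auto simp: tuple_def o_def dest: spec[of _ 0])
  ultimately have "w 0 = 0" using assms by blast
  moreover have "w \<in> Rn 1"
    using w differential_image_tuple_subset by blast
  ultimately have "w i = 0" for i
    by (cases "i = 0") (auto simp: Rn_iff)
  then show "w \<in> {0}"
    by (simp add: fun_eq_iff)
qed

subsection \<open>CW structures\<close>

text \<open>The bound holds for all infinitely many coordinates, so \<open>S\<close> is a closed
  part of a cube that is compact by Tychonoff.\<close>

lemma compact_bounded_fun:
  fixes S :: "(nat \<Rightarrow> real) set"
  assumes "closed S" and "\<And>x i. x \<in> S \<Longrightarrow> \<bar>x i\<bar> \<le> B"
  shows "compact S"
proof -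
  let ?P = "PiE UNIV (\<lambda>i::nat. {-B..B})"
  have "compact_space (product_topology (\<lambda>i::nat. top_of_set {-B..B}) UNIV)"
    by (simp add: compact_space_product_topology compact_space_subtopology)
  then have "compactin euclidean ?P"
    by (simp add: compactin_subspace subtopology_product_topology flip: euclidean_product_topology)
  then have "compact ?P" by simp
  moreover have "S \<subseteq> ?P"
    using assms(2) by (auto simp: abs_le_iff minus_le_iff)
  ultimately show ?thesis
    using assms(1) compact_Int_closed by (metis Int_absorb1)
qed

lemma closed_disc_subset: "closed_disc e \<subseteq> Rn e"
  and open_disc_subset: "open_disc e \<subseteq> closed_disc e"
  by (auto simp: closed_disc_def open_disc_def)

lemma compact_closed_disc: "compact (closed_disc e)"
proof (rule compact_bounded_fun)
  have "closed {x :: nat \<Rightarrow> real. (\<Sum>i<e. (x i)\<^sup>2) \<le> 1}"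
    by (intro closed_Collect_le continuous_on_sum continuous_on_power continuous_on_coord continuous_on_const)
  then show "closed (closed_disc e)"
    using closed_Int[OF closed_Rn[of e]] by (simp add: closed_disc_def Collect_conj_eq)
  fix x i assume x: "x \<in> closed_disc e"
  show "\<bar>x i\<bar> \<le> 1"
  proof (cases "i < e")
    case True
    then have "(x i)\<^sup>2 \<le> (\<Sum>i<e. (x i)\<^sup>2)"
      by (intro member_le_sum) auto
    then have "(x i)\<^sup>2 \<le> 1"
      using x by (simp add: closed_disc_def)
    then show ?thesis
      by (simp add: abs_square_le_1)
  next
    case False
    then show ?thesis using x by (simp add: closed_disc_def Rn_iff)
  qed
qed

text \<open>The segments from the points of \<open>S\<close> to the origin lie in \<open>S\<close>
  and all contain the origin.\<close>

lemma connected_star: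
  fixes S :: "(nat \<Rightarrow> real) set"
  assumes "\<And>x c. x \<in> S \<Longrightarrow> 0 \<le> c \<Longrightarrow> c \<le> 1 \<Longrightarrow> (\<lambda>i. c * x i) \<in> S"
  shows "connected S"
proof -
  define seg :: "(nat \<Rightarrow> real) \<Rightarrow> (nat \<Rightarrow> real) set"
    where "seg x = (\<lambda>c i. c * x i) ` {0..1}" for x
  have "connected (seg x)" for x
    unfolding seg_def
    by (intro connected_continuous_image continuous_on_coordinatewise_then_product)
       (auto intro: continuous_on_mult_right continuous_on_id)
  moreover have "(\<lambda>i. 0) \<in> seg x" "x \<in> seg x" for x
    by (force simp: seg_def)+
  moreover have "S = \<Union>(seg ` S)"
    using assms calculation(3) by (auto simp: seg_def)
  moreover have "connected (\<Union>(seg ` S))"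
  proof (rule connected_Union)
    have "(\<lambda>i. 0) \<in> \<Inter>(seg ` S)"
      using calculation(2) by simp
    then show "\<Inter>(seg ` S) \<noteq> {}" by blast
  qed (use calculation(1) in auto)
  ultimately show ?thesis by simp
qed

text \<open>Local finiteness implies the weak topology and, unlike the latter, passes to products.\<close>

locale lf_cw =
  fixes A :: "'a::t2_space set" and I :: "'i set" and dm :: "'i \<Rightarrow> nat"
    and \<phi> :: "'i \<Rightarrow> (nat \<Rightarrow> real) \<Rightarrow> 'a"
  assumes cont: "i \<in> I \<Longrightarrow> continuous_on (closed_disc (dm i)) (\<phi> i)"
    and into: "i \<in> I \<Longrightarrow> x \<in> closed_disc (dm i) \<Longrightarrow> \<phi> i x \<in> A"
    and homeo: "i \<in> I \<Longrightarrow> \<exists>g. homeomorphism (open_disc (dm i)) (\<phi> i ` open_disc (dm i)) (\<phi> i) g"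
    and cover: "a \<in> A \<Longrightarrow> \<exists>i\<in>I. a \<in> \<phi> i ` open_disc (dm i)"
    and disjoint: "i \<in> I \<Longrightarrow> j \<in> I \<Longrightarrow> x \<in> open_disc (dm i) \<Longrightarrow> y \<in> open_disc (dm j) \<Longrightarrow>
      \<phi> i x = \<phi> j y \<Longrightarrow> i = j"
    and boundary: "i \<in> I \<Longrightarrow> \<exists>F\<subseteq>I. finite F \<and> (\<forall>j\<in>F. dm j < dm i) \<and>
      \<phi> i ` (closed_disc (dm i) - open_disc (dm i)) \<subseteq> (\<Union>j\<in>F. \<phi> j ` open_disc (dm j))"
    and loc_finite: "a \<in> A \<Longrightarrow> \<exists>U. open U \<and> a \<in> U \<and> finite {i\<in>I. \<phi> i ` closed_disc (dm i) \<inter> U \<noteq> {}}"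
begin

text \<open>For the weak topology: closed cells are compact, hence closed, so a closed set has
  closed traces on them; conversely a set is the union of its traces on the closed cells, and a
  locally finite union of closed sets is closed.\<close>

lemma CW_structure: "CW_structure (top_of_set A) ((\<lambda>i. (dm i, \<phi> i)) ` I)"
  unfolding CW_structure_def
proof (intro conjI allI impI)
  have top_closed: "subtopology (Euclidean_space e) (closed_disc e) = top_of_set (closed_disc e)"
    and top_open: "subtopology (Euclidean_space e) (open_disc e) = top_of_set (open_disc e)" for e
    using closed_disc_subset open_disc_subset by (metis subtopology_Euclidean_space order_trans)+
  show "Hausdorff_space (top_of_set A)"
    by (rule Hausdorff_space_subtopology) (simp add: Hausdorff_space_def disjnt_def, metis hausdorff)
  show "topspace (top_of_set A) = (\<Union>(e, \<phi>)\<in>(\<lambda>i. (dm i, \<phi> i)) ` I. \<phi> ` open_disc e)"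
    using cover into open_disc_subset by fastforce
  show "pairwise (\<lambda>(e, \<phi>) (e', \<phi>'). disjnt (\<phi> ` open_disc e) (\<phi>' ` open_disc e'))
      ((\<lambda>i. (dm i, \<phi> i)) ` I)"
    unfolding pairwise_def disjnt_def using disjoint by fastforce
  have "continuous_map (subtopology (Euclidean_space (dm i)) (closed_disc (dm i))) (top_of_set A) (\<phi> i) \<and>
      embedding_map (subtopology (Euclidean_space (dm i)) (open_disc (dm i))) (top_of_set A) (\<phi> i)"
    if i: "i \<in> I" for i
  proof -
    obtain g where g: "homeomorphism (open_disc (dm i)) (\<phi> i ` open_disc (dm i)) (\<phi> i) g"
      using homeo[OF i] by auto
    have "\<phi> i ` open_disc (dm i) \<subseteq> A"
      using into[OF i] open_disc_subset by blast
    then have "subtopology (top_of_set A) (\<phi> i ` open_disc (dm i)) = top_of_set (\<phi> i ` open_disc (dm i))"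
      by (simp add: subtopology_subtopology Int_absorb1)
    moreover have "homeomorphic_map (top_of_set (open_disc (dm i))) (top_of_set (\<phi> i ` open_disc (dm i))) (\<phi> i)"
      using g unfolding homeomorphic_map_maps homeomorphic_maps_def homeomorphism_def by auto
    ultimately show ?thesis
      using cont[OF i] into[OF i] by (auto simp: top_closed top_open embedding_map_def)
  qed
  then show "\<forall>(e, \<phi>)\<in>(\<lambda>i. (dm i, \<phi> i)) ` I.
      continuous_map (subtopology (Euclidean_space e) (closed_disc e)) (top_of_set A) \<phi> \<and>
      embedding_map (subtopology (Euclidean_space e) (open_disc e)) (top_of_set A) \<phi>"
    by simp
  show "\<forall>(e, \<psi>)\<in>(\<lambda>i. (dm i, \<phi> i)) ` I. \<exists>F\<subseteq>(\<lambda>i. (dm i, \<phi> i)) ` I. finite F \<and>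
      (\<forall>(e', \<psi>')\<in>F. e' < e) \<and>
      \<psi> ` (closed_disc e - open_disc e) \<subseteq> (\<Union>(e', \<psi>')\<in>F. \<psi>' ` open_disc e')"
  proof clarify
    fix i assume "i \<in> I"
    then obtain F where "F \<subseteq> I" "finite F" "\<forall>j\<in>F. dm j < dm i"
      "\<phi> i ` (closed_disc (dm i) - open_disc (dm i)) \<subseteq> (\<Union>j\<in>F. \<phi> j ` open_disc (dm j))"
      using boundary by meson
    then show "\<exists>F\<subseteq>(\<lambda>i. (dm i, \<phi> i)) ` I. finite F \<and> (\<forall>(e', \<psi>')\<in>F. e' < dm i) \<and>
        \<phi> i ` (closed_disc (dm i) - open_disc (dm i)) \<subseteq> (\<Union>(e', \<psi>')\<in>F. \<psi>' ` open_disc e')"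
      by (intro exI[of _ "(\<lambda>i. (dm i, \<phi> i)) ` F"] conjI) (simp_all add: image_mono)
  qed
  fix B assume "B \<subseteq> topspace (top_of_set A)"
  then have B: "B \<subseteq> A" by simp
  define cell where "cell i = B \<inter> \<phi> i ` closed_disc (dm i)" for i
  have "closedin (top_of_set A) B \<longleftrightarrow> (\<forall>i\<in>I. closedin (top_of_set A) (cell i))"
  proof
    assume closed: "closedin (top_of_set A) B"
    have "closedin (top_of_set A) (\<phi> i ` closed_disc (dm i))" if "i \<in> I" for i
    proof -
      have "closed (\<phi> i ` closed_disc (dm i))"
        by (rule compact_imp_closed[OF compact_continuous_image[OF cont[OF that] compact_closed_disc]])
      moreover have "\<phi> i ` closed_disc (dm i) \<subseteq> A"
        using into[OF that] by auto
      ultimately show ?thesis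
        by (rule closed_subset[rotated])
    qed
    then show "\<forall>i\<in>I. closedin (top_of_set A) (cell i)"
      using closed by (auto simp: cell_def)
  next
    assume cells: "\<forall>i\<in>I. closedin (top_of_set A) (cell i)"
    have "closedin (top_of_set A) (\<Union>(cell ` I))"
    proof (rule closedin_locally_finite_Union)
      show "closedin (top_of_set A) T" if "T \<in> cell ` I" for T
        using cells that by auto
      have "\<exists>V. openin (top_of_set A) V \<and> x \<in> V \<and> finite {T \<in> cell ` I. T \<inter> V \<noteq> {}}"
        if "x \<in> A" for x
      proof -
        obtain U where U: "open U" "x \<in> U"
          "finite {i\<in>I. \<phi> i ` closed_disc (dm i) \<inter> U \<noteq> {}}" (is "finite ?D")
          using loc_finite \<open>x \<in> A\<close> by blast
        have "{T \<in> cell ` I. T \<inter> (A \<inter> U) \<noteq> {}} \<subseteq> cell ` ?D"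
          by (auto simp: cell_def)
        then have "finite {T \<in> cell ` I. T \<inter> (A \<inter> U) \<noteq> {}}"
          using U(3) finite_surj by blast
        then show ?thesis
          using U(1,2) \<open>x \<in> A\<close> by (intro exI[of _ "A \<inter> U"] conjI openin_open_Int) auto
      qed
      then show "locally_finite_in (top_of_set A) (cell ` I)"
        using B by (auto simp: locally_finite_in_def cell_def)
    qed
    moreover have "\<Union>(cell ` I) = B"
    proof
      show "B \<subseteq> \<Union>(cell ` I)"
      proof
        fix b assume "b \<in> B"
        then obtain i where "i \<in> I" "b \<in> \<phi> i ` open_disc (dm i)"
          using B cover by blast
        then show "b \<in> \<Union>(cell ` I)"
          using \<open>b \<in> B\<close> open_disc_subset by (auto simp: cell_def)
      qed
    qed (auto simp: cell_def)
    ultimately show "closedin (top_of_set A) B" by simp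
  qed
  then show "closedin (top_of_set A) B \<longleftrightarrow>
      (\<forall>(e, \<phi>)\<in>(\<lambda>i. (dm i, \<phi> i)) ` I. closedin (top_of_set A) (B \<inter> \<phi> ` closed_disc e))"
    by (simp add: cell_def)
qed

text \<open>Carries the model structures on the line, the cylinder and the sphere over to the
  fibers.\<close>

lemma lf_cw_homeomorphism:
  fixes f :: "'a \<Rightarrow> 'b::t2_space"
  assumes hom: "homeomorphism A B f g"
  shows "lf_cw B I dm (\<lambda>i x. f (\<phi> i x))"
proof
  have f: "continuous_on A f" "inj_on f A" "f ` A = B" and g: "continuous_on B g"
    "\<And>a. a \<in> A \<Longrightarrow> g (f a) = a" "g ` B = A"
    using hom by (auto simp: homeomorphism_def inj_on_def) metis
  have into_open: "\<phi> i x \<in> A" if "i \<in> I" "x \<in> open_disc (dm i)" for i x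
    using into open_disc_subset that by blast
  fix i assume i: "i \<in> I"
  show "continuous_on (closed_disc (dm i)) (\<lambda>x. f (\<phi> i x))"
    using cont[OF i] into[OF i] f(1) by (rule_tac continuous_on_compose2) auto
  show "f (\<phi> i x) \<in> B" if "x \<in> closed_disc (dm i)" for x
    using into[OF i that] f(3) by auto
  obtain h where h: "homeomorphism (open_disc (dm i)) (\<phi> i ` open_disc (dm i)) (\<phi> i) h"
    using homeo[OF i] by blast
  have "homeomorphism (\<phi> i ` open_disc (dm i)) (f ` \<phi> i ` open_disc (dm i)) f g"
    using hom by (rule homeomorphism_of_subsets) (use f into_open[OF i] in auto)
  from homeomorphism_compose[OF h this]
  show "\<exists>h. homeomorphism (open_disc (dm i)) ((\<lambda>x. f (\<phi> i x)) ` open_disc (dm i)) (\<lambda>x. f (\<phi> i x)) h"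
    by (auto simp: image_comp o_def)
  show "i = j" if "j \<in> I" "x \<in> open_disc (dm i)" "y \<in> open_disc (dm j)" "f (\<phi> i x) = f (\<phi> j y)" for j x y
    using disjoint[OF i that(1-3)] into_open[OF i that(2)] into_open[OF that(1,3)] f(2) that(4)
    by (auto simp: inj_on_def)
  obtain F where F: "F \<subseteq> I" "finite F" "\<forall>j\<in>F. dm j < dm i"
    "\<phi> i ` (closed_disc (dm i) - open_disc (dm i)) \<subseteq> (\<Union>j\<in>F. \<phi> j ` open_disc (dm j))"
    using boundary[OF i] by meson
  have "(\<lambda>x. f (\<phi> i x)) ` (closed_disc (dm i) - open_disc (dm i))
      = f ` \<phi> i ` (closed_disc (dm i) - open_disc (dm i))"
    by (simp add: image_comp o_def)
  also have "\<dots> \<subseteq> f ` (\<Union>j\<in>F. \<phi> j ` open_disc (dm j))"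
    using F(4) by (rule image_mono)
  also have "\<dots> = (\<Union>j\<in>F. (\<lambda>x. f (\<phi> j x)) ` open_disc (dm j))"
    by (simp add: image_UN image_comp o_def)
  finally show "\<exists>F\<subseteq>I. finite F \<and> (\<forall>j\<in>F. dm j < dm i) \<and>
      (\<lambda>x. f (\<phi> i x)) ` (closed_disc (dm i) - open_disc (dm i)) \<subseteq> (\<Union>j\<in>F. (\<lambda>x. f (\<phi> j x)) ` open_disc (dm j))"
    using F by blast
next
  have f: "f ` A = B" and g: "continuous_on B g" "\<And>a. a \<in> A \<Longrightarrow> g (f a) = a" "g ` B = A"
    "\<And>b. b \<in> B \<Longrightarrow> f (g b) = b"
    using hom by (auto simp: homeomorphism_def)
  fix b assume "b \<in> B"
  then have "g b \<in> A" using g(3) by blast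
  then obtain i x where "i \<in> I" "x \<in> open_disc (dm i)" "g b = \<phi> i x"
    using cover by blast
  then show "\<exists>i\<in>I. b \<in> (\<lambda>x. f (\<phi> i x)) ` open_disc (dm i)"
    using g(4)[OF \<open>b \<in> B\<close>] by (metis image_eqI)
  obtain U where U: "open U" "g b \<in> U" "finite {i\<in>I. \<phi> i ` closed_disc (dm i) \<inter> U \<noteq> {}}"
    using loc_finite[OF \<open>g b \<in> A\<close>] by blast
  \<comment> \<open>A neighbourhood meeting finitely many cells of \<open>A\<close> is pulled back
    along the inverse \<open>g\<close>; \<open>V\<close> extends the result to an open set of the
    whole space.\<close>
  obtain V where V: "open V" "V \<inter> B = g -` U \<inter> B"
    using g(1) U(1) unfolding continuous_on_open_invariant by metis
  have "\<phi> i x \<in> U" if "i \<in> I" "x \<in> closed_disc (dm i)" "f (\<phi> i x) \<in> V" for i x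
  proof -
    have "\<phi> i x \<in> A" using into that by blast
    then show ?thesis using V(2) that(3) f g(2) by (metis IntD1 IntI imageI vimageE)
  qed
  then have "{i\<in>I. (\<lambda>x. f (\<phi> i x)) ` closed_disc (dm i) \<inter> V \<noteq> {}}
      \<subseteq> {i\<in>I. \<phi> i ` closed_disc (dm i) \<inter> U \<noteq> {}}"
    by auto
  from finite_subset[OF this U(3)]
  have "finite {i\<in>I. (\<lambda>x. f (\<phi> i x)) ` closed_disc (dm i) \<inter> V \<noteq> {}}" .
  moreover have "b \<in> V"
    using V(2) U(2) \<open>b \<in> B\<close> by blast
  ultimately show "\<exists>U. open U \<and> b \<in> U \<and> finite {i\<in>I. (\<lambda>x. f (\<phi> i x)) ` closed_disc (dm i) \<inter> U \<noteq> {}}"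
    using V(1) by blast
qed

end

text \<open>At a zero of \<open>q\<close> the quotient stays bounded while \<open>f\<close> tends to
  0. This handles the points where both norms vanish, at which the radial scaling factors below can
  be discontinuous.\<close>

lemma continuous_on_quotient_mult:
  fixes p q f :: "'a::topological_space \<Rightarrow> real"
  assumes "continuous_on UNIV p" "continuous_on UNIV q" "continuous_on UNIV f" "0 \<le> K"
    and bound: "\<And>x. \<bar>p x\<bar> \<le> K * \<bar>q x\<bar>" and zero: "\<And>x. q x = 0 \<Longrightarrow> f x = 0"
  shows "continuous_on UNIV (\<lambda>x. p x / q x * f x)"
proof -
  have "((\<lambda>y. p y / q y * f y) \<longlongrightarrow> p x / q x * f x) (at x)" for x
  proof -
    have lim: "(p \<longlongrightarrow> p x) (at x)" "(q \<longlongrightarrow> q x) (at x)" "(f \<longlongrightarrow> f x) (at x)"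
      using assms(1-3) by (auto simp: continuous_on_def)
    show ?thesis
    proof (cases "q x = 0")
      case True
      \<comment> \<open>Where \<open>q y = 0\<close> the quotient is 0 by the convention on
        division, so the bound has no exceptions.\<close>
      have "\<bar>p y / q y\<bar> \<le> K" for y
        using bound[of y] \<open>0 \<le> K\<close> by (cases "q y = 0") (auto simp: abs_divide divide_le_eq)
      from mult_left_mono[OF this abs_ge_zero]
      have "norm (p y / q y * f y) \<le> norm (f y) * K" for y
        by (simp only: real_norm_def abs_mult mult.commute)
      then have "\<forall>\<^sub>F y in at x. norm (p y / q y * f y) \<le> norm (f y) * K"
        by (intro always_eventually allI)
      moreover have "(f \<longlongrightarrow> 0) (at x)"
        using lim(3) zero[OF True] by simp
      ultimately have "((\<lambda>y. p y / q y * f y) \<longlongrightarrow> 0) (at x)"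
        by (rule tendsto_0_le[rotated])
      then show ?thesis
        using zero[OF True] by simp
    next
      case False
      then show ?thesis
        using lim by (intro tendsto_mult tendsto_divide)
    qed
  qed
  then show ?thesis
    by (simp add: continuous_on_def)
qed

section \<open>Discs as products of discs\<close>

definition sqnorm :: "nat \<Rightarrow> (nat \<Rightarrow> real) \<Rightarrow> real"
  where "sqnorm n x = (\<Sum>i<n. (x i)\<^sup>2)"

lemma closed_disc_sqnorm: "closed_disc n = {x \<in> Rn n. sqnorm n x \<le> 1}"
  and open_disc_sqnorm: "open_disc n = {x \<in> Rn n. sqnorm n x < 1}"
  by (simp_all add: closed_disc_def open_disc_def sqnorm_def)

lemma sqnorm_nonneg: "0 \<le> sqnorm n x"
  by (simp add: sqnorm_def sum_nonneg)

lemma continuous_on_sqnorm: "continuous_on S (sqnorm n)"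
  unfolding sqnorm_def [abs_def]
  by (intro continuous_on_sum continuous_on_power continuous_on_coord)

lemma sqnorm_eq_0: "sqnorm n x = 0 \<Longrightarrow> i < n \<Longrightarrow> x i = 0"
  by (simp add: sqnorm_def sum_nonneg_eq_0_iff)

lemma sqnorm_scale:
  assumes "\<And>i. i < n \<Longrightarrow> y i = c * x i"
  shows "sqnorm n y = c\<^sup>2 * sqnorm n x"
  using assms by (simp add: sqnorm_def sum_distrib_left power_mult_distrib)

lemma sqnorm_add: "sqnorm (a + b) x = sqnorm a x + sqnorm b (\<lambda>i. x (a + i))"
  by (induction b) (auto simp: sqnorm_def)

lemma continuous_on_shift: "continuous_on S (\<lambda>x :: nat \<Rightarrow> real. \<lambda>i. x (a + i))"
  by (intro continuous_on_coordinatewise_then_product continuous_on_coord)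

text \<open>
  The radial homeomorphism from the unit ball for the Euclidean norm on \<open>\<real>\<^sup>a \<times> \<real>\<^sup>b\<close> to the unit ball
  for the maximum of the two Euclidean norms. At the origin both scaling factors are \<open>0 / 0 = 0\<close>.
\<close>

definition disc_split :: "nat \<Rightarrow> nat \<Rightarrow> (nat \<Rightarrow> real) \<Rightarrow> (nat \<Rightarrow> real) \<times> (nat \<Rightarrow> real)" where
  "disc_split a b x =
    (let P = sqnorm a x; Q = sqnorm b (\<lambda>i. x (a + i)); c = sqrt (P + Q) / sqrt (max P Q)
     in (\<lambda>i. c * (if i < a then x i else 0), \<lambda>i. c * (if i < b then x (a + i) else 0)))"

definition disc_join :: "nat \<Rightarrow> nat \<Rightarrow> (nat \<Rightarrow> real) \<times> (nat \<Rightarrow> real) \<Rightarrow> nat \<Rightarrow> real" where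
  "disc_join a b = (\<lambda>(u, v).
    let P = sqnorm a u; Q = sqnorm b v; c = sqrt (max P Q) / sqrt (P + Q)
    in (\<lambda>i. c * (if i < a then u i else if i < a + b then v (i - a) else 0)))"

text \<open>Here \<open>c\<close> does not depend on the point; in the uses below it is a test of a
  coordinate index.\<close>

lemma continuous_on_if_const:
  "(c \<Longrightarrow> continuous_on S f) \<Longrightarrow> (\<not> c \<Longrightarrow> continuous_on S g) \<Longrightarrow>
    continuous_on S (\<lambda>x. if c then f x else g x)"
  by (cases c) simp_all

lemma continuous_on_disc_split: "continuous_on UNIV (disc_split a b)"
proof -
  let ?P = "sqnorm a" and ?Q = "\<lambda>x. sqnorm b (\<lambda>i. x (a + i))"
  \<comment> \<open>The sum of two non-negative numbers is at most twice the larger one, so the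
    scaling factor is at most \<open>sqrt 2\<close>.\<close>
  have le: "\<bar>sqrt (p + q)\<bar> \<le> sqrt 2 * \<bar>sqrt (max p q)\<bar>" if "0 \<le> p" "0 \<le> q" for p q :: real
    using that by (auto simp: max_def simp flip: real_sqrt_mult)
  have Q: "continuous_on UNIV ?Q"
    by (rule continuous_on_compose2[OF continuous_on_sqnorm continuous_on_shift]) auto
  have *: "continuous_on UNIV (\<lambda>x. sqrt (?P x + ?Q x) / sqrt (max (?P x) (?Q x)) * f x)"
    if "continuous_on UNIV f" and f: "\<And>x. ?P x = 0 \<Longrightarrow> ?Q x = 0 \<Longrightarrow> f x = 0" for f
  proof (rule continuous_on_quotient_mult)
    show "\<bar>sqrt (?P x + ?Q x)\<bar> \<le> sqrt 2 * \<bar>sqrt (max (?P x) (?Q x))\<bar>" for x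
      using le[OF sqnorm_nonneg sqnorm_nonneg] .
    show "f x = 0" if "sqrt (max (?P x) (?Q x)) = 0" for x
      using that sqnorm_nonneg[of a x] sqnorm_nonneg[of b "\<lambda>i. x (a + i)"]
      by (intro f) (auto simp: max_def split: if_splits)
  qed (use Q that in \<open>auto intro!: continuous_on_add continuous_on_max continuous_on_real_sqrt continuous_on_sqnorm\<close>)
  show ?thesis
    unfolding disc_split_def [abs_def] Let_def
    by (intro continuous_on_Pair continuous_on_coordinatewise_then_product *
          continuous_on_if_const continuous_on_coord continuous_on_const)
       (auto dest: sqnorm_eq_0)
qed

lemma continuous_on_disc_join: "continuous_on UNIV (disc_join a b)"
proof -
  let ?P = "\<lambda>w. sqnorm a (fst w)" and ?Q = "\<lambda>w. sqnorm b (snd w)"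
  \<comment> \<open>The inverse scaling factor is at most 1.\<close>
  have le: "\<bar>sqrt (max p q)\<bar> \<le> 1 * \<bar>sqrt (p + q)\<bar>" if "0 \<le> p" "0 \<le> q" for p q :: real
    using that by (simp add: max_def)
  have P: "continuous_on UNIV ?P"
    by (rule continuous_on_compose2[OF continuous_on_sqnorm continuous_on_fst[OF continuous_on_id] subset_UNIV])
  have Q: "continuous_on UNIV ?Q"
    by (rule continuous_on_compose2[OF continuous_on_sqnorm continuous_on_snd[OF continuous_on_id] subset_UNIV])
  have *: "continuous_on UNIV (\<lambda>w. sqrt (max (?P w) (?Q w)) / sqrt (?P w + ?Q w) * f w)"
    if "continuous_on UNIV f" and f: "\<And>w. ?P w = 0 \<Longrightarrow> ?Q w = 0 \<Longrightarrow> f w = 0" for f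
  proof (rule continuous_on_quotient_mult)
    show "\<bar>sqrt (max (?P w) (?Q w))\<bar> \<le> 1 * \<bar>sqrt (?P w + ?Q w)\<bar>" for w
      using le[OF sqnorm_nonneg sqnorm_nonneg] .
    show "f w = 0" if "sqrt (?P w + ?Q w) = 0" for w
      using that sqnorm_nonneg[of a "fst w"] sqnorm_nonneg[of b "snd w"]
      by (intro f) (auto simp: add_nonneg_eq_0_iff)
  qed (use P Q that in \<open>auto intro!: continuous_on_add continuous_on_max continuous_on_real_sqrt\<close>)
  have u: "continuous_on UNIV (\<lambda>w :: (nat \<Rightarrow> real) \<times> (nat \<Rightarrow> real). fst w i)" for i
    by (rule continuous_on_compose2[OF continuous_on_coord continuous_on_fst[OF continuous_on_id] subset_UNIV])
  have v: "continuous_on UNIV (\<lambda>w :: (nat \<Rightarrow> real) \<times> (nat \<Rightarrow> real). snd w i)" for i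
    by (rule continuous_on_compose2[OF continuous_on_coord continuous_on_snd[OF continuous_on_id] subset_UNIV])
  show ?thesis
    unfolding disc_join_def [abs_def] Let_def case_prod_unfold
    by (intro continuous_on_coordinatewise_then_product * continuous_on_if_const u v
          continuous_on_const)
       (auto intro: sqnorm_eq_0[of a] sqnorm_eq_0[of b])
qed

text \<open>The square of the factor is \<open>(P + Q) / max P Q\<close>, so the larger of the two
  scaled square norms becomes \<open>P + Q\<close>. Away from zero norm, the factor of
  \<open>disc_join\<close> at the image point is therefore \<open>1 / c\<close>.\<close>

lemma disc_split_sqnorm:
  assumes "disc_split a b x = (u, v)"
  shows "u \<in> Rn a" "v \<in> Rn b" "max (sqnorm a u) (sqnorm b v) = sqnorm (a + b) x"
    and "x \<in> Rn (a + b) \<Longrightarrow> disc_join a b (u, v) = x"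
proof -
  define P Q where "P = sqnorm a x" and "Q = sqnorm b (\<lambda>i. x (a + i))"
  define c where "c = sqrt (P + Q) / sqrt (max P Q)"
  have u: "u = (\<lambda>i. c * (if i < a then x i else 0))"
    and v: "v = (\<lambda>i. c * (if i < b then x (a + i) else 0))"
    using assms by (auto simp: disc_split_def Let_def P_def Q_def c_def)
  show "u \<in> Rn a" "v \<in> Rn b"
    by (auto simp: u v Rn_iff)
  have PQ: "0 \<le> P" "0 \<le> Q"
    by (auto simp: P_def Q_def sqnorm_nonneg)
  then have c2: "c\<^sup>2 = (P + Q) / max P Q"
    by (simp add: c_def power_divide)
  have norms: "sqnorm a u = c\<^sup>2 * P" "sqnorm b v = c\<^sup>2 * Q"
    unfolding P_def Q_def by (rule sqnorm_scale; simp add: u v)+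
  have M: "max (c\<^sup>2 * P) (c\<^sup>2 * Q) = P + Q"
  proof -
    have "max (c\<^sup>2 * P) (c\<^sup>2 * Q) = c\<^sup>2 * max P Q"
      by (simp add: max_mult_distrib_left)
    then show ?thesis
      using PQ by (cases "max P Q = 0") (auto simp: c2 max_def split: if_splits)
  qed
  then show "max (sqnorm a u) (sqnorm b v) = sqnorm (a + b) x"
    by (simp add: norms sqnorm_add P_def Q_def)
  assume x: "x \<in> Rn (a + b)"
  have "sqrt (P + Q) / sqrt (c\<^sup>2 * P + c\<^sup>2 * Q) * (c * y) = y"
    if "P = 0 \<Longrightarrow> Q = 0 \<Longrightarrow> y = 0" for y
  proof (cases "P + Q = 0")
    case True
    then show ?thesis using PQ that by (auto simp: add_nonneg_eq_0_iff)
  next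
    case False
    then have "0 < P + Q" "0 < max P Q" using PQ by auto
    then have "0 < c" by (simp add: c_def)
    then have "sqrt (c\<^sup>2 * P + c\<^sup>2 * Q) = c * sqrt (P + Q)"
      by (simp flip: distrib_left add: real_sqrt_mult)
    then show ?thesis using \<open>0 < c\<close> \<open>0 < P + Q\<close> by simp
  qed
  \<comment> \<open>If both norms vanish, the factors are 0 by the convention on division, and the
    equality rests on \<open>x\<close> being 0.\<close>
  moreover have "x i = 0" if "P = 0" "Q = 0" for i
  proof -
    have "sqnorm (a + b) x = 0"
      using that by (simp add: sqnorm_add P_def Q_def)
    then show ?thesis
      using sqnorm_eq_0 x by (cases "i < a + b") (auto simp: Rn_iff)
  qed
  moreover have "disc_join a b (u, v) = (\<lambda>i. sqrt (P + Q) / sqrt (c\<^sup>2 * P + c\<^sup>2 * Q) * (c * x i))"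
  proof -
    have "disc_join a b (u, v) = (\<lambda>i. sqrt (P + Q) / sqrt (c\<^sup>2 * P + c\<^sup>2 * Q) *
        (if i < a then u i else if i < a + b then v (i - a) else 0))"
      by (simp add: disc_join_def Let_def norms M)
    moreover have "(if i < a then u i else if i < a + b then v (i - a) else 0) = c * x i" for i
      using x by (auto simp: u v Rn_iff)
    ultimately show ?thesis by simp
  qed
  ultimately show "disc_join a b (u, v) = x"
    by auto
qed

text \<open>The mirror image of the previous computation, now with \<open>max P Q / (P + Q)\<close>
  as the square of the factor.\<close>

lemma disc_join_sqnorm:
  assumes "u \<in> Rn a" "v \<in> Rn b"
  shows "disc_join a b (u, v) \<in> Rn (a + b)"
    and "sqnorm (a + b) (disc_join a b (u, v)) = max (sqnorm a u) (sqnorm b v)"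
    and "disc_split a b (disc_join a b (u, v)) = (u, v)"
proof -
  define P Q where "P = sqnorm a u" and "Q = sqnorm b v"
  define c where "c = sqrt (max P Q) / sqrt (P + Q)"
  define x where "x = disc_join a b (u, v)"
  have x: "x = (\<lambda>i. c * (if i < a then u i else if i < a + b then v (i - a) else 0))"
    by (auto simp: x_def disc_join_def Let_def P_def Q_def c_def)
  show "disc_join a b (u, v) \<in> Rn (a + b)"
    by (auto simp: x Rn_iff simp flip: x_def)
  have PQ: "0 \<le> P" "0 \<le> Q"
    by (auto simp: P_def Q_def sqnorm_nonneg)
  then have c2: "c\<^sup>2 = max P Q / (P + Q)"
    by (simp add: c_def power_divide)
  have norms: "sqnorm a x = c\<^sup>2 * P" "sqnorm b (\<lambda>i. x (a + i)) = c\<^sup>2 * Q"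
    unfolding P_def Q_def by (rule sqnorm_scale; simp add: x)+
  have sum: "c\<^sup>2 * P + c\<^sup>2 * Q = max P Q"
  proof -
    have "c\<^sup>2 * P + c\<^sup>2 * Q = c\<^sup>2 * (P + Q)"
      by (simp only: distrib_left)
    then show ?thesis
      using PQ by (cases "P + Q = 0") (auto simp: c2 add_nonneg_eq_0_iff)
  qed
  then show "sqnorm (a + b) (disc_join a b (u, v)) = max (sqnorm a u) (sqnorm b v)"
    by (simp add: norms sqnorm_add flip: x_def P_def Q_def)
  have *: "sqrt (c\<^sup>2 * P + c\<^sup>2 * Q) / sqrt (max (c\<^sup>2 * P) (c\<^sup>2 * Q)) * (c * y) = y"
    if "P = 0 \<Longrightarrow> Q = 0 \<Longrightarrow> y = 0" for y
  proof (cases "P + Q = 0")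
    case True
    then show ?thesis using PQ that by (auto simp: add_nonneg_eq_0_iff)
  next
    case False
    then have "0 < P + Q" "0 < max P Q" using PQ by auto
    then have "0 < c" by (simp add: c_def)
    moreover have "max (c\<^sup>2 * P) (c\<^sup>2 * Q) = c\<^sup>2 * max P Q"
      by (simp add: max_mult_distrib_left)
    ultimately have "sqrt (max (c\<^sup>2 * P) (c\<^sup>2 * Q)) = c * sqrt (max P Q)"
      by (simp add: real_sqrt_mult)
    then show ?thesis using \<open>0 < c\<close> \<open>0 < max P Q\<close> by (simp add: sum)
  qed
  have uv0: "u i = 0" "v i = 0" if "P = 0" "Q = 0" for i
    using that assms sqnorm_eq_0[of a u i] sqnorm_eq_0[of b v i]
    by (cases "i < a"; cases "i < b"; auto simp: P_def Q_def Rn_iff)+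
  have uv: "sqrt (c\<^sup>2 * P + c\<^sup>2 * Q) / sqrt (max (c\<^sup>2 * P) (c\<^sup>2 * Q)) * (c * u i) = u i"
    "sqrt (c\<^sup>2 * P + c\<^sup>2 * Q) / sqrt (max (c\<^sup>2 * P) (c\<^sup>2 * Q)) * (c * v i) = v i" for i
    using *[of "u i"] *[of "v i"] uv0 by blast+
  have "(if i < a then x i else 0) = c * u i" "(if i < b then x (a + i) else 0) = c * v i" for i
    using assms by (auto simp: x Rn_iff)
  then have "disc_split a b x = (u, v)"
    unfolding disc_split_def Let_def norms by (simp only: uv)
  then show "disc_split a b (disc_join a b (u, v)) = (u, v)"
    by (simp add: x_def)
qed

text \<open>The Euclidean norm on one side corresponds to the maximum of the two norms on the other,
  so the same pair of maps matches both the closed and the open discs.\<close>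

lemma homeomorphism_disc_split:
  shows homeomorphism_closed_disc_split:
      "homeomorphism (closed_disc (a + b)) (closed_disc a \<times> closed_disc b) (disc_split a b) (disc_join a b)"
    and homeomorphism_open_disc_split:
      "homeomorphism (open_disc (a + b)) (open_disc a \<times> open_disc b) (disc_split a b) (disc_join a b)"
proof -
  have split: "disc_split a b x \<in> closed_disc a \<times> closed_disc b" if "x \<in> closed_disc (a + b)" for x
    using disc_split_sqnorm[of a b x] that
    by (cases "disc_split a b x") (auto simp: closed_disc_sqnorm simp flip: max.bounded_iff)
  have split': "disc_split a b x \<in> open_disc a \<times> open_disc b" if "x \<in> open_disc (a + b)" for x
    using disc_split_sqnorm[of a b x] that
    by (cases "disc_split a b x") (auto simp: open_disc_sqnorm simp flip: max_less_iff_conj)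
  have join: "disc_join a b w \<in> closed_disc (a + b)" if "w \<in> closed_disc a \<times> closed_disc b" for w
    using disc_join_sqnorm[of "fst w" a "snd w" b] that by (auto simp: closed_disc_sqnorm)
  have join': "disc_join a b w \<in> open_disc (a + b)" if "w \<in> open_disc a \<times> open_disc b" for w
    using disc_join_sqnorm[of "fst w" a "snd w" b] that by (auto simp: open_disc_sqnorm)
  have inv: "disc_join a b (disc_split a b x) = x" if "x \<in> closed_disc (a + b)" for x
    using disc_split_sqnorm[of a b x] that by (cases "disc_split a b x") (auto simp: closed_disc_sqnorm)
  have inv': "disc_split a b (disc_join a b w) = w" if "w \<in> closed_disc a \<times> closed_disc b" for w
    using disc_join_sqnorm[of "fst w" a "snd w" b] that by (auto simp: closed_disc_sqnorm)
  have cont: "continuous_on S (disc_split a b)" "continuous_on T (disc_join a b)" for S T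
    using continuous_on_disc_split continuous_on_disc_join continuous_on_subset by blast+
  show "homeomorphism (closed_disc (a + b)) (closed_disc a \<times> closed_disc b) (disc_split a b) (disc_join a b)"
    by (intro homeomorphismI cont image_subsetI split join inv inv')
  show "homeomorphism (open_disc (a + b)) (open_disc a \<times> open_disc b) (disc_split a b) (disc_join a b)"
    using open_disc_subset by (intro homeomorphismI cont image_subsetI split' join' inv inv') blast+
qed

text \<open>A product of two cells is parametrised by a single disc through
  \<open>disc_split\<close>. Local finiteness survives because a box \<open>U \<times> V\<close>
  meets a product of closed cells only if it does so in both factors.\<close>

lemma lf_cw_product:
  assumes "lf_cw A I dm \<phi>" and "lf_cw B J dn \<psi>"
  shows "lf_cw (A \<times> B) (I \<times> J) (\<lambda>(i, j). dm i + dn j)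
    (\<lambda>(i, j). map_prod (\<phi> i) (\<psi> j) \<circ> disc_split (dm i) (dn j))"
proof -
  interpret A: lf_cw A I dm \<phi> by fact
  interpret B: lf_cw B J dn \<psi> by fact
  let ?\<Phi> = "\<lambda>i j. map_prod (\<phi> i) (\<psi> j) \<circ> disc_split (dm i) (dn j)"
  have closed: "disc_split a b x \<in> closed_disc a \<times> closed_disc b" if "x \<in> closed_disc (a + b)" for a b x
    using homeomorphism_closed_disc_split[of a b] that by (auto simp: homeomorphism_def)
  \<comment> \<open>Used contrapositively: a boundary point of the big disc has at least one
    component on the boundary of its own disc.\<close>
  have open_iff: "disc_split a b x \<in> open_disc a \<times> open_disc b \<longleftrightarrow> x \<in> open_disc (a + b)"
    if "x \<in> closed_disc (a + b)" for a b x
  proof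
    assume "disc_split a b x \<in> open_disc a \<times> open_disc b"
    then have "disc_join a b (disc_split a b x) \<in> open_disc (a + b)"
      using homeomorphism_open_disc_split[of a b] by (auto simp: homeomorphism_def)
    then show "x \<in> open_disc (a + b)"
      using homeomorphism_closed_disc_split[of a b] that by (simp add: homeomorphism_def)
  qed (use homeomorphism_open_disc_split[of a b] in \<open>auto simp: homeomorphism_def\<close>)
  have image_open: "?\<Phi> i j ` open_disc (dm i + dn j) = \<phi> i ` open_disc (dm i) \<times> \<psi> j ` open_disc (dn j)" for i j
  proof -
    have "disc_split (dm i) (dn j) ` open_disc (dm i + dn j) = open_disc (dm i) \<times> open_disc (dn j)"
      using homeomorphism_open_disc_split unfolding homeomorphism_def by blast
    then show ?thesis
      by (simp only: image_comp [symmetric] map_prod_surj_on [OF refl refl])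
  qed
  have cells: "\<exists>F\<subseteq>I \<times> J. finite F \<and> (\<forall>(i', j')\<in>F. dm i' + dn j' < dm i + dn j) \<and>
      ?\<Phi> i j ` (closed_disc (dm i + dn j) - open_disc (dm i + dn j))
        \<subseteq> (\<Union>(i', j')\<in>F. \<phi> i' ` open_disc (dm i') \<times> \<psi> j' ` open_disc (dn j'))"
    if ij: "i \<in> I" "j \<in> J" for i j
  proof -
    obtain F where F: "F \<subseteq> I" "finite F" "\<forall>k\<in>F. dm k < dm i"
      "\<phi> i ` (closed_disc (dm i) - open_disc (dm i)) \<subseteq> (\<Union>k\<in>F. \<phi> k ` open_disc (dm k))"
      using A.boundary[OF ij(1)] by meson
    obtain G where G: "G \<subseteq> J" "finite G" "\<forall>k\<in>G. dn k < dn j"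
      "\<psi> j ` (closed_disc (dn j) - open_disc (dn j)) \<subseteq> (\<Union>k\<in>G. \<psi> k ` open_disc (dn k))"
      using B.boundary[OF ij(2)] by meson
    \<comment> \<open>The boundary of a product is the boundary of one factor times the closure of
      the other, in either order; \<open>insert\<close> adds the open cell that completes a
      closure.\<close>
    define FG where "FG = F \<times> insert j G \<union> insert i F \<times> G"
    have u: "\<phi> i u \<in> (\<Union>k\<in>insert i F. \<phi> k ` open_disc (dm k))"
      if "u \<in> closed_disc (dm i)" for u
      using F(4) that by (cases "u \<in> open_disc (dm i)") auto
    have v: "\<psi> j v \<in> (\<Union>k\<in>insert j G. \<psi> k ` open_disc (dn k))"
      if "v \<in> closed_disc (dn j)" for v
      using G(4) that by (cases "v \<in> open_disc (dn j)") auto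
    have "?\<Phi> i j x \<in> (\<Union>(i', j')\<in>FG. \<phi> i' ` open_disc (dm i') \<times> \<psi> j' ` open_disc (dn j'))"
      if x: "x \<in> closed_disc (dm i + dn j)" "x \<notin> open_disc (dm i + dn j)" for x
    proof -
      obtain a b where ab: "disc_split (dm i) (dn j) x = (a, b)" by fastforce
      then have "a \<in> closed_disc (dm i)" "b \<in> closed_disc (dn j)"
        "a \<notin> open_disc (dm i) \<or> b \<notin> open_disc (dn j)"
        using closed[OF x(1)] open_iff[OF x(1)] x(2) by auto
      then consider
          "\<phi> i a \<in> (\<Union>k\<in>F. \<phi> k ` open_disc (dm k))" "\<psi> j b \<in> (\<Union>k\<in>insert j G. \<psi> k ` open_disc (dn k))"
        | "\<phi> i a \<in> (\<Union>k\<in>insert i F. \<phi> k ` open_disc (dm k))" "\<psi> j b \<in> (\<Union>k\<in>G. \<psi> k ` open_disc (dn k))"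
        using u[of a] v[of b] F(4) G(4) by blast
      then have "(\<phi> i a, \<psi> j b) \<in> (\<Union>(i', j')\<in>FG. \<phi> i' ` open_disc (dm i') \<times> \<psi> j' ` open_disc (dn j'))"
      proof cases
        case 1
        then obtain k k' where "k \<in> F" "\<phi> i a \<in> \<phi> k ` open_disc (dm k)"
          "k' \<in> insert j G" "\<psi> j b \<in> \<psi> k' ` open_disc (dn k')" by blast
        then show ?thesis
          by (intro UN_I[of "(k, k')"]) (auto simp: FG_def)
      next
        case 2
        then obtain k k' where "k \<in> insert i F" "\<phi> i a \<in> \<phi> k ` open_disc (dm k)"
          "k' \<in> G" "\<psi> j b \<in> \<psi> k' ` open_disc (dn k')" by blast
        then show ?thesis
          by (intro UN_I[of "(k, k')"]) (auto simp: FG_def)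
      qed
      then show ?thesis by (simp add: ab)
    qed
    moreover have "FG \<subseteq> I \<times> J" "finite FG" "\<forall>(i', j')\<in>FG. dm i' + dn j' < dm i + dn j"
      using F(1-3) G(1-3) ij by (auto simp: FG_def intro: add_less_le_mono add_le_less_mono add_strict_mono)
    ultimately show ?thesis
      by (intro exI[of _ FG]) blast
  qed
  show ?thesis
  proof (unfold_locales, unfold split_paired_all mem_Times_iff fst_conv snd_conv prod.case)
    fix i j assume "i \<in> I \<and> j \<in> J"
    then have i: "i \<in> I" and j: "j \<in> J" by simp_all
    have "continuous_on (closed_disc (dm i) \<times> closed_disc (dn j)) (map_prod (\<phi> i) (\<psi> j))"
      unfolding map_prod_def case_prod_unfold
      by (intro continuous_on_Pair continuous_on_compose2[OF A.cont[OF i]]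
          continuous_on_compose2[OF B.cont[OF j]] continuous_on_fst continuous_on_snd continuous_on_id) auto
    then show "continuous_on (closed_disc (dm i + dn j)) (?\<Phi> i j)"
      using homeomorphism_closed_disc_split[of "dm i" "dn j"]
      by (intro continuous_on_compose) (auto simp: homeomorphism_def)
    show "fst (?\<Phi> i j x) \<in> A \<and> snd (?\<Phi> i j x) \<in> B" if "x \<in> closed_disc (dm i + dn j)" for x
      using closed[OF that] A.into[OF i] B.into[OF j] by (cases "disc_split (dm i) (dn j) x") auto
    obtain g where g: "homeomorphism (open_disc (dm i)) (\<phi> i ` open_disc (dm i)) (\<phi> i) g"
      using A.homeo[OF i] by (elim exE)
    obtain h where h: "homeomorphism (open_disc (dn j)) (\<psi> j ` open_disc (dn j)) (\<psi> j) h"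
      using B.homeo[OF j] by (elim exE)
    have "homeomorphism (open_disc (dm i) \<times> open_disc (dn j))
        (\<phi> i ` open_disc (dm i) \<times> \<psi> j ` open_disc (dn j)) (map_prod (\<phi> i) (\<psi> j)) (map_prod g h)"
    proof (rule homeomorphismI)
      show "continuous_on (open_disc (dm i) \<times> open_disc (dn j)) (map_prod (\<phi> i) (\<psi> j))"
        unfolding map_prod_def case_prod_unfold
        by (intro continuous_on_Pair
            continuous_on_compose2[OF homeomorphism_cont1[OF g] continuous_on_fst[OF continuous_on_id]]
            continuous_on_compose2[OF homeomorphism_cont1[OF h] continuous_on_snd[OF continuous_on_id]])
           auto
      show "continuous_on (\<phi> i ` open_disc (dm i) \<times> \<psi> j ` open_disc (dn j)) (map_prod g h)"
        unfolding map_prod_def case_prod_unfold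
        by (intro continuous_on_Pair
            continuous_on_compose2[OF homeomorphism_cont2[OF g] continuous_on_fst[OF continuous_on_id]]
            continuous_on_compose2[OF homeomorphism_cont2[OF h] continuous_on_snd[OF continuous_on_id]])
           auto
    qed (use g h in \<open>auto simp: homeomorphism_def\<close>)
    from homeomorphism_compose[OF homeomorphism_open_disc_split this]
    show "\<exists>g. homeomorphism (open_disc (dm i + dn j)) (?\<Phi> i j ` open_disc (dm i + dn j)) (?\<Phi> i j) g"
      unfolding image_open by blast
    obtain F where F: "F \<subseteq> I \<times> J" "finite F" "\<forall>(i', j')\<in>F. dm i' + dn j' < dm i + dn j"
      "?\<Phi> i j ` (closed_disc (dm i + dn j) - open_disc (dm i + dn j))
        \<subseteq> (\<Union>(i', j')\<in>F. \<phi> i' ` open_disc (dm i') \<times> \<psi> j' ` open_disc (dn j'))"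
      using cells[OF i j] by meson
    have "(\<Union>ij\<in>F. (case ij of (i, j) \<Rightarrow> ?\<Phi> i j) ` open_disc (case ij of (i, j) \<Rightarrow> dm i + dn j))
        = (\<Union>(i', j')\<in>F. \<phi> i' ` open_disc (dm i') \<times> \<psi> j' ` open_disc (dn j'))"
      by (simp only: case_prod_unfold image_open)
    then show "\<exists>F\<subseteq>I \<times> J. finite F \<and> (\<forall>j'\<in>F. (case j' of (i, j) \<Rightarrow> dm i + dn j) < dm i + dn j) \<and>
        ?\<Phi> i j ` (closed_disc (dm i + dn j) - open_disc (dm i + dn j))
          \<subseteq> (\<Union>ij\<in>F. (case ij of (i, j) \<Rightarrow> ?\<Phi> i j) ` open_disc (case ij of (i, j) \<Rightarrow> dm i + dn j))"
      using F by (intro exI[of _ F]) (auto simp only: case_prod_unfold)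
  next
    fix a b assume "a \<in> A \<and> b \<in> B"
    then have "a \<in> A" "b \<in> B" by simp_all
    obtain i where i: "i \<in> I" "a \<in> \<phi> i ` open_disc (dm i)"
      using A.cover[OF \<open>a \<in> A\<close>] by blast
    obtain j where j: "j \<in> J" "b \<in> \<psi> j ` open_disc (dn j)"
      using B.cover[OF \<open>b \<in> B\<close>] by blast
    have "(a, b) \<in> ?\<Phi> i j ` open_disc (dm i + dn j)"
      unfolding image_open using i j by blast
    then show "\<exists>ij\<in>I \<times> J. (a, b) \<in> (case ij of (i, j) \<Rightarrow> ?\<Phi> i j) ` open_disc (case ij of (i, j) \<Rightarrow> dm i + dn j)"
      using i(1) j(1) by (intro bexI[of _ "(i, j)"]) auto
    obtain U where U: "open U" "a \<in> U" "finite {i\<in>I. \<phi> i ` closed_disc (dm i) \<inter> U \<noteq> {}}" (is "finite ?X")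
      using A.loc_finite[OF \<open>a \<in> A\<close>] by (elim exE conjE)
    obtain V where V: "open V" "b \<in> V" "finite {j\<in>J. \<psi> j ` closed_disc (dn j) \<inter> V \<noteq> {}}" (is "finite ?Y")
      using B.loc_finite[OF \<open>b \<in> B\<close>] by (elim exE conjE)
    have "{ij\<in>I \<times> J. (case ij of (i, j) \<Rightarrow> ?\<Phi> i j) ` closed_disc (case ij of (i, j) \<Rightarrow> dm i + dn j) \<inter> U \<times> V \<noteq> {}}
        \<subseteq> ?X \<times> ?Y"
    proof
      fix ij
      assume ij': "ij \<in> {ij\<in>I \<times> J. (case ij of (i, j) \<Rightarrow> ?\<Phi> i j) `
        closed_disc (case ij of (i, j) \<Rightarrow> dm i + dn j) \<inter> U \<times> V \<noteq> {}}"
      obtain i j where ij_eq: "ij = (i, j)" by fastforce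
      have ij: "(i \<in> I \<and> j \<in> J) \<and> ?\<Phi> i j ` closed_disc (dm i + dn j) \<inter> U \<times> V \<noteq> {}"
        using ij' by (simp only: ij_eq mem_Collect_eq mem_Sigma_iff prod.case simp_thms not_False_eq_True)
      obtain w where w: "w \<in> ?\<Phi> i j ` closed_disc (dm i + dn j)" "w \<in> U \<times> V"
        using conjunct2[OF ij] unfolding ex_in_conv[symmetric] by (elim exE IntE)
      then obtain x where x: "x \<in> closed_disc (dm i + dn j)" "?\<Phi> i j x \<in> U \<times> V"
        by (elim imageE) (simp only:)
      obtain a b where ab: "disc_split (dm i) (dn j) x = (a, b)" by fastforce
      have "a \<in> closed_disc (dm i)" "b \<in> closed_disc (dn j)" "\<phi> i a \<in> U" "\<psi> j b \<in> V"
        using closed[OF x(1)] x(2) by (simp_all add: ab)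
      then have "\<phi> i ` closed_disc (dm i) \<inter> U \<noteq> {}" "\<psi> j ` closed_disc (dn j) \<inter> V \<noteq> {}"
        by blast+
      then show "ij \<in> ?X \<times> ?Y"
        using conjunct1[OF ij] by (simp only: ij_eq mem_Collect_eq mem_Sigma_iff simp_thms not_False_eq_True)
    qed
    from finite_subset[OF this finite_cartesian_product[OF U(3) V(3)]]
    show "\<exists>W. open W \<and> (a, b) \<in> W \<and> finite {ij. (fst ij \<in> I \<and> snd ij \<in> J) \<and>
        (case ij of (i, j) \<Rightarrow> ?\<Phi> i j) ` closed_disc (case ij of (i, j) \<Rightarrow> dm i + dn j) \<inter> W \<noteq> {}}"
      using U(1,2) V(1,2) unfolding mem_Times_iff
      by (intro exI[of _ "U \<times> V"] conjI open_Times SigmaI)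
  next
    fix i j i' j' x y
    assume "i \<in> I \<and> j \<in> J" "i' \<in> I \<and> j' \<in> J"
      and "x \<in> open_disc (dm i + dn j)"
      "y \<in> open_disc (dm i' + dn j')" "?\<Phi> i j x = ?\<Phi> i' j' y"
    then have *: "i \<in> I" "j \<in> J" "i' \<in> I" "j' \<in> J" "x \<in> open_disc (dm i + dn j)"
      "y \<in> open_disc (dm i' + dn j')" "?\<Phi> i j x = ?\<Phi> i' j' y" by simp_all
    obtain a b a' b' where ab: "disc_split (dm i) (dn j) x = (a, b)" "disc_split (dm i') (dn j') y = (a', b')"
      by fastforce
    then have "a \<in> open_disc (dm i)" "b \<in> open_disc (dn j)" "a' \<in> open_disc (dm i')" "b' \<in> open_disc (dn j')"
      using open_iff[OF subsetD[OF open_disc_subset *(5)]] open_iff[OF subsetD[OF open_disc_subset *(6)]]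
        *(5,6) by simp_all
    moreover have "\<phi> i a = \<phi> i' a'" "\<psi> j b = \<psi> j' b'"
      using *(7) ab by auto
    ultimately show "(i, j) = (i', j')"
      using A.disjoint[OF *(1,3)] B.disjoint[OF *(2,4)] by simp
  qed
qed

section \<open>Cell structures on the line and on spheres\<close>

lemma sqnorm_0 [simp]: "sqnorm 0 x = 0"
  and sqnorm_Suc: "sqnorm (Suc n) x = sqnorm n x + (x n)\<^sup>2"
  by (simp_all add: sqnorm_def)

lemma closed_disc_0: "closed_disc 0 = {\<lambda>i. 0}" and open_disc_0: "open_disc 0 = {\<lambda>i. 0}"
  by (auto simp: closed_disc_sqnorm open_disc_sqnorm Rn_iff fun_eq_iff)

text \<open>Integers are the vertices and unit intervals the edges: \<open>(k, True)\<close> stands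
  for the edge from \<open>k\<close> to \<open>k + 1\<close>, parametrised by
  \<open>[-1, 1]\<close>.\<close>

lemma lf_cw_real:
  "lf_cw (UNIV :: real set) (UNIV :: (int \<times> bool) set) (\<lambda>(k, b). if b then 1 else 0)
    (\<lambda>(k, b) x. if b then real_of_int k + (x 0 + 1) / 2 else real_of_int k)"
proof (unfold_locales, unfold split_paired_all prod.case)
  have closed1: "x \<in> closed_disc 1 \<longleftrightarrow> x \<in> Rn 1 \<and> -1 \<le> x 0 \<and> x 0 \<le> 1" for x
    by (auto simp: closed_disc_sqnorm sqnorm_Suc abs_square_le_1 abs_le_iff)
  have open1: "x \<in> open_disc 1 \<longleftrightarrow> x \<in> Rn 1 \<and> -1 < x 0 \<and> x 0 < 1" for x
    by (auto simp: open_disc_sqnorm sqnorm_Suc abs_square_less_1 abs_less_iff)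
  let ?d = "\<lambda>b. if b then 1 else 0 :: nat"
  let ?\<phi> = "\<lambda>k b x. if b then real_of_int k + (x 0 + 1) / 2 else real_of_int k"
  have at0: "?\<phi> k False x = k" for k x by simp
  have image0: "?\<phi> k False ` open_disc (?d False) = {real_of_int k}" for k
    by (auto simp: open_disc_0)
  {
    fix k b
    show "continuous_on (closed_disc (?d b)) (?\<phi> k b)"
      by (cases b) (auto intro!: continuous_on_add continuous_on_divide continuous_on_coord continuous_on_const)
    show "?\<phi> k b x \<in> UNIV" for x by simp
    show "\<exists>g. homeomorphism (open_disc (?d b)) (?\<phi> k b ` open_disc (?d b)) (?\<phi> k b) g"
    proof (cases b)
      case True
      have "homeomorphism (open_disc 1) (?\<phi> k True ` open_disc 1) (?\<phi> k True)
        (\<lambda>y i. if i = 0 then 2 * (y - real_of_int k) - 1 else 0)"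
      proof (rule homeomorphismI)
        have inv: "(\<lambda>i. if i = 0 then 2 * (?\<phi> k True x - real_of_int k) - 1 else 0) = x"
          if "x \<in> open_disc 1" for x
          using that[unfolded open1] by (auto simp: Rn_iff fun_eq_iff add_divide_distrib)
        show "(\<lambda>i. if i = 0 then 2 * (?\<phi> k True x - real_of_int k) - 1 else 0) = x"
          if "x \<in> open_disc 1" for x
          using inv[OF that] .
        show "(\<lambda>y i. if i = 0 then 2 * (y - real_of_int k) - 1 else 0) ` ?\<phi> k True ` open_disc 1 \<subseteq> open_disc 1"
          using inv by (simp only: image_image) (auto simp del: if_True)
        show "continuous_on (?\<phi> k True ` open_disc 1) (\<lambda>y i. if i = 0 then 2 * (y - real_of_int k) - 1 else 0)"
          by (intro continuous_on_coordinatewise_then_product continuous_on_if_const continuous_on_diff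
              continuous_on_mult continuous_on_const continuous_on_id)
        show "continuous_on (open_disc 1) (?\<phi> k True)"
          by (auto intro!: continuous_on_add continuous_on_divide continuous_on_coord continuous_on_const)
      qed auto
      then show ?thesis
        using True by auto
    next
      case False
      have "homeomorphism (open_disc 0) (?\<phi> k False ` open_disc 0) (?\<phi> k False) (\<lambda>y i. 0)"
        by (rule homeomorphismI) (auto simp: open_disc_0)
      then show ?thesis
        using False by auto
    qed
    show "\<exists>F\<subseteq>UNIV. finite F \<and> (\<forall>j\<in>F. (case j of (k, b) \<Rightarrow> ?d b) < ?d b) \<and>
      ?\<phi> k b ` (closed_disc (?d b) - open_disc (?d b))
        \<subseteq> (\<Union>j\<in>F. (case j of (k, b) \<Rightarrow> ?\<phi> k b) ` open_disc (case j of (k, b) \<Rightarrow> ?d b))"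
    proof (cases b)
      case True
      have ends: "x 0 = -1 \<or> x 0 = 1" if "x \<in> closed_disc (Suc 0)" "x \<notin> open_disc (Suc 0)" for x
        using that closed1[of x] open1[of x] by auto
      show ?thesis
        using True by (intro exI[of _ "{(k, False), (k + 1, False)}"]) (auto simp: open_disc_0 dest!: ends)
    next
      case False
      then show ?thesis
        by (intro exI[of _ "{}"]) (auto simp: open_disc_0 closed_disc_0)
    qed
  }
  {
    fix a :: real
    define k where "k = \<lfloor>a\<rfloor>"
    have k: "real_of_int k \<le> a" "a < real_of_int k + 1"
      by (simp_all add: k_def)
    show "\<exists>j\<in>UNIV. a \<in> (case j of (k, b) \<Rightarrow> ?\<phi> k b) ` open_disc (case j of (k, b) \<Rightarrow> ?d b)"
    proof (cases "a = real_of_int k")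
      case True
      then show ?thesis
        by (intro bexI[of _ "(k, False)"]) (auto simp: open_disc_0)
    next
      case False
      then have "(\<lambda>i. if i = 0 then 2 * (a - real_of_int k) - 1 else 0) \<in> open_disc 1"
        unfolding open1 using k by (simp add: Rn_iff)
      then have "a \<in> ?\<phi> k True ` open_disc 1"
        by (rule rev_image_eqI) (simp add: diff_divide_distrib)
      then show ?thesis
        by (intro bexI[of _ "(k, True)"]) auto
    qed
    \<comment> \<open>The closed cells with index \<open>j\<close> lie in \<open>[j, j + 1]\<close>,
      so only indices within 2 of the floor of \<open>a\<close> can meet this interval.\<close>
    have "{j\<in>UNIV. (case j of (k, b) \<Rightarrow> ?\<phi> k b) ` closed_disc (case j of (k, b) \<Rightarrow> ?d b) \<inter> {a-1<..<a+1} \<noteq> {}}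
        \<subseteq> {k-2..k+2} \<times> UNIV"
    proof
      fix p
      assume p: "p \<in> {j\<in>UNIV. (case j of (k, b) \<Rightarrow> ?\<phi> k b) `
        closed_disc (case j of (k, b) \<Rightarrow> ?d b) \<inter> {a-1<..<a+1} \<noteq> {}}"
      obtain j b where jb: "p = (j, b)" by fastforce
      obtain x where x: "x \<in> closed_disc (?d b)" "?\<phi> j b x \<in> {a-1<..<a+1}"
        using p unfolding jb mem_Collect_eq prod.case by blast
      have "real_of_int j < a + 1 \<and> a - 1 < real_of_int j + 1"
      proof (cases b)
        case True
        then have "-1 \<le> x 0" "x 0 \<le> 1"
          using x(1) closed1[of x] by simp_all
        moreover have "a - 1 < real_of_int j + (x 0 + 1) / 2" "real_of_int j + (x 0 + 1) / 2 < a + 1"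
          using x(2) True by simp_all
        ultimately show ?thesis
          by (simp add: field_simps)
      qed (use x(2) in simp)
      then have "real_of_int j < real_of_int (k + 2)" "real_of_int (k - 2) < real_of_int j"
        using k by simp_all
      then show "p \<in> {k-2..k+2} \<times> UNIV"
        unfolding of_int_less_iff by (simp add: jb)
    qed
    then have "finite {j\<in>UNIV. (case j of (k, b) \<Rightarrow> ?\<phi> k b) ` closed_disc (case j of (k, b) \<Rightarrow> ?d b) \<inter> {a-1<..<a+1} \<noteq> {}}"
      by (rule finite_subset) (simp add: finite_cartesian_product)
    then show "\<exists>U. open U \<and> a \<in> U \<and> finite {j\<in>UNIV.
        (case j of (k, b) \<Rightarrow> ?\<phi> k b) ` closed_disc (case j of (k, b) \<Rightarrow> ?d b) \<inter> U \<noteq> {}}"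
      by (intro exI[of _ "{a-1<..<a+1}"] conjI) simp_all
  }
  fix k b k' b' x y
  assume xy: "x \<in> open_disc (?d b)" "y \<in> open_disc (?d b')" "?\<phi> k b x = ?\<phi> k' b' y"
  \<comment> \<open>The floor of a point recovers the index of its open cell, and integrality tells
    vertices from edges.\<close>
  have floor: "\<lfloor>?\<phi> k b x\<rfloor> = k \<and> (b \<longleftrightarrow> ?\<phi> k b x \<noteq> real_of_int k)" if "x \<in> open_disc (?d b)" for k b x
    using that open1[of x] by (cases b) (auto intro: floor_unique)
  show "(k, b) = (k', b')"
    using floor[OF xy(1), of k] floor[OF xy(2), of k'] xy(3) by auto
qed

definition sph :: "nat \<Rightarrow> (nat \<Rightarrow> real) set"
  where "sph d = {x \<in> Rn (Suc d). sqnorm (Suc d) x = 1}"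

text \<open>Collapses the boundary of the disc to the north pole.\<close>

definition disc_to_sph :: "nat \<Rightarrow> (nat \<Rightarrow> real) \<Rightarrow> nat \<Rightarrow> real" where
  "disc_to_sph d x =
    (\<lambda>i. if i < d then 2 * sqrt (1 - sqnorm d x) * x i else if i = d then 2 * sqnorm d x - 1 else 0)"

definition north_pole :: "nat \<Rightarrow> nat \<Rightarrow> real"
  where "north_pole d = (\<lambda>i. if i = d then 1 else 0)"

lemma continuous_on_disc_to_sph: "continuous_on S (disc_to_sph d)"
  unfolding disc_to_sph_def [abs_def]
  by (intro continuous_on_coordinatewise_then_product continuous_on_if_const continuous_on_mult
      continuous_on_real_sqrt continuous_on_diff continuous_on_sqnorm continuous_on_const continuous_on_coord)

lemma north_pole_sph: "north_pole d \<in> sph d"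
proof -
  have "sqnorm d (north_pole d) = 0"
    by (simp add: sqnorm_def north_pole_def)
  then show ?thesis
    by (auto simp: sph_def sqnorm_Suc Rn_iff) (simp_all add: north_pole_def)
qed

text \<open>With \<open>P\<close> the squared norm of \<open>x\<close>, the last coordinate is
  \<open>2 * P - 1\<close> and the others have squared length \<open>4 * (1 - P) * P\<close>;
  together this gives 1.\<close>

lemma disc_to_sph_in_sph:
  assumes "x \<in> closed_disc d"
  shows "disc_to_sph d x \<in> sph d"
proof -
  define P where "P = sqnorm d x"
  have P: "0 \<le> P" "P \<le> 1"
    using assms by (auto simp: P_def closed_disc_sqnorm sqnorm_nonneg)
  have "sqnorm d (disc_to_sph d x) = (2 * sqrt (1 - P))\<^sup>2 * P"
    unfolding P_def by (rule sqnorm_scale) (simp add: disc_to_sph_def)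
  also have "\<dots> = 4 * (1 - P) * P"
    using P by (simp add: power_mult_distrib)
  finally have "sqnorm (Suc d) (disc_to_sph d x) = 4 * (1 - P) * P + (2 * P - 1)\<^sup>2"
    by (simp add: sqnorm_Suc) (simp add: disc_to_sph_def P_def)
  also have "\<dots> = 1"
    by (simp add: power2_eq_square algebra_simps)
  finally show ?thesis
    by (simp add: sph_def Rn_iff) (simp add: disc_to_sph_def)
qed

lemma disc_to_sph_boundary:
  assumes "x \<in> closed_disc d - open_disc d"
  shows "disc_to_sph d x = north_pole d"
proof -
  have "sqnorm d x = 1"
    using assms by (auto simp: closed_disc_sqnorm open_disc_sqnorm)
  then show ?thesis
    by (auto simp: disc_to_sph_def north_pole_def fun_eq_iff)
qed

text \<open>A last coordinate \<open>y d = 2 * P - 1\<close> gives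
  \<open>1 - P = (1 - y d) / 2\<close>, so this undoes the factor of \<open>disc_to_sph\<close>.
  Only at the north pole would the formula divide by 0.\<close>

definition sph_to_disc :: "nat \<Rightarrow> (nat \<Rightarrow> real) \<Rightarrow> nat \<Rightarrow> real" where
  "sph_to_disc d y = (\<lambda>i. if i < d then y i / (2 * sqrt ((1 - y d) / 2)) else 0)"

text \<open>Keeps the denominators of \<open>sph_to_disc\<close> away from 0.\<close>

lemma sph_last_less:
  assumes "y \<in> sph d" "y \<noteq> north_pole d"
  shows "y d < 1"
proof -
  have "sqnorm d y + (y d)\<^sup>2 = 1"
    using assms(1) by (simp add: sph_def sqnorm_Suc)
  moreover have "sqnorm d y \<noteq> 0" if "y d = 1"
  proof
    assume *: "sqnorm d y = 0"
    have "y i = north_pole d i" for i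
    proof (cases i d rule: linorder_cases)
      case less
      then show ?thesis using sqnorm_eq_0[OF *] by (simp add: north_pole_def)
    next
      case greater
      then show ?thesis using assms(1) by (simp add: north_pole_def sph_def Rn_iff)
    qed (use that in \<open>simp add: north_pole_def\<close>)
    then show False using assms(2) by auto
  qed
  moreover have "0 \<le> sqnorm d y" by (rule sqnorm_nonneg)
  ultimately have "(y d)\<^sup>2 \<le> 1" "y d \<noteq> 1" by auto
  then show ?thesis
    by (auto simp: abs_square_le_1 abs_le_iff)
qed

lemma homeomorphism_disc_to_sph:
  "homeomorphism (open_disc d) (sph d - {north_pole d}) (disc_to_sph d) (sph_to_disc d)"
proof (rule homeomorphismI)
  show "continuous_on (open_disc d) (disc_to_sph d)"
    by (rule continuous_on_disc_to_sph)
  have "1 - y d \<noteq> 0" if "y \<in> sph d - {north_pole d}" for y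
    using sph_last_less that by fastforce
  then show "continuous_on (sph d - {north_pole d}) (sph_to_disc d)"
    unfolding sph_to_disc_def [abs_def]
    by (intro continuous_on_coordinatewise_then_product continuous_on_if_const continuous_on_mult
        continuous_on_divide continuous_on_real_sqrt continuous_on_diff continuous_on_const continuous_on_coord)
       auto
  have pole: "disc_to_sph d x \<noteq> north_pole d" if "x \<in> open_disc d" for x
    using that by (auto simp: disc_to_sph_def north_pole_def open_disc_sqnorm dest: fun_cong[of _ _ d])
  show "disc_to_sph d ` open_disc d \<subseteq> sph d - {north_pole d}"
  proof (rule image_subsetI)
    fix x assume "x \<in> open_disc d"
    then show "disc_to_sph d x \<in> sph d - {north_pole d}"
      using pole disc_to_sph_in_sph[OF subsetD[OF open_disc_subset]] by simp
  qed
  show "sph_to_disc d (disc_to_sph d x) = x" if "x \<in> open_disc d" for x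
  proof
    fix i
    have last: "(1 - disc_to_sph d x d) / 2 = 1 - sqnorm d x"
      by (simp add: disc_to_sph_def field_simps)
    have "sqnorm d x < 1" "i \<ge> d \<Longrightarrow> x i = 0"
      using that by (auto simp: open_disc_sqnorm Rn_iff)
    moreover have "i < d \<Longrightarrow> disc_to_sph d x i = 2 * sqrt (1 - sqnorm d x) * x i"
      by (simp add: disc_to_sph_def)
    ultimately show "sph_to_disc d (disc_to_sph d x) i = x i"
      unfolding sph_to_disc_def last by simp
  qed
  have sq: "sqnorm d (sph_to_disc d y) = (1 + y d) / 2" if "y \<in> sph d - {north_pole d}" for y
  proof -
    have *: "y d < 1" "sqnorm d y = (1 - y d) * (1 + y d)"
      using that sph_last_less by (auto simp: sph_def sqnorm_Suc power2_eq_square algebra_simps)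
    have "sqnorm d (sph_to_disc d y) = (1 / (2 * sqrt ((1 - y d) / 2)))\<^sup>2 * sqnorm d y"
      by (rule sqnorm_scale) (simp add: sph_to_disc_def)
    also have "(1 / (2 * sqrt ((1 - y d) / 2)))\<^sup>2 = 1 / (2 * (1 - y d))"
    proof -
      have "(1 / (2 * sqrt (z / 2)))\<^sup>2 = 1 / (2 * z)" if "0 < z" for z :: real
        using that by (simp add: power_divide power_mult_distrib)
      then show ?thesis
        using *(1) by simp
    qed
    also have "\<dots> * sqnorm d y = (1 + y d) / 2"
    proof -
      have "1 / (2 * z) * (z * w) = w / 2" if "z \<noteq> 0" for z w :: real
        using that by simp
      from this[of "1 - y d" "1 + y d"] show ?thesis
        using *(1) unfolding *(2) by simp
    qed
    finally show ?thesis .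
  qed
  show "sph_to_disc d ` (sph d - {north_pole d}) \<subseteq> open_disc d"
  proof (rule image_subsetI)
    fix y assume y: "y \<in> sph d - {north_pole d}"
    then have "sqnorm d (sph_to_disc d y) < 1"
      using sq[OF y] sph_last_less[of y d] by simp
    moreover have "sph_to_disc d y \<in> Rn d"
      by (simp add: Rn_iff sph_to_disc_def)
    ultimately show "sph_to_disc d y \<in> open_disc d"
      by (simp add: open_disc_sqnorm)
  qed
  show "disc_to_sph d (sph_to_disc d y) = y" if y: "y \<in> sph d - {north_pole d}" for y
  proof
    fix i
    have "y d < 1" using y sph_last_less by blast
    moreover have eq: "1 - (1 + y d) / 2 = (1 - y d) / 2" by (simp add: field_simps)
    moreover have "y i = 0" if "d < i" using y that by (simp add: sph_def Rn_iff)
    ultimately show "disc_to_sph d (sph_to_disc d y) i = y i"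
      unfolding disc_to_sph_def sq[OF y] eq by (simp add: sph_to_disc_def add_divide_distrib)
  qed
qed

text \<open>A vertex at the north pole and one open cell for the rest; \<open>0 < d\<close> puts the
  vertex in a lower dimension than the cell attached to it.\<close>

lemma lf_cw_sph:
  assumes "0 < d"
  shows "lf_cw (sph d) UNIV (\<lambda>b. if b then d else 0) (\<lambda>b. if b then disc_to_sph d else (\<lambda>x. north_pole d))"
    (is "lf_cw _ _ ?d ?\<phi>")
proof
  have image: "disc_to_sph d ` open_disc d = sph d - {north_pole d}"
    using homeomorphism_disc_to_sph by (auto simp: homeomorphism_def)
  fix b
  show "continuous_on (closed_disc (?d b)) (?\<phi> b)"
    by (simp add: continuous_on_disc_to_sph)
  show "?\<phi> b x \<in> sph d" if "x \<in> closed_disc (?d b)" for x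
    using that disc_to_sph_in_sph[of x d] north_pole_sph[of d] by (cases b) simp_all
  show "\<exists>g. homeomorphism (open_disc (?d b)) (?\<phi> b ` open_disc (?d b)) (?\<phi> b) g"
  proof (cases b)
    case True
    then show ?thesis using homeomorphism_disc_to_sph[of d] image by auto
  next
    case False
    have "homeomorphism (open_disc 0) ((\<lambda>x. north_pole d) ` open_disc 0) (\<lambda>x. north_pole d) (\<lambda>y i. 0)"
      by (rule homeomorphismI) (auto simp: open_disc_0)
    then show ?thesis using False by auto
  qed
  show "b = b'" if "x \<in> open_disc (?d b)" "y \<in> open_disc (?d b')" "?\<phi> b x = ?\<phi> b' y" for b' x y
  proof -
    have "disc_to_sph d z \<noteq> north_pole d" if "z \<in> open_disc d" for z
      using image that by blast
    then show ?thesis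
      using that by (cases b; cases b') auto
  qed
  show "\<exists>F\<subseteq>UNIV. finite F \<and> (\<forall>j\<in>F. ?d j < ?d b) \<and>
      ?\<phi> b ` (closed_disc (?d b) - open_disc (?d b)) \<subseteq> (\<Union>j\<in>F. ?\<phi> j ` open_disc (?d j))"
  proof (cases b)
    case True
    then show ?thesis
      using assms disc_to_sph_boundary by (intro exI[of _ "{False}"]) (auto simp: open_disc_0)
  next
    case False
    then show ?thesis
      by (intro exI[of _ "{}"]) (auto simp: open_disc_0 closed_disc_0)
  qed
next
  have image: "disc_to_sph d ` open_disc d = sph d - {north_pole d}"
    using homeomorphism_disc_to_sph by (auto simp: homeomorphism_def)
  fix y assume "y \<in> sph d"
  then have "y \<in> disc_to_sph d ` open_disc d \<or> y = north_pole d"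
    unfolding image by blast
  then have "y \<in> ?\<phi> True ` open_disc (?d True) \<or> y \<in> ?\<phi> False ` open_disc (?d False)"
    by (auto simp: open_disc_0)
  then show "\<exists>b\<in>UNIV. y \<in> ?\<phi> b ` open_disc (?d b)"
    by blast
  show "\<exists>U. open U \<and> y \<in> U \<and> finite {b\<in>UNIV. ?\<phi> b ` closed_disc (?d b) \<inter> U \<noteq> {}}"
    by (intro exI[of _ UNIV]) auto
qed

text \<open>For \<open>d > 0\<close> the sphere is a continuous image of the closed disc; for
  \<open>d = 0\<close> it would consist of two points.\<close>

lemma
  assumes "0 < d"
  shows connected_sph: "connected (sph d)" and compact_sph: "compact (sph d)"
proof -
  \<comment> \<open>A boundary point of the disc, so that the north pole is attained as
    well.\<close>
  define e :: "nat \<Rightarrow> real" where "e i = (if i = 0 then 1 else 0)" for i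
  have "sqnorm d e = 1"
    using assms by (simp add: sqnorm_def e_def sum.delta if_distrib[of "\<lambda>x. x\<^sup>2"] cong: if_cong)
  then have e: "e \<in> closed_disc d - open_disc d"
    using assms by (auto simp: closed_disc_sqnorm open_disc_sqnorm Rn_iff e_def)
  have "disc_to_sph d ` open_disc d = sph d - {north_pole d}"
    using homeomorphism_disc_to_sph by (auto simp: homeomorphism_def)
  then have "sph d - {north_pole d} \<subseteq> disc_to_sph d ` closed_disc d"
    using open_disc_subset[of d] by (metis image_mono)
  moreover have "north_pole d \<in> disc_to_sph d ` closed_disc d"
    using e disc_to_sph_boundary[OF e] by (metis DiffD1 imageI)
  moreover have "disc_to_sph d ` closed_disc d \<subseteq> sph d"
    using disc_to_sph_in_sph by (rule image_subsetI)
  ultimately have sph: "sph d = disc_to_sph d ` closed_disc d"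
    by blast
  have "connected (closed_disc d)"
  proof (rule connected_star)
    fix x :: "nat \<Rightarrow> real" and c :: real assume x: "x \<in> closed_disc d" and c: "0 \<le> c" "c \<le> 1"
    have "sqnorm d (\<lambda>i. c * x i) = c\<^sup>2 * sqnorm d x"
      by (rule sqnorm_scale) simp
    also have "\<dots> \<le> 1"
      using x c sqnorm_nonneg[of d x] by (simp add: closed_disc_sqnorm mult_le_one power_le_one)
    finally show "(\<lambda>i. c * x i) \<in> closed_disc d"
      using x by (simp add: closed_disc_sqnorm Rn_iff)
  qed
  then show "connected (sph d)"
    unfolding sph by (rule connected_continuous_image[OF continuous_on_disc_to_sph])
  show "compact (sph d)"
    unfolding sph by (rule compact_continuous_image[OF continuous_on_disc_to_sph compact_closed_disc])
qed

subsection \<open>The manifold\<close>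

lemma polynomial_funs_peval:
  assumes "\<And>j. j < r \<Longrightarrow> polynomial_fun k (H j)"
  obtains h where "\<And>j. j < r \<Longrightarrow> poly_in k (h j)" "\<And>j. j < r \<Longrightarrow> peval (h j) = H j"
proof -
  have "\<forall>j. \<exists>p. j < r \<longrightarrow> poly_in k p \<and> peval p = H j"
    using assms polynomial_fun_peval by metis
  then obtain h where "\<forall>j. j < r \<longrightarrow> poly_in k (h j) \<and> peval (h j) = H j"
    by (rule exE[OF choice])
  then show ?thesis using that by blast
qed

text \<open>\<open>M\<close> is the entire zero set, hence the union of all its components, and full
  rank is tested along straight lines.\<close>

lemma nonsingular_zero_set:
  assumes h: "\<And>j. j < r \<Longrightarrow> poly_in k (h j)" "\<And>j. j < r \<Longrightarrow> peval (h j) = H j"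
    and M: "M = {x \<in> Rn k. \<forall>j<r. H j x = 0}"
    and surj: "\<And>x \<omega>. x \<in> M \<Longrightarrow> \<exists>v\<in>Rn k. \<forall>j<r.
      ((\<lambda>s. H j (\<lambda>i. x i + s * v i)) has_real_derivative \<omega> j) (at 0)"
  shows "nonsingular_wrt k r h M"
  unfolding nonsingular_wrt_def
proof (intro conjI ballI)
  have M': "M = zero_set k r h"
    using h(2) by (auto simp: M zero_set_def)
  have "zero_set k r h \<subseteq> Rn k"
    by (auto simp: zero_set_def)
  then show "\<exists>\<C>\<subseteq>conn_comps k (zero_set k r h). M = \<Union>\<C>"
    using Union_conn_comps M' by blast
  fix x assume x: "x \<in> M"
  show "diff_rank (Rn k) (tuple r (\<lambda>j. peval (h j))) x = r"
  proof (rule diff_rank_full_line)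
    show "x \<in> Rn k" using x by (simp add: M)
    fix \<omega>
    show "\<exists>v\<in>Rn k. \<forall>j<r. ((\<lambda>s. peval (h j) (\<lambda>i. x i + s * v i)) has_real_derivative \<omega> j) (at 0)"
      using surj[OF x, of \<omega>] by (simp add: h(2))
  qed
qed (use h(1) in simp)

lemma has_velocity_ex:
  assumes "\<And>i. \<exists>D. ((\<lambda>s. \<gamma> s i) has_real_derivative D) (at 0)"
  shows "\<exists>v. has_velocity \<gamma> v"
  unfolding has_velocity_def using choice[of "\<lambda>i D. ((\<lambda>s. \<gamma> s i) has_real_derivative D) (at 0)"] assms by blast

text \<open>
  With \<open>m = d + 2\<close>, the coordinates \<open>s, x, z\<close> have the indices \<open>0, 1, 2\<close>, and \<open>w\<close> occupies \<open>3, \<dots>, d + 3\<close>.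
\<close>

locale fibered_manifold =
  fixes \<alpha> \<beta> :: real and c q :: "real poly" and d :: nat
  assumes d_pos: "0 < d" and less: "\<alpha> < \<beta>"
    and c_nonneg: "\<not> (\<alpha> < s \<and> s < \<beta>) \<Longrightarrow> 0 \<le> poly c s"
    and q_root: "poly q s = 0 \<Longrightarrow> \<alpha> < s \<and> s < \<beta> \<and> poly (pderiv q) s \<noteq> 0"
begin

definition b :: "real \<Rightarrow> real"
  where "b s = (s - \<alpha>) * (\<beta> - s)"

text \<open>The squared radius of the sphere through which the tail \<open>w\<close> runs over
  \<open>(s, z)\<close>; where it is negative there are no points of \<open>M\<close>.\<close>

definition rsq :: "real \<Rightarrow> real \<Rightarrow> real"
  where "rsq s z = b s * (1 + poly c s * z\<^sup>2)"

definition F1 :: "(nat \<Rightarrow> real) \<Rightarrow> real"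
  where "F1 v = v 1 ^ 3 - poly q (v 0)"

definition F2 :: "(nat \<Rightarrow> real) \<Rightarrow> real"
  where "F2 v = sqnorm (Suc d) (\<lambda>i. v (3 + i)) - rsq (v 0) (v 2)"

definition M :: "(nat \<Rightarrow> real) set"
  where "M = {v \<in> Rn (d + 4). F1 v = 0 \<and> F2 v = 0}"

definition fiber :: "real \<Rightarrow> (nat \<Rightarrow> real) set"
  where "fiber s = {v \<in> M. v 0 = s}"

text \<open>Parametrises the fiber by \<open>z\<close> and the direction \<open>u\<close> of the
  tail; the direction is forgotten where the radius vanishes.\<close>

definition \<Phi> :: "real \<Rightarrow> real \<Rightarrow> (nat \<Rightarrow> real) \<Rightarrow> nat \<Rightarrow> real"
  where "\<Phi> s z u = (\<lambda>i. if i = 0 then s else if i = 1 then root 3 (poly q s)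
    else if i = 2 then z else sqrt (rsq s z) * u (i - 3))"

text \<open>The projection of the fiber over \<open>s\<close> to the coordinate
  \<open>z\<close>.\<close>

definition J :: "real \<Rightarrow> real set"
  where "J s = {z. 0 \<le> rsq s z}"

section \<open>Topology of the fibers\<close>

lemma b_pos: "\<alpha> < s \<Longrightarrow> s < \<beta> \<Longrightarrow> 0 < b s"
  by (simp add: b_def)

lemma b_nonneg: "\<alpha> \<le> s \<Longrightarrow> s \<le> \<beta> \<Longrightarrow> 0 \<le> b s"
  by (simp add: b_def)

lemma b_neg: "\<not> (\<alpha> \<le> s \<and> s \<le> \<beta>) \<Longrightarrow> b s < 0"
  using less by (auto simp: b_def mult_less_0_iff)

lemma M_range:
  assumes "v \<in> M"
  shows "\<alpha> \<le> v 0 \<and> v 0 \<le> \<beta>"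
proof (rule ccontr)
  assume out: "\<not> (\<alpha> \<le> v 0 \<and> v 0 \<le> \<beta>)"
  then have "0 \<le> poly c (v 0)"
    by (intro c_nonneg) auto
  then have "0 < 1 + poly c (v 0) * (v 2)\<^sup>2"
    by (simp add: add_pos_nonneg)
  with b_neg[OF out] have "rsq (v 0) (v 2) < 0"
    by (simp add: rsq_def mult_less_0_iff)
  moreover have "0 \<le> rsq (v 0) (v 2)"
    using assms sqnorm_nonneg[of "Suc d" "\<lambda>i. v (3 + i)"] by (simp add: M_def F2_def)
  ultimately show False by simp
qed

lemma root3_eq: "(y :: real) ^ 3 = x \<longleftrightarrow> y = root 3 x"
  by (metis odd_numeral odd_real_root_pow odd_real_root_power_cancel)

lemma \<Phi>_in_fiber:
  assumes "z \<in> J s" "u \<in> sph d"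
  shows "\<Phi> s z u \<in> fiber s"
proof -
  have "sqnorm (Suc d) (\<lambda>i. \<Phi> s z u (3 + i)) = (sqrt (rsq s z))\<^sup>2 * sqnorm (Suc d) u"
    by (rule sqnorm_scale) (simp add: \<Phi>_def)
  also have "\<dots> = rsq s z"
    using assms by (simp add: J_def sph_def)
  finally have "F2 (\<Phi> s z u) = 0"
    by (simp add: F2_def) (simp add: \<Phi>_def)
  moreover have "F1 (\<Phi> s z u) = 0"
    using root3_eq by (simp add: F1_def \<Phi>_def)
  moreover have "\<Phi> s z u \<in> Rn (d + 4)"
    using assms(2) by (auto simp: Rn_iff \<Phi>_def sph_def)
  ultimately show ?thesis
    by (simp add: fiber_def M_def) (simp add: \<Phi>_def)
qed

lemma fiber_D:
  assumes "v \<in> fiber s"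
  shows "v 0 = s" "v 1 = root 3 (poly q s)" "v 2 \<in> J s" "\<And>i. d + 4 \<le> i \<Longrightarrow> v i = 0"
    and "sqnorm (Suc d) (\<lambda>i. v (3 + i)) = rsq s (v 2)"
proof -
  show s: "v 0 = s"
    using assms by (simp add: fiber_def)
  show "v 1 = root 3 (poly q s)"
    using assms by (simp add: fiber_def M_def F1_def root3_eq)
  show sq: "sqnorm (Suc d) (\<lambda>i. v (3 + i)) = rsq s (v 2)"
    using assms by (simp add: fiber_def M_def F2_def s)
  show "v 2 \<in> J s"
    by (simp add: J_def sq[symmetric] sqnorm_nonneg)
  show "v i = 0" if "d + 4 \<le> i" for i
    using assms that by (simp add: fiber_def M_def Rn_iff)
qed

lemma fiber_tail_zero:
  assumes "v \<in> fiber s" "rsq s (v 2) = 0" "3 \<le> i"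
  shows "v i = 0"
proof (cases "i < d + 4")
  case True
  have "sqnorm (Suc d) (\<lambda>i. v (3 + i)) = 0"
    using fiber_D(5)[OF assms(1)] assms(2) by simp
  from sqnorm_eq_0[OF this, of "i - 3"] show ?thesis
    using True assms(3) by simp
qed (use fiber_D(4)[OF assms(1)] in simp)

lemma nat_cases4:
  obtains "i = 0" | "i = (1::nat)" | "i = 2" | "3 \<le> i"
  by linarith

lemma \<Phi>_unit_tail:
  assumes v: "v \<in> fiber s" and pos: "0 < rsq s (v 2)"
  defines "u \<equiv> \<lambda>i. v (3 + i) / sqrt (rsq s (v 2))"
  shows "u \<in> sph d" "\<Phi> s (v 2) u = v"
proof -
  have "sqnorm (Suc d) u = (1 / sqrt (rsq s (v 2)))\<^sup>2 * sqnorm (Suc d) (\<lambda>i. v (3 + i))"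
    by (rule sqnorm_scale) (simp add: u_def)
  also have "\<dots> = 1"
    using pos by (simp add: fiber_D(5)[OF v] power_divide)
  finally show "u \<in> sph d"
    using fiber_D(4)[OF v] by (simp add: sph_def Rn_iff u_def)
  show "\<Phi> s (v 2) u = v"
  proof
    fix i
    show "\<Phi> s (v 2) u i = v i"
      by (cases i rule: nat_cases4) (use pos fiber_D(1,2)[OF v] in \<open>simp_all add: \<Phi>_def u_def\<close>)
  qed
qed

text \<open>The sphere of directions is collapsed to one point, so \<open>u\<close> is arbitrary;
  over the two ends this happens for every \<open>z\<close>.\<close>

lemma \<Phi>_zero_tail:
  assumes v: "v \<in> fiber s" and zero: "rsq s (v 2) = 0"
  shows "\<Phi> s (v 2) u = v"
proof
  fix i
  show "\<Phi> s (v 2) u i = v i"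
    by (cases i rule: nat_cases4)
       (use zero fiber_D(1,2)[OF v] fiber_tail_zero[OF v zero] in \<open>simp_all add: \<Phi>_def\<close>)
qed

text \<open>A continuous surjection suffices for connectedness and compactness, so collapsed
  directions do no harm.\<close>

lemma fiber_eq_image: "fiber s = (\<lambda>(z, u). \<Phi> s z u) ` (J s \<times> sph d)"
proof
  show "(\<lambda>(z, u). \<Phi> s z u) ` (J s \<times> sph d) \<subseteq> fiber s"
    using \<Phi>_in_fiber by auto
  show "fiber s \<subseteq> (\<lambda>(z, u). \<Phi> s z u) ` (J s \<times> sph d)"
  proof
    fix v assume v: "v \<in> fiber s"
    have "0 \<le> rsq s (v 2)"
      using fiber_D(3)[OF v] by (simp add: J_def)
    then obtain u where "u \<in> sph d" "\<Phi> s (v 2) u = v"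
      using \<Phi>_unit_tail[OF v] \<Phi>_zero_tail[OF v] north_pole_sph[of d]
      by (cases "rsq s (v 2) = 0") (metis, metis less_eq_real_def)
    then show "v \<in> (\<lambda>(z, u). \<Phi> s z u) ` (J s \<times> sph d)"
      using fiber_D(3)[OF v] by (intro image_eqI[of _ _ "(v 2, u)"]) auto
  qed
qed

lemma continuous_on_poly_comp:
  "continuous_on S f \<Longrightarrow> continuous_on S (\<lambda>x. poly p (f x :: real))"
  by (rule continuous_on_compose2[of UNIV "poly p"]) (auto intro: continuous_on_poly continuous_on_id)

lemma continuous_on_rsq:
  "continuous_on S f \<Longrightarrow> continuous_on S g \<Longrightarrow> continuous_on S (\<lambda>x. rsq (f x) (g x))"
  unfolding rsq_def b_def
  by (intro continuous_on_mult continuous_on_add continuous_on_diff continuous_on_power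
      continuous_on_poly_comp continuous_on_const)

lemma continuous_on_\<Phi>:
  assumes "continuous_on S f" "continuous_on S g" "continuous_on S h"
  shows "continuous_on S (\<lambda>x. \<Phi> (f x) (g x) (h x))"
proof -
  have "continuous_on S (\<lambda>x. h x i)" for i
    using continuous_on_compose2[OF continuous_on_coord[of UNIV] assms(3)] by simp
  then show ?thesis
    unfolding \<Phi>_def
    by (intro continuous_on_coordinatewise_then_product continuous_on_if_const assms
        continuous_on_mult continuous_on_real_sqrt continuous_on_real_root
        continuous_on_poly_comp continuous_on_rsq)
qed

lemma continuous_on_\<Phi>_fiber: "continuous_on S (\<lambda>(z, u). \<Phi> s z u)"
  unfolding case_prod_unfold
  by (intro continuous_on_\<Phi> continuous_on_const continuous_on_fst continuous_on_snd continuous_on_id)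

lemma J_eq_UNIV:
  assumes "\<alpha> \<le> s" "s \<le> \<beta>" "0 \<le> poly c s"
  shows "J s = UNIV"
  using assms b_nonneg[of s] by (auto simp: J_def rsq_def)

lemma J_eq_interval:
  assumes "\<alpha> < s" "s < \<beta>" "poly c s < 0"
  shows "J s = {- sqrt (1 / - poly c s) .. sqrt (1 / - poly c s)}"
proof -
  have *: "z \<in> J s \<longleftrightarrow> \<bar>z\<bar> \<le> sqrt (1 / - poly c s)" for z
  proof -
    have "z \<in> J s \<longleftrightarrow> 0 \<le> 1 + poly c s * z\<^sup>2"
      using b_pos[OF assms(1,2)] by (simp add: J_def rsq_def zero_le_mult_iff)
    also have "\<dots> \<longleftrightarrow> z\<^sup>2 \<le> 1 / - poly c s"
    proof -
      have "z\<^sup>2 \<le> 1 / - poly c s \<longleftrightarrow> z\<^sup>2 * - poly c s \<le> 1"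
        by (rule pos_le_divide_eq) (use assms(3) in simp)
      also have "z\<^sup>2 * - poly c s = - (poly c s * z\<^sup>2)"
        by simp
      finally show ?thesis
        by linarith
    qed
    also have "\<dots> \<longleftrightarrow> \<bar>z\<bar> \<le> sqrt (1 / - poly c s)"
      by (metis real_sqrt_abs real_sqrt_le_iff)
    finally show ?thesis .
  qed
  show ?thesis
    by (rule set_eqI, unfold * atLeastAtMost_iff) linarith
qed

lemma J_cases:
  assumes "\<alpha> \<le> s" "s \<le> \<beta>"
  obtains "0 \<le> poly c s" "J s = UNIV"
  | "\<alpha> < s" "s < \<beta>" "poly c s < 0" "J s = {- sqrt (1 / - poly c s) .. sqrt (1 / - poly c s)}"
  using J_eq_UNIV J_eq_interval c_nonneg assms by (metis not_le)

lemma zero_in_J: "\<alpha> \<le> s \<Longrightarrow> s \<le> \<beta> \<Longrightarrow> 0 \<in> J s"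
  by (simp add: J_def rsq_def b_nonneg)

lemma connected_fiber:
  assumes "\<alpha> \<le> s" "s \<le> \<beta>"
  shows "connected (fiber s)"
proof -
  have "connected (J s)"
    using assms by (cases rule: J_cases) auto
  then have "connected (J s \<times> sph d)"
    using connected_sph[OF d_pos] by (rule connected_Times)
  then show ?thesis
    unfolding fiber_eq_image by (rule connected_continuous_image[OF continuous_on_\<Phi>_fiber])
qed

lemma compact_fiber:
  assumes "\<alpha> < s" "s < \<beta>" "poly c s < 0"
  shows "compact (fiber s)"
proof -
  have "compact (J s)"
    unfolding J_eq_interval[OF assms] by simp
  then have "compact (J s \<times> sph d)"
    using compact_sph[OF d_pos] by (rule compact_Times)
  then show ?thesis
    unfolding fiber_eq_image by (rule compact_continuous_image[OF continuous_on_\<Phi>_fiber])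
qed

text \<open>The coordinate \<open>z\<close> takes all real values on such a fiber.\<close>

lemma not_compact_fiber:
  assumes "\<alpha> \<le> s" "s \<le> \<beta>" "0 \<le> poly c s"
  shows "\<not> compact (fiber s)"
proof
  assume "compact (fiber s)"
  then have "compact ((\<lambda>v. v 2) ` fiber s)"
    by (rule compact_continuous_image[OF continuous_on_coord])
  moreover have "z \<in> (\<lambda>v. v 2) ` fiber s" for z
  proof
    show "\<Phi> s z (north_pole d) \<in> fiber s"
      using J_eq_UNIV[OF assms] by (intro \<Phi>_in_fiber north_pole_sph) simp
    show "z = \<Phi> s z (north_pole d) 2"
      by (simp add: \<Phi>_def)
  qed
  then have "(\<lambda>v. v 2) ` fiber s = UNIV" by blast
  ultimately show False
    by (simp add: compact_eq_bounded_closed)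
qed

lemma M_eq_fibers: "M = (\<Union>s\<in>{\<alpha>..\<beta>}. fiber s)"
  using M_range by (auto simp: fiber_def)

lemma image_coord0: "(\<lambda>v. v 0) ` M = {\<alpha>..\<beta>}"
proof
  show "(\<lambda>v. v 0) ` M \<subseteq> {\<alpha>..\<beta>}"
    using M_range by auto
  show "{\<alpha>..\<beta>} \<subseteq> (\<lambda>v. v 0) ` M"
  proof
    fix s assume s: "s \<in> {\<alpha>..\<beta>}"
    then have "\<Phi> s 0 (north_pole d) \<in> fiber s"
      by (intro \<Phi>_in_fiber zero_in_J north_pole_sph) auto
    then show "s \<in> (\<lambda>v. v 0) ` M"
      unfolding fiber_def by (intro image_eqI[of _ _ "\<Phi> s 0 (north_pole d)"]) simp_all
  qed
qed

text \<open>The value \<open>z = 0\<close> is allowed over every \<open>s\<close> of the interval,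
  so fixing it and a direction of the tail gives a continuous section that links the connected
  fibers.\<close>

lemma connected_M: "connected M"
proof -
  define \<sigma> where "\<sigma> s = \<Phi> s 0 (north_pole d)" for s
  have \<sigma>: "\<sigma> s \<in> fiber s" if "s \<in> {\<alpha>..\<beta>}" for s
    unfolding \<sigma>_def using that by (intro \<Phi>_in_fiber zero_in_J north_pole_sph) auto
  have sec: "connected (\<sigma> ` {\<alpha>..\<beta>})"
    unfolding \<sigma>_def [abs_def]
    by (intro connected_continuous_image continuous_on_\<Phi> continuous_on_id continuous_on_const connected_Icc)
  let ?X = "(\<lambda>s. \<sigma> ` {\<alpha>..\<beta>} \<union> fiber s) ` {\<alpha>..\<beta>}"
  have "connected (\<Union>?X)"
  proof (rule connected_Union)
    fix T assume "T \<in> ?X"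
    then obtain s where s: "s \<in> {\<alpha>..\<beta>}" and T: "T = \<sigma> ` {\<alpha>..\<beta>} \<union> fiber s" by blast
    have "connected (fiber s)"
      using s by (intro connected_fiber) auto
    moreover have "\<sigma> s \<in> \<sigma> ` {\<alpha>..\<beta>} \<inter> fiber s"
      using s \<sigma> by blast
    ultimately show "connected T"
      unfolding T using sec by (intro connected_Un) auto
  next
    have "\<sigma> \<alpha> \<in> \<Inter>?X" using less by auto
    then show "\<Inter>?X \<noteq> {}" by blast
  qed
  moreover have "\<Union>?X = M"
  proof -
    have "\<sigma> ` {\<alpha>..\<beta>} \<subseteq> M"
      using \<sigma> by (auto simp: fiber_def)
    then show ?thesis
      using less unfolding M_eq_fibers by auto
  qed
  ultimately show ?thesis by simp
qed

text \<open>One model for each shape of the fiber, with cells of dimension at most 1 for the line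
  and \<open>d + 1\<close> for the cylinder and the sphere; \<open>d + 1\<close> is
  \<open>m - 1\<close>.\<close>

lemma CW_structure_fiber:
  assumes "\<alpha> \<le> s" "s \<le> \<beta>"
  shows "\<exists>C. CW_structure (top_of_set (fiber s)) C \<and> (\<forall>(e, \<phi>)\<in>C. e \<le> d + 1)"
proof -
  consider (line) "b s = 0" | (cylinder) "0 < b s" "0 \<le> poly c s" | (sphere) "0 < b s" "poly c s < 0"
    using b_nonneg[OF assms] by linarith
  then show ?thesis
  proof cases
    case line
    then have rsq: "rsq s z = 0" for z
      by (simp add: rsq_def)
    have "homeomorphism UNIV (fiber s) (\<lambda>z. \<Phi> s z (north_pole d)) (\<lambda>v. v 2)"
    proof (rule homeomorphismI)
      show "(\<lambda>z. \<Phi> s z (north_pole d)) ` UNIV \<subseteq> fiber s"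
        using rsq by (intro image_subsetI \<Phi>_in_fiber north_pole_sph) (simp add: J_def)
      show "\<Phi> s (v 2) (north_pole d) = v" if "v \<in> fiber s" for v
        using \<Phi>_zero_tail[OF that rsq] .
      show "\<Phi> s z (north_pole d) 2 = z" for z
        by (simp add: \<Phi>_def)
    qed (intro continuous_on_\<Phi> continuous_on_id continuous_on_const continuous_on_coord | simp)+
    note CW = lf_cw.CW_structure[OF lf_cw.lf_cw_homeomorphism[OF lf_cw_real this]]
    show ?thesis
      by (rule exI, rule conjI, rule CW) auto
  next
    case cylinder
    then have rsq: "0 < rsq s z" for z
      by (simp add: rsq_def add_pos_nonneg)
    have "homeomorphism (UNIV \<times> sph d) (fiber s) (\<lambda>(z, u). \<Phi> s z u)
        (\<lambda>v. (v 2, \<lambda>i. v (3 + i) / sqrt (rsq s (v 2))))"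
    proof (rule homeomorphismI)
      show "continuous_on (UNIV \<times> sph d) (\<lambda>(z, u). \<Phi> s z u)"
        by (rule continuous_on_\<Phi>_fiber)
      have "sqrt (rsq s z) \<noteq> 0" for z
        using rsq[of z] by simp
      then show "continuous_on (fiber s) (\<lambda>v. (v 2, \<lambda>i. v (3 + i) / sqrt (rsq s (v 2))))"
        by (intro continuous_on_Pair continuous_on_coordinatewise_then_product continuous_on_divide
            continuous_on_real_sqrt continuous_on_rsq continuous_on_coord continuous_on_const) simp
      show "(\<lambda>(z, u). \<Phi> s z u) ` (UNIV \<times> sph d) \<subseteq> fiber s"
        using \<Phi>_in_fiber less_imp_le[OF rsq] by (auto simp: J_def)
      show "(\<lambda>v. (v 2, \<lambda>i. v (3 + i) / sqrt (rsq s (v 2)))) ` fiber s \<subseteq> UNIV \<times> sph d"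
        using \<Phi>_unit_tail(1)[OF _ rsq] by auto
      show "(\<lambda>v. (v 2, \<lambda>i. v (3 + i) / sqrt (rsq s (v 2)))) ((\<lambda>(z, u). \<Phi> s z u) w) = w"
        if "w \<in> UNIV \<times> sph d" for w
        using less_imp_neq[OF rsq] by (cases w) (simp add: \<Phi>_def)
      show "(\<lambda>(z, u). \<Phi> s z u) (v 2, \<lambda>i. v (3 + i) / sqrt (rsq s (v 2))) = v" if "v \<in> fiber s" for v
        using \<Phi>_unit_tail(2)[OF that rsq] by simp
    qed
    note CW = lf_cw.CW_structure[OF lf_cw.lf_cw_homeomorphism[OF lf_cw_product[OF lf_cw_real lf_cw_sph[OF d_pos]] this]]
    show ?thesis
      by (rule exI, rule conjI, rule CW) auto
  next
    case sphere
    \<comment> \<open>The fiber is the ellipsoid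
      \<open>|w|\<^sup>2 / r\<^sup>2 + k\<^sup>2 * z\<^sup>2 = 1\<close>; \<open>r\<close> and
      \<open>k\<close> scale it to the unit sphere, with \<open>z\<close> as the last
      coordinate.\<close>
    define k where "k = sqrt (- poly c s)"
    define r where "r = sqrt (b s)"
    have k: "0 < k" "k\<^sup>2 = - poly c s" and r: "0 < r" "r\<^sup>2 = b s"
      using sphere by (auto simp: k_def r_def)
    define f where "f y = (\<lambda>i. if i = 0 then s else if i = 1 then root 3 (poly q s)
      else if i = 2 then y (Suc d) / k else if i < d + 4 then r * y (i - 3) else 0)" for y :: "nat \<Rightarrow> real"
    define g where "g v = (\<lambda>i. if i < Suc d then v (3 + i) / r else if i = Suc d then k * v 2 else 0)"
      for v :: "nat \<Rightarrow> real"
    have "homeomorphism (sph (Suc d)) (fiber s) f g"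
    proof (rule homeomorphismI)
      show "continuous_on (sph (Suc d)) f"
        unfolding f_def [abs_def]
        by (intro continuous_on_coordinatewise_then_product continuous_on_if_const continuous_on_mult
            continuous_on_divide continuous_on_coord continuous_on_const) (use k in simp)
      show "continuous_on (fiber s) g"
        unfolding g_def [abs_def]
        by (intro continuous_on_coordinatewise_then_product continuous_on_if_const continuous_on_mult
            continuous_on_divide continuous_on_coord continuous_on_const) (use r in simp)
      show "f ` sph (Suc d) \<subseteq> fiber s"
      proof (rule image_subsetI)
        fix y assume y: "y \<in> sph (Suc d)"
        have "sqnorm (Suc d) (\<lambda>i. f y (3 + i)) = r\<^sup>2 * sqnorm (Suc d) y"
          by (rule sqnorm_scale) (simp add: f_def)
        also have "\<dots> = b s * (1 - (y (Suc d))\<^sup>2)"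
          using y by (simp add: r(2) sph_def sqnorm_Suc[of "Suc d"])
        also have "\<dots> = rsq s (f y 2)"
          using k sphere(2) by (simp add: rsq_def f_def power_divide)
        finally show "f y \<in> fiber s"
          using root3_eq by (simp add: fiber_def M_def F1_def F2_def Rn_iff) (simp add: f_def)
      qed
      show "g ` fiber s \<subseteq> sph (Suc d)"
      proof (rule image_subsetI)
        fix v assume v: "v \<in> fiber s"
        have "sqnorm (Suc d) (g v) = (1 / r)\<^sup>2 * sqnorm (Suc d) (\<lambda>i. v (3 + i))"
          by (rule sqnorm_scale) (simp add: g_def)
        also have "\<dots> = 1 + poly c s * (v 2)\<^sup>2"
          using r sphere(1) by (simp add: fiber_D(5)[OF v] rsq_def power_divide)
        finally have "sqnorm (Suc (Suc d)) (g v) = 1"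
          using k by (simp add: sqnorm_Suc[of "Suc d"] g_def power_mult_distrib)
        then show "g v \<in> sph (Suc d)"
          by (simp add: sph_def Rn_iff) (simp add: g_def)
      qed
      show "g (f y) = y" if "y \<in> sph (Suc d)" for y
      proof
        fix i
        have "y i = 0" if "Suc d < i"
          using \<open>y \<in> sph (Suc d)\<close> that by (simp add: sph_def Rn_iff)
        then show "g (f y) i = y i"
          using k(1) r(1) by (simp add: f_def g_def)
      qed
      show "f (g v) = v" if v: "v \<in> fiber s" for v
      proof
        fix i
        show "f (g v) i = v i"
          by (cases i rule: nat_cases4)
             (use k(1) r(1) fiber_D(1,2,4)[OF v] in \<open>auto simp: f_def g_def\<close>)
      qed
    qed
    note CW = lf_cw.CW_structure[OF lf_cw.lf_cw_homeomorphism[OF lf_cw_sph this]]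
    show ?thesis
      by (rule exI, rule conjI, rule CW) auto
  qed
qed

end

section \<open>Differentials of the defining equations\<close>

lemma has_derivative_poly_comp:
  assumes "(f has_real_derivative D) (at x)"
  shows "((\<lambda>t. poly p (f t)) has_real_derivative poly (pderiv p) (f x) * D) (at x)"
  by (rule DERIV_chain2[OF poly_DERIV assms])

lemma eventually_pos_nhds:
  fixes h :: "real \<Rightarrow> real"
  assumes "isCont h x" "0 < h x"
  shows "\<forall>\<^sub>F t in nhds x. 0 < h t"
  using order_tendstoD(1)[of h "h x" "nhds x" 0] assms
  by (simp add: isCont_def tendsto_at_iff_tendsto_nhds)

context fibered_manifold
begin

text \<open>The partial derivative of \<open>rsq\<close> in \<open>s\<close>; the factor
  \<open>\<alpha> + \<beta> - 2 * s\<close> is the derivative of \<open>b\<close>.\<close>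

definition rsq_s :: "real \<Rightarrow> real \<Rightarrow> real"
  where "rsq_s s z = (\<alpha> + \<beta> - 2 * s) * (1 + poly c s * z\<^sup>2) + b s * (poly (pderiv c) s * z\<^sup>2)"

definition rsq_z :: "real \<Rightarrow> real \<Rightarrow> real"
  where "rsq_z s z = 2 * b s * poly c s * z"

lemma DERIV_rsq:
  assumes "(f has_real_derivative f') (at x)" "(g has_real_derivative g') (at x)"
  shows "((\<lambda>t. rsq (f t) (g t)) has_real_derivative
    rsq_s (f x) (g x) * f' + rsq_z (f x) (g x) * g') (at x)"
  unfolding rsq_def b_def rsq_s_def rsq_z_def
  by (rule derivative_eq_intros has_derivative_poly_comp assms refl)+
     (simp add: power2_eq_square algebra_simps)

lemma DERIV_F1:
  "((\<lambda>t. F1 (\<lambda>i. v i + t * w i)) has_real_derivative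
    3 * (v 1)\<^sup>2 * w 1 - poly (pderiv q) (v 0) * w 0) (at 0)"
  unfolding F1_def
  by (rule derivative_eq_intros has_derivative_poly_comp refl)+
     (simp add: power2_eq_square)

lemma DERIV_sqnorm:
  "((\<lambda>t. sqnorm n (\<lambda>i. v i + t * w i)) has_real_derivative 2 * (\<Sum>i<n. v i * w i)) (at 0)"
  unfolding sqnorm_def
proof -
  have "((\<lambda>t. (v i + t * w i)\<^sup>2) has_real_derivative 2 * (v i * w i)) (at 0)" for i
    by (rule derivative_eq_intros refl)+ (simp add: power2_eq_square)
  then have "((\<lambda>t. \<Sum>i<n. (v i + t * w i)\<^sup>2) has_real_derivative (\<Sum>i<n. 2 * (v i * w i))) (at 0)"
    by (rule DERIV_sum)
  then show "((\<lambda>t. \<Sum>i<n. (v i + t * w i)\<^sup>2) has_real_derivative 2 * (\<Sum>i<n. v i * w i)) (at 0)"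
    by (simp add: sum_distrib_left)
qed

text \<open>The differential of \<open>F2\<close> at \<open>v\<close> applied to \<open>w\<close>;
  the corrections below rely on its linearity in \<open>w\<close>.\<close>

definition dF2 :: "(nat \<Rightarrow> real) \<Rightarrow> (nat \<Rightarrow> real) \<Rightarrow> real"
  where "dF2 v w = 2 * (\<Sum>i<Suc d. v (3 + i) * w (3 + i)) -
    (rsq_s (v 0) (v 2) * w 0 + rsq_z (v 0) (v 2) * w 2)"

lemma DERIV_F2: "((\<lambda>t. F2 (\<lambda>i. v i + t * w i)) has_real_derivative dF2 v w) (at 0)"
proof -
  have line: "((\<lambda>t. v i + t * w i) has_real_derivative w i) (at 0)" for i
    by (auto intro!: derivative_eq_intros)
  have "((\<lambda>t. rsq (v 0 + t * w 0) (v 2 + t * w 2)) has_real_derivative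
      rsq_s (v 0) (v 2) * w 0 + rsq_z (v 0) (v 2) * w 2) (at 0)"
    using DERIV_rsq[OF line[of 0] line[of 2]] by simp
  from DERIV_diff[OF DERIV_sqnorm this] show ?thesis
    by (simp only: F2_def dF2_def)
qed

lemma dF2_add: "dF2 v (\<lambda>i. w i + t * e i) = dF2 v w + t * dF2 v e"
  by (simp add: dF2_def algebra_simps sum.distrib sum_distrib_left)

lemma b_zero: "b s = 0 \<longleftrightarrow> s = \<alpha> \<or> s = \<beta>"
  by (auto simp: b_def)

text \<open>A direction along which \<open>F2\<close> can be corrected without disturbing
  \<open>s\<close> or \<open>F1\<close> to first order. If the tail is not 0, it is radial in the
  tail; otherwise \<open>1 + c z\<^sup>2 = 0\<close>, so neither \<open>c\<close> nor
  \<open>z\<close> is 0 and the direction of \<open>z\<close> works.\<close>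

lemma vertical_direction:
  assumes "v \<in> M" "\<alpha> < v 0" "v 0 < \<beta>"
  shows "\<exists>e\<in>Rn (d + 4). e 0 = 0 \<and> e 1 = 0 \<and> dF2 v e = 1"
proof -
  have v: "v \<in> fiber (v 0)"
    using assms by (simp add: fiber_def)
  let ?T = "sqnorm (Suc d) (\<lambda>i. v (3 + i))"
  note T = fiber_D(5)[OF v]
  show ?thesis
  proof (cases "?T = 0")
    case False
    define e where "e i = (if i < 3 then 0 else v i / (2 * ?T))" for i
    have "(\<Sum>i<Suc d. v (3 + i) * e (3 + i)) = ?T / (2 * ?T)"
      unfolding e_def sqnorm_def sum_divide_distrib by (rule sum.cong) (simp_all add: power2_eq_square)
    then have "dF2 v e = 1"
      using False by (simp only: dF2_def) (simp add: e_def)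
    moreover have "e \<in> Rn (d + 4)"
      using fiber_D(4)[OF v] by (simp add: Rn_iff e_def)
    ultimately show ?thesis
      by (intro bexI[of _ e]) (simp_all add: e_def)
  next
    case True
    then have "1 + poly c (v 0) * (v 2)\<^sup>2 = 0"
      using T b_pos[OF assms(2,3)] by (simp add: rsq_def)
    then have nz: "rsq_z (v 0) (v 2) \<noteq> 0"
      using b_pos[OF assms(2,3)] by (auto simp: rsq_z_def)
    define e where "e i = (if i = 2 then - 1 / rsq_z (v 0) (v 2) else 0)" for i :: nat
    have "dF2 v e = 1"
      using nz by (simp add: dF2_def e_def)
    then show ?thesis
      by (intro bexI[of _ e]) (simp_all add: e_def Rn_iff)
  qed
qed

text \<open>Each case supplies a non-zero partial derivative: of \<open>F1\<close> in
  \<open>x\<close>, of \<open>F1\<close> in \<open>s\<close>, or of \<open>F2\<close> in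
  \<open>s\<close>. At the ends \<open>b\<close> is 0 and \<open>c\<close> is non-negative, so the
  derivative of \<open>rsq\<close> in \<open>s\<close> reduces to the non-zero product of
  \<open>\<alpha> + \<beta> - 2 * s\<close> and \<open>1 + c z\<^sup>2\<close>.\<close>

lemma M_cases:
  assumes "v \<in> M"
  obtains (regular) "\<alpha> < v 0" "v 0 < \<beta>" "v 1 \<noteq> 0" "poly q (v 0) \<noteq> 0"
  | (critical) "\<alpha> < v 0" "v 0 < \<beta>" "v 1 = 0" "poly q (v 0) = 0" "poly (pderiv q) (v 0) \<noteq> 0"
  | (extremal) "v 0 = \<alpha> \<or> v 0 = \<beta>" "v 1 \<noteq> 0" "rsq_s (v 0) (v 2) \<noteq> 0"
proof -
  have eq: "v 1 ^ 3 = poly q (v 0)"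
    using assms by (simp add: M_def F1_def)
  show ?thesis
  proof (cases "v 0 = \<alpha> \<or> v 0 = \<beta>")
    case True
    then have "poly q (v 0) \<noteq> 0" "0 \<le> poly c (v 0)"
      using q_root[of "v 0"] by (auto intro!: c_nonneg)
    then have "0 < 1 + poly c (v 0) * (v 2)\<^sup>2"
      by (simp add: add_pos_nonneg)
    moreover have "\<alpha> + \<beta> - 2 * v 0 \<noteq> 0" "b (v 0) = 0"
      using True less by (auto simp: b_zero)
    ultimately have "rsq_s (v 0) (v 2) \<noteq> 0"
      by (simp add: rsq_s_def)
    then show ?thesis
      using extremal True eq \<open>poly q (v 0) \<noteq> 0\<close> by fastforce
  next
    case False
    then have "\<alpha> < v 0" "v 0 < \<beta>"
      using M_range[OF assms] by auto
    show ?thesis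
    proof (cases "v 1 = 0")
      case True
      then have "poly q (v 0) = 0" using eq by simp
      then show ?thesis
        using critical True \<open>\<alpha> < v 0\<close> \<open>v 0 < \<beta>\<close> q_root by blast
    next
      case False
      then have "poly q (v 0) \<noteq> 0" using eq by (metis power_eq_0_iff)
      then show ?thesis
        using regular False \<open>\<alpha> < v 0\<close> \<open>v 0 < \<beta>\<close> by blast
    qed
  qed
qed

text \<open>The system is triangular. Inside the interval \<open>F1\<close> is solved by
  \<open>x\<close> or by \<open>s\<close>, and \<open>F2\<close> is then corrected along the
  vertical direction; at the ends \<open>F2\<close> is solved by \<open>s\<close>, and
  \<open>F1\<close> afterwards by \<open>x\<close>.\<close>

lemma surjective_dF:
  assumes "v \<in> M"
  shows "\<exists>w\<in>Rn (d + 4). 3 * (v 1)\<^sup>2 * w 1 - poly (pderiv q) (v 0) * w 0 = \<omega>\<^sub>1 \<and> dF2 v w = \<omega>\<^sub>2"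
  using assms
proof (cases rule: M_cases)
  case regular
  then obtain e where e: "e \<in> Rn (d + 4)" "e 0 = 0" "e 1 = 0" "dF2 v e = 1"
    using vertical_direction[OF assms] by blast
  define w0 where "w0 i = (if i = 1 then \<omega>\<^sub>1 / (3 * (v 1)\<^sup>2) else 0)" for i :: nat
  show ?thesis
    using e regular by (intro bexI[of _ "\<lambda>i. w0 i + (\<omega>\<^sub>2 - dF2 v w0) * e i"])
      (simp_all add: dF2_add Rn_iff, simp_all add: w0_def)
next
  case critical
  then obtain e where e: "e \<in> Rn (d + 4)" "e 0 = 0" "e 1 = 0" "dF2 v e = 1"
    using vertical_direction[OF assms] by blast
  define w0 where "w0 i = (if i = 0 then - \<omega>\<^sub>1 / poly (pderiv q) (v 0) else 0)" for i :: nat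
  show ?thesis
    using e critical by (intro bexI[of _ "\<lambda>i. w0 i + (\<omega>\<^sub>2 - dF2 v w0) * e i"])
      (simp_all add: dF2_add Rn_iff, simp_all add: w0_def)
next
  case extremal
  define \<sigma> where "\<sigma> = - \<omega>\<^sub>2 / rsq_s (v 0) (v 2)"
  define w where "w i = (if i = 0 then \<sigma>
    else if i = 1 then (\<omega>\<^sub>1 + poly (pderiv q) (v 0) * \<sigma>) / (3 * (v 1)\<^sup>2) else 0)" for i :: nat
  have "dF2 v w = \<omega>\<^sub>2"
    using extremal by (simp add: dF2_def w_def \<sigma>_def)
  then show ?thesis
    using extremal by (intro bexI[of _ w]) (simp_all add: w_def Rn_iff)
qed

text \<open>As \<open>x\<close> is not 0 here, it solves \<open>F1\<close> for any prescribed
  velocity of \<open>s\<close>, and the vertical direction remains for \<open>F2\<close>.\<close>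

lemma surjective_dF_regular:
  assumes "v \<in> M" "\<alpha> < v 0" "v 0 < \<beta>" "poly q (v 0) \<noteq> 0"
  shows "\<exists>w\<in>Rn (d + 4). 3 * (v 1)\<^sup>2 * w 1 - poly (pderiv q) (v 0) * w 0 = \<omega>\<^sub>1 \<and> dF2 v w = \<omega>\<^sub>2 \<and> w 0 = \<omega>\<^sub>3"
proof -
  obtain e where e: "e \<in> Rn (d + 4)" "e 0 = 0" "e 1 = 0" "dF2 v e = 1"
    using vertical_direction[OF assms(1-3)] by blast
  have v1: "v 1 \<noteq> 0"
    using assms by (auto simp: M_def F1_def)
  define w0 where "w0 i = (if i = 0 then \<omega>\<^sub>3
    else if i = 1 then (\<omega>\<^sub>1 + poly (pderiv q) (v 0) * \<omega>\<^sub>3) / (3 * (v 1)\<^sup>2) else 0)" for i :: nat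
  show ?thesis
    using e v1 by (intro bexI[of _ "\<lambda>i. w0 i + (\<omega>\<^sub>2 - dF2 v w0) * e i"])
      (simp_all add: dF2_add Rn_iff, simp_all add: w0_def)
qed

lemma polynomial_fun_F1: "polynomial_fun (d + 4) F1"
  unfolding F1_def [abs_def] by (intro polynomial_intros) simp_all

lemma polynomial_fun_F2: "polynomial_fun (d + 4) F2"
  unfolding F2_def [abs_def] sqnorm_def rsq_def b_def by (intro polynomial_intros) simp_all

lemma nonsingular_alg_manifold_M: "nonsingular_alg_manifold (d + 4) (d + 2) M"
proof -
  define H where "H j = (if j = 0 then F1 else F2)" for j :: nat
  have "polynomial_fun (d + 4) (H j)" for j
    by (simp add: H_def polynomial_fun_F1 polynomial_fun_F2)
  then obtain h where h: "\<And>j. j < 2 \<Longrightarrow> poly_in (d + 4) (h j)" "\<And>j. j < 2 \<Longrightarrow> peval (h j) = H j"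
    using polynomial_funs_peval[of 2 "d + 4" H] by blast
  have all2: "(\<forall>j<2. P j) \<longleftrightarrow> P 0 \<and> P 1" for P :: "nat \<Rightarrow> bool"
    by (auto simp: less_2_cases_iff)
  have "nonsingular_wrt (d + 4) 2 h M"
  proof (rule nonsingular_zero_set[OF h])
    show "M = {x \<in> Rn (d + 4). \<forall>j<2. H j x = 0}"
      by (simp add: all2 M_def H_def)
    fix v and \<omega> :: "nat \<Rightarrow> real" assume "v \<in> M"
    then obtain w where w: "w \<in> Rn (d + 4)"
      "3 * (v 1)\<^sup>2 * w 1 - poly (pderiv q) (v 0) * w 0 = \<omega> 0" "dF2 v w = \<omega> 1"
      using surjective_dF by blast
    show "\<exists>w\<in>Rn (d + 4). \<forall>j<2. ((\<lambda>s. H j (\<lambda>i. v i + s * w i)) has_real_derivative \<omega> j) (at 0)"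
      using w(1) DERIV_F1[of v w] DERIV_F2[of v w] unfolding w(2,3)
      by (intro bexI[of _ w]) (simp_all add: all2 H_def)
  qed auto
  then show ?thesis
    unfolding nonsingular_alg_manifold_def by (intro exI[of _ 2] exI[of _ h]) simp
qed

text \<open>The equation \<open>v 0 = s\<close> joins the two equations of \<open>M\<close>; three
  independent equations in \<open>d + 4\<close> coordinates leave dimension
  \<open>d + 1\<close>.\<close>

lemma smooth_submanifold_fiber:
  assumes "\<alpha> < s" "s < \<beta>" "poly q s \<noteq> 0"
  shows "smooth_submanifold (d + 4) (d + 1) 0 (fiber s)"
  unfolding smooth_submanifold_def
proof (intro conjI ballI)
  show "fiber s \<subseteq> Rn (d + 4)"
    by (auto simp: fiber_def M_def)
  fix v assume v: "v \<in> fiber s"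
  define H where "H j = (if j = 0 then F1 else if j = 1 then F2 else (\<lambda>v. v 0 - s))" for j :: nat
  have all3: "(\<forall>j<3. P j) \<longleftrightarrow> P 0 \<and> P 1 \<and> P 2" for P :: "nat \<Rightarrow> bool"
    by (auto simp: numeral_3_eq_3 less_Suc_eq numeral_2_eq_2)
  have smooth: "smooth_fun_on (d + 4) U (H j)" for U j
  proof -
    have "polynomial_fun (d + 4) (\<lambda>v. v 0 - s)"
      by (intro polynomial_intros) simp
    then show ?thesis
      by (auto simp: H_def intro: polynomial_fun_smooth polynomial_fun_F1 polynomial_fun_F2)
  qed
  have vanish: "\<forall>j<3. H j v = 0"
    using v by (simp add: all3 H_def fiber_def M_def)
  have rank: "diff_rank (Rn (d + 4)) (tuple 3 H) v = 3"
  proof (rule diff_rank_full_line)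
    show "v \<in> Rn (d + 4)"
      using v by (simp add: fiber_def M_def)
    fix \<omega> :: "nat \<Rightarrow> real"
    obtain w where w: "w \<in> Rn (d + 4)"
      "3 * (v 1)\<^sup>2 * w 1 - poly (pderiv q) (v 0) * w 0 = \<omega> 0" "dF2 v w = \<omega> 1" "w 0 = \<omega> 2"
      using surjective_dF_regular[of v "\<omega> 0" "\<omega> 1" "\<omega> 2"] v assms by (auto simp: fiber_def)
    note D1 = DERIV_F1[of v w, unfolded w(2)]
    note D2 = DERIV_F2[of v w, unfolded w(3)]
    have "((\<lambda>t. v 0 + t * w 0 - s) has_real_derivative w 0) (at 0)"
      by (auto intro!: derivative_eq_intros)
    then have D3: "((\<lambda>t. v 0 + t * w 0 - s) has_real_derivative \<omega> 2) (at 0)"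
      by (simp only: w(4))
    show "\<exists>w\<in>Rn (d + 4). \<forall>j<3. ((\<lambda>s. H j (\<lambda>i. v i + s * w i)) has_real_derivative \<omega> j) (at 0)"
      unfolding all3 by (intro bexI[OF _ w(1)]) (simp add: H_def D1 D2[unfolded One_nat_def] D3)
  qed
  have "fiber s \<inter> Rn (d + 4) = {x \<in> Rn (d + 4). \<forall>j<3. H j x = 0}"
    by (auto simp: all3 H_def fiber_def M_def)
  moreover have "d + 4 - (d + 1) + 0 = 3" by simp
  moreover have "v \<in> Rn (d + 4)"
    using v by (simp add: fiber_def M_def)
  ultimately show "\<exists>U n h. openin (Euclidean_space (d + 4)) U \<and> v \<in> U \<and> n \<le> 0 \<and>
      (\<forall>j<d + 4 - (d + 1) + n. smooth_fun_on (d + 4) U (h j) \<and> h j v = 0) \<and>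
      diff_rank U (tuple (d + 4 - (d + 1) + n) h) v = d + 4 - (d + 1) + n \<and>
      fiber s \<inter> U = {x \<in> U. (\<forall>j<d + 4 - (d + 1). h j x = 0) \<and>
        (\<forall>j\<in>{d + 4 - (d + 1)..<d + 4 - (d + 1) + n}. 0 \<le> h j x)}"
    using smooth vanish rank by (intro exI[of _ "Rn (d + 4)"] exI[of _ "0::nat"] exI[of _ H]) simp
qed simp

subsection \<open>Critical points\<close>

text \<open>Curves in \<open>M\<close> with prescribed velocity in \<open>s\<close> are written down
  explicitly: \<open>x\<close> follows as a cube root, differentiable because \<open>q\<close> is
  not 0 there, while \<open>z\<close> or the length of the tail adapts to the change of the
  radius.\<close>

lemma rank_one_if_regular:
  assumes v: "v \<in> M" and regular: "\<alpha> < v 0" "v 0 < \<beta>" "poly q (v 0) \<noteq> 0"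
  shows "diff_rank M (tuple 1 (\<lambda>_ v. v 0)) v = 1"
proof (rule diff_rank_full)
  fix \<omega> :: "nat \<Rightarrow> real"
  define s where "s t = v 0 + t * \<omega> 0" for t
  have s: "(s has_real_derivative \<omega> 0) (at 0)"
    unfolding s_def by (auto intro!: derivative_eq_intros)
  have s0: "s 0 = v 0" by (simp add: s_def)
  define x where "x t = root 3 (poly q (s t))" for t
  have x: "\<exists>D. (x has_real_derivative D) (at 0)"
    unfolding x_def
    by (rule exI, rule DERIV_chain2[OF DERIV_odd_real_root has_derivative_poly_comp[OF s]])
       (use regular(3) in \<open>simp_all add: s0\<close>)
  have v': "v \<in> fiber (v 0)"
    using v by (simp add: fiber_def)
  have x0: "x 0 = v 1"
    using fiber_D(2)[OF v'] by (simp add: x_def s0)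
  have cont: "isCont s 0"
    using s by (rule DERIV_isCont)
  \<comment> \<open>The function \<open>k\<close> rescales the tail; the last premise says that the
    new tail has the length required over \<open>(s t, z t)\<close>.\<close>
  have lift: "\<exists>\<gamma> u. \<gamma> 0 = v \<and> (\<forall>\<^sub>F t in nhds 0. \<gamma> t \<in> M) \<and> has_velocity \<gamma> u \<and>
      (\<forall>j<1. ((\<lambda>t. \<gamma> t 0) has_real_derivative \<omega> j) (at 0))"
    if z: "\<exists>D. (z has_real_derivative D) (at 0)" "z 0 = v 2"
      and k: "\<exists>D. (k has_real_derivative D) (at 0)" "k 0 = 1"
      and M: "\<forall>\<^sub>F t in nhds 0. (k t)\<^sup>2 * rsq (v 0) (v 2) = rsq (s t) (z t)" for z k :: "real \<Rightarrow> real"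
  proof -
    define \<gamma> where "\<gamma> t i = (if i = 0 then s t else if i = 1 then x t else if i = 2 then z t else k t * v i)"
      for t and i :: nat
    have "\<exists>D. ((\<lambda>t. \<gamma> t i) has_real_derivative D) (at 0)" for i
    proof (cases i rule: nat_cases4)
      case 4
      then show ?thesis
        using k(1) by (auto simp: \<gamma>_def intro: DERIV_cmult_right)
    qed (use s x z(1) in \<open>auto simp: \<gamma>_def\<close>)
    then obtain u where u: "has_velocity \<gamma> u"
      using has_velocity_ex[of \<gamma>] by blast
    have "\<gamma> t \<in> M" if "(k t)\<^sup>2 * rsq (v 0) (v 2) = rsq (s t) (z t)" for t
    proof -
      have "sqnorm (Suc d) (\<lambda>i. \<gamma> t (3 + i)) = (k t)\<^sup>2 * sqnorm (Suc d) (\<lambda>i. v (3 + i))"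
        by (rule sqnorm_scale) (simp add: \<gamma>_def)
      then have "F2 (\<gamma> t) = 0"
        using that fiber_D(5)[OF v'] by (simp add: F2_def) (simp add: \<gamma>_def)
      moreover have "F1 (\<gamma> t) = 0"
        using root3_eq by (simp add: F1_def \<gamma>_def x_def)
      moreover have "\<gamma> t \<in> Rn (d + 4)"
        using fiber_D(4)[OF v'] by (simp add: Rn_iff \<gamma>_def)
      ultimately show ?thesis by (simp add: M_def)
    qed
    then have "\<forall>\<^sub>F t in nhds 0. \<gamma> t \<in> M"
      using M by (auto elim: eventually_mono)
    moreover have "\<gamma> 0 = v"
    proof
      fix i
      show "\<gamma> 0 i = v i"
        by (cases i rule: nat_cases4) (simp_all add: \<gamma>_def s0 x0 z(2) k(2))
    qed
    moreover have "\<forall>j<1. ((\<lambda>t. \<gamma> t 0) has_real_derivative \<omega> j) (at 0)"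
      using s by (simp add: \<gamma>_def)
    ultimately show ?thesis using u by blast
  qed
  show "\<exists>\<gamma> u. \<gamma> 0 = v \<and> (\<forall>\<^sub>F t in nhds 0. \<gamma> t \<in> M) \<and> has_velocity \<gamma> u \<and>
      (\<forall>j<1. ((\<lambda>t. \<gamma> t 0) has_real_derivative \<omega> j) (at 0))"
  proof (cases "rsq (v 0) (v 2) = 0")
    case False
    then have pos: "0 < rsq (v 0) (v 2)"
      using fiber_D(3)[OF v'] by (simp add: J_def)
    \<comment> \<open>Positive radius: \<open>z\<close> stays fixed and the tail is scaled by the
      square root of \<open>h\<close>.\<close>
    define h where "h t = rsq (s t) (v 2) / rsq (v 0) (v 2)" for t
    have h0: "h 0 = 1" using False by (simp add: h_def s0)
    have "((\<lambda>t. rsq (s t) (v 2)) has_real_derivative rsq_s (s 0) (v 2) * \<omega> 0 + rsq_z (s 0) (v 2) * 0) (at 0)"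
      by (rule DERIV_rsq[OF s DERIV_const])
    from DERIV_cdivide[OF this] have h: "\<exists>D. (h has_real_derivative D) (at 0)"
      unfolding h_def by (rule exI)
    then have "isCont h 0"
      by (blast intro: DERIV_isCont)
    then have "\<forall>\<^sub>F t in nhds 0. 0 < h t"
      using h0 by (intro eventually_pos_nhds) simp_all
    show ?thesis
    proof (rule lift[of "\<lambda>t. v 2" "\<lambda>t. sqrt (h t)"])
      show "\<exists>D. ((\<lambda>t. sqrt (h t)) has_real_derivative D) (at 0)"
        using h DERIV_chain2[OF DERIV_real_sqrt] h0 by (metis zero_less_one)
      show "\<forall>\<^sub>F t in nhds 0. (sqrt (h t))\<^sup>2 * rsq (v 0) (v 2) = rsq (s t) (v 2)"
        using \<open>\<forall>\<^sub>F t in nhds 0. 0 < h t\<close> by (rule eventually_mono) (use pos in \<open>simp add: h_def\<close>)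
    qed (auto simp: h0 intro: DERIV_const)
  next
    case True
    then have c0: "poly c (v 0) * (v 2)\<^sup>2 = - 1"
      using b_pos[OF regular(1,2)] by (simp add: rsq_def add_eq_0_iff)
    then have neg: "poly c (v 0) < 0"
      by (metis mult_nonneg_nonneg neg_0_le_iff_le not_le not_one_le_zero zero_le_power2)
    \<comment> \<open>Zero radius: the tail is left alone and \<open>z\<close> moves so that
      \<open>c z\<^sup>2\<close> keeps the value -1.\<close>
    define h where "h t = poly c (v 0) / poly c (s t)" for t
    have h0: "h 0 = 1" using neg by (simp add: h_def s0)
    have h: "\<exists>D. (h has_real_derivative D) (at 0)"
      unfolding h_def
      by (rule exI, rule DERIV_divide[OF DERIV_const has_derivative_poly_comp[OF s]]) (use neg in \<open>simp add: s0\<close>)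
    then have "isCont h 0"
      by (blast intro: DERIV_isCont)
    then have "\<forall>\<^sub>F t in nhds 0. 0 < h t"
      using h0 by (intro eventually_pos_nhds) simp_all
    show ?thesis
    proof (rule lift[of "\<lambda>t. sqrt (h t) * v 2" "\<lambda>t. 1"])
      obtain D where "((\<lambda>t. sqrt (h t)) has_real_derivative D) (at 0)"
        using h DERIV_chain2[OF DERIV_real_sqrt] h0 by (metis zero_less_one)
      from DERIV_cmult_right[OF this]
      show "\<exists>D. ((\<lambda>t. sqrt (h t) * v 2) has_real_derivative D) (at 0)"
        by (rule exI)
      show "\<forall>\<^sub>F t in nhds 0. 1\<^sup>2 * rsq (v 0) (v 2) = rsq (s t) (sqrt (h t) * v 2)"
        using \<open>\<forall>\<^sub>F t in nhds 0. 0 < h t\<close>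
      proof (rule eventually_mono)
        fix t assume t: "0 < h t"
        then have "poly c (s t) * h t = poly c (v 0)"
          by (auto simp: h_def)
        then have "poly c (s t) * (sqrt (h t) * v 2)\<^sup>2 = - 1"
          using c0 t by (simp add: power_mult_distrib flip: mult.assoc)
        then show "1\<^sup>2 * rsq (v 0) (v 2) = rsq (s t) (sqrt (h t) * v 2)"
          by (simp add: True) (simp add: rsq_def)
      qed
    qed (auto simp: h0 intro: DERIV_const)
  qed
qed

text \<open>Over the two ends \<open>s\<close> has an extremum on \<open>M\<close>. At a root of
  \<open>q\<close>, differentiating \<open>x\<^sup>3 = q(s)\<close> along a curve gives
  \<open>0 = q'(s) * s'\<close>, because \<open>x = 0\<close>, and \<open>q'(s)\<close> is not
  0.\<close>

lemma rank_zero_if_critical: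
  assumes v: "v \<in> M" and crit: "v 0 = \<alpha> \<or> v 0 = \<beta> \<or> poly q (v 0) = 0"
  shows "diff_rank M (tuple 1 (\<lambda>_ v. v 0)) v = 0"
proof (rule diff_rank_zero)
  fix \<gamma> u w
  assume \<gamma>: "\<gamma> 0 = v" "\<forall>\<^sub>F s in nhds 0. \<gamma> s \<in> M" "has_velocity \<gamma> u"
    and w: "((\<lambda>s. \<gamma> s 0) has_real_derivative w) (at 0)"
  obtain \<epsilon> where \<epsilon>: "0 < \<epsilon>" "\<And>t. \<bar>t\<bar> < \<epsilon> \<Longrightarrow> \<gamma> t \<in> M"
    using \<gamma>(2) unfolding eventually_nhds_metric by (auto simp: dist_real_def)
  show "w = 0"
  proof (cases "v 0 = \<alpha> \<or> v 0 = \<beta>")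
    case True
    then show ?thesis
    proof
      assume "v 0 = \<alpha>"
      then have "\<forall>y. \<bar>0 - y\<bar> < \<epsilon> \<longrightarrow> \<gamma> 0 0 \<le> \<gamma> y 0"
        using \<epsilon>(2) M_range \<gamma>(1) by simp
      then show ?thesis
        using DERIV_local_min[OF w \<epsilon>(1)] by blast
    next
      assume "v 0 = \<beta>"
      then have "\<forall>y. \<bar>0 - y\<bar> < \<epsilon> \<longrightarrow> \<gamma> y 0 \<le> \<gamma> 0 0"
        using \<epsilon>(2) M_range \<gamma>(1) by simp
      then show ?thesis
        using DERIV_local_max[OF w \<epsilon>(1)] by blast
    qed
  next
    case False
    then have q0: "poly q (v 0) = 0" using crit by blast
    then have v1: "v 1 = 0"
      using v by (simp add: M_def F1_def)
    \<comment> \<open>Differentiability of the coordinate \<open>x\<close> is essential: a curve on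
      which \<open>x\<close> is the cube root of time could move in \<open>s\<close> with non-zero
      speed.\<close>
    have "((\<lambda>t. \<gamma> t 1) has_real_derivative u 1) (at 0)"
      using \<gamma>(3) by (simp add: has_velocity_def)
    from DERIV_power[OF this, of 3]
    have cube: "((\<lambda>t. \<gamma> t 1 ^ 3) has_real_derivative 0) (at 0)"
      by (simp add: \<gamma>(1) v1[unfolded One_nat_def])
    have "((\<lambda>t. poly q (\<gamma> t 0)) has_real_derivative poly (pderiv q) (\<gamma> 0 0) * w) (at 0)"
      by (rule has_derivative_poly_comp[OF w])
    moreover have "\<forall>\<^sub>F t in nhds 0. \<gamma> t 1 ^ 3 = poly q (\<gamma> t 0)"
      using \<gamma>(2) by (rule eventually_mono) (simp add: M_def F1_def)
    ultimately have "((\<lambda>t. \<gamma> t 1 ^ 3) has_real_derivative poly (pderiv q) (\<gamma> 0 0) * w) (at 0)"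
      using DERIV_cong_ev[OF refl _ refl] by metis
    from DERIV_unique[OF this cube] have "poly (pderiv q) (v 0) * w = 0"
      by (simp only: \<gamma>(1))
    then show ?thesis
      using q_root[OF q0] by simp
  qed
qed

text \<open>The target has dimension 1, so singular means rank 0, and the two rank lemmas together
  cover all points of \<open>M\<close>.\<close>

lemma singular_points_M:
  "singular_points (d + 2) 1 M (tuple 1 (\<lambda>_ v. v 0)) = {v \<in> M. v 0 = \<alpha> \<or> v 0 = \<beta> \<or> poly q (v 0) = 0}"
proof -
  have "diff_rank M (tuple 1 (\<lambda>_ v. v 0)) v < min (d + 2) 1 \<longleftrightarrow> v 0 = \<alpha> \<or> v 0 = \<beta> \<or> poly q (v 0) = 0"
    if "v \<in> M" for v
  proof (cases "v 0 = \<alpha> \<or> v 0 = \<beta> \<or> poly q (v 0) = 0")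
    case True
    then show ?thesis
      using rank_zero_if_critical[OF that True] by simp
  next
    case False
    then have "\<alpha> < v 0" "v 0 < \<beta>" "poly q (v 0) \<noteq> 0"
      using M_range[OF that] by auto
    from rank_one_if_regular[OF that this] False show ?thesis by simp
  qed
  then show ?thesis
    unfolding singular_points_def by blast
qed

subsection \<open>The map to the plane\<close>

definition g :: "(nat \<Rightarrow> real) \<Rightarrow> nat \<Rightarrow> real" where
  "g v = (\<lambda>i. if i = 0 then v 0
    else if i = 1 then v 3 / (1 + (1 + (poly c (v 0))\<^sup>2) * (v 2)\<^sup>2) else 0)"

lemma g_denominator_pos: "1 \<le> 1 + (1 + (poly c s)\<^sup>2) * z\<^sup>2"
  by simp

lemma real_algebraic_map_g: "real_algebraic_map (d + 4) 2 M g"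
  unfolding real_algebraic_map_def
proof (intro conjI allI impI)
  show "g ` M \<subseteq> Rn 2"
    by (auto simp: g_def Rn_iff)
  fix i :: nat assume "i < 2"
  define P where "P = (\<lambda>v :: nat \<Rightarrow> real. v (if i = 0 then 0 else 3))"
  define Q where "Q = (\<lambda>v :: nat \<Rightarrow> real. if i = 0 then 1 else 1 + (1 + (poly c (v 0))\<^sup>2) * (v 2)\<^sup>2)"
  have "polynomial_fun (d + 4) P"
    unfolding P_def using d_pos by (intro polynomial_intros) simp
  then obtain p where p: "poly_in (d + 4) p" "peval p = P"
    by (rule polynomial_fun_peval)
  have "polynomial_fun (d + 4) Q"
    unfolding Q_def by (cases "i = 0") (auto intro!: polynomial_intros)
  then obtain r where r: "poly_in (d + 4) r" "peval r = Q"
    by (rule polynomial_fun_peval)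
  have "Q v \<noteq> 0" for v
    using g_denominator_pos[of "v 0" "v 2"] by (cases "i = 0") (simp_all only: Q_def if_True if_False, auto)
  moreover have "g v i = P v / Q v" for v
    using \<open>i < 2\<close> by (auto simp: less_2_cases_iff P_def Q_def g_def)
  ultimately show "\<exists>p r. poly_in (d + 4) p \<and> poly_in (d + 4) r \<and>
      (\<forall>v\<in>M. peval r v \<noteq> 0 \<and> g v i = peval p v / peval r v)"
    using p r by (intro exI[of _ p] exI[of _ r]) simp
qed

lemma image_g: "g ` M = {x \<in> Rn 2. (x 1)\<^sup>2 \<le> b (x 0)}"
proof
  show "g ` M \<subseteq> {x \<in> Rn 2. (x 1)\<^sup>2 \<le> b (x 0)}"
  proof (rule image_subsetI)
    fix v assume v: "v \<in> M"
    then have v': "v \<in> fiber (v 0)" by (simp add: fiber_def)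
    define k where "k = 1 + (1 + (poly c (v 0))\<^sup>2) * (v 2)\<^sup>2"
    have k: "1 \<le> k" by (simp add: k_def)
    have b0: "0 \<le> b (v 0)"
      using M_range[OF v] by (simp add: b_nonneg)
    \<comment> \<open>The origin of the denominator of \<open>g\<close>: a polynomial bound for
      \<open>c\<close> that is positive whatever the sign of \<open>c\<close>.\<close>
    have "poly c (v 0) \<le> 1 + (poly c (v 0))\<^sup>2"
    proof -
      have "0 \<le> (poly c (v 0) - 1)\<^sup>2" "0 \<le> (poly c (v 0))\<^sup>2"
        by simp_all
      moreover have "(poly c (v 0) - 1)\<^sup>2 = (poly c (v 0))\<^sup>2 - 2 * poly c (v 0) + 1"
        by (simp add: power2_diff)
      ultimately show ?thesis by linarith
    qed
    then have "1 + poly c (v 0) * (v 2)\<^sup>2 \<le> k"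
      unfolding k_def by (simp add: mult_right_mono)
    then have "rsq (v 0) (v 2) \<le> b (v 0) * k"
      unfolding rsq_def using b0 by (rule mult_left_mono)
    \<comment> \<open>The quotient by \<open>k\<close> is going to be squared, so one more factor
      \<open>k\<close>, which is at least 1, is given away.\<close>
    also have "\<dots> \<le> b (v 0) * k\<^sup>2"
      using b0 k by (intro mult_left_mono) (simp_all add: power2_eq_square)
    finally have "rsq (v 0) (v 2) \<le> b (v 0) * k\<^sup>2" .
    moreover have "(v 3)\<^sup>2 \<le> rsq (v 0) (v 2)"
    proof -
      have "(v (3 + 0))\<^sup>2 \<le> sqnorm (Suc d) (\<lambda>i. v (3 + i))"
        unfolding sqnorm_def by (rule member_le_sum) auto
      then show ?thesis
        by (simp add: fiber_D(5)[OF v'])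
    qed
    ultimately have "(v 3 / k)\<^sup>2 \<le> b (v 0)"
      using k by (simp add: power_divide divide_le_eq)
    then show "g v \<in> {x \<in> Rn 2. (x 1)\<^sup>2 \<le> b (x 0)}"
      by (simp add: g_def Rn_iff k_def)
  qed
  show "{x \<in> Rn 2. (x 1)\<^sup>2 \<le> b (x 0)} \<subseteq> g ` M"
  proof
    fix x assume x: "x \<in> {x \<in> Rn 2. (x 1)\<^sup>2 \<le> b (x 0)}"
    \<comment> \<open>A preimage with \<open>z = 0\<close> whose tail has two entries; index 4 is
      available because \<open>d > 0\<close>.\<close>
    define v where "v i = (if i = 0 then x 0 else if i = 1 then root 3 (poly q (x 0))
      else if i = 3 then x 1 else if i = 4 then sqrt (b (x 0) - (x 1)\<^sup>2) else 0)" for i :: nat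
    have "sqnorm (Suc d) (\<lambda>i. v (3 + i)) = (\<Sum>i\<in>{0, 1}. (v (3 + i))\<^sup>2)"
      unfolding sqnorm_def using d_pos by (intro sum.mono_neutral_right) (auto simp: v_def)
    also have "\<dots> = b (x 0)"
      using x by (simp add: v_def)
    finally have "F2 v = 0"
      by (simp add: F2_def) (simp add: v_def rsq_def)
    moreover have "F1 v = 0"
      using root3_eq by (simp add: F1_def v_def)
    moreover have "v \<in> Rn (d + 4)"
      using d_pos by (auto simp: Rn_iff v_def)
    moreover have "g v = x"
    proof
      fix i
      have "2 \<le> i \<Longrightarrow> x i = 0"
        using x by (simp add: Rn_iff)
      then show "g v i = x i"
        by (auto simp: g_def v_def)
    qed
    ultimately show "x \<in> g ` M"
      by (auto simp: M_def)
  qed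
qed

end

subsection \<open>The disc\<close>

lemma closure_of_eq_closed: "closed S \<Longrightarrow> S \<subseteq> Rn n \<Longrightarrow> Euclidean_space n closure_of S = S"
  by (simp add: closure_of_Euclidean_space)

locale plane_disc =
  fixes \<alpha> \<beta> :: real
  assumes less: "\<alpha> < \<beta>"
begin

definition G :: "(nat \<Rightarrow> real) \<Rightarrow> real"
  where "G x = (x 0 - \<alpha>) * (\<beta> - x 0) - (x 1)\<^sup>2"

definition D :: "(nat \<Rightarrow> real) set" where "D = {x \<in> Rn 2. 0 < G x}"
definition E :: "(nat \<Rightarrow> real) set" where "E = {x \<in> Rn 2. 0 \<le> G x}"
definition C :: "(nat \<Rightarrow> real) set" where "C = {x \<in> Rn 2. G x = 0}"

definition cen :: real where "cen = (\<alpha> + \<beta>) / 2"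
definition rad :: real where "rad = (\<beta> - \<alpha>) / 2"

text \<open>Maps the unit disc to the disc bounded by \<open>C\<close>, so that the results on discs
  and spheres carry over.\<close>

definition A :: "(nat \<Rightarrow> real) \<Rightarrow> nat \<Rightarrow> real"
  where "A y = (\<lambda>i. if i = 0 then cen + rad * y 0 else rad * y i)"

lemma rad_pos: "0 < rad"
  using less by (simp add: rad_def)

lemma G_eq: "G x = rad\<^sup>2 - ((x 0 - cen)\<^sup>2 + (x 1)\<^sup>2)"
proof -
  have "(x 0 - \<alpha>) * (\<beta> - x 0) = rad\<^sup>2 - (x 0 - cen)\<^sup>2"
  proof -
    have "cen - rad = \<alpha>" "cen + rad = \<beta>"
      by (simp_all add: cen_def rad_def field_simps)
    moreover have "(s - (m - r)) * ((m + r) - s) = r\<^sup>2 - (s - m)\<^sup>2" for s m r :: real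
      by (simp add: power2_eq_square algebra_simps)
    ultimately show ?thesis by metis
  qed
  then show ?thesis by (simp add: G_def)
qed

lemma sqnorm_2: "sqnorm 2 y = (y 0)\<^sup>2 + (y 1)\<^sup>2"
  by (simp add: sqnorm_def numeral_2_eq_2)

lemma G_A: "G (A y) = rad\<^sup>2 * (1 - sqnorm 2 y)"
  by (simp add: G_eq A_def sqnorm_2 power_mult_distrib algebra_simps)

lemma A_in_Rn: "y \<in> Rn 2 \<Longrightarrow> A y \<in> Rn 2"
  by (simp add: Rn_iff A_def)

lemma A_surj:
  assumes "x \<in> Rn 2"
  obtains y where "y \<in> Rn 2" "x = A y"
proof
  show "(\<lambda>i. if i = 0 then (x 0 - cen) / rad else x i / rad) \<in> Rn 2"
    using assms by (simp add: Rn_iff)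
  show "x = A (\<lambda>i. if i = 0 then (x 0 - cen) / rad else x i / rad)"
    using rad_pos by (auto simp: A_def)
qed

lemma continuous_on_A: "continuous_on S A"
  unfolding A_def [abs_def]
  by (intro continuous_on_coordinatewise_then_product continuous_on_if_const continuous_on_add
      continuous_on_mult continuous_on_coord continuous_on_const)

lemma D_eq: "D = A ` open_disc 2" and C_eq: "C = A ` sph 1"
proof -
  have sgn: "0 < G (A y) \<longleftrightarrow> sqnorm 2 y < 1" "G (A y) = 0 \<longleftrightarrow> sqnorm 2 y = 1" for y
    using rad_pos by (auto simp: G_A zero_less_mult_iff)
  have "x \<in> D \<longleftrightarrow> x \<in> A ` open_disc 2" for x
  proof
    assume "x \<in> D"
    then obtain y where "y \<in> Rn 2" "x = A y" "0 < G x"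
      unfolding D_def using A_surj by blast
    then show "x \<in> A ` open_disc 2"
      by (auto simp: open_disc_sqnorm sgn)
  qed (auto simp: D_def open_disc_sqnorm sgn A_in_Rn)
  then show "D = A ` open_disc 2" by blast
  have sph1: "sph 1 = {y \<in> Rn 2. sqnorm 2 y = 1}"
    by (simp only: sph_def Suc_1)
  have "x \<in> C \<longleftrightarrow> x \<in> A ` sph 1" for x
    unfolding sph1
  proof
    assume "x \<in> C"
    then obtain y where "y \<in> Rn 2" "x = A y" "G x = 0"
      unfolding C_def using A_surj by blast
    then show "x \<in> A ` {y \<in> Rn 2. sqnorm 2 y = 1}"
      by (auto simp: sgn)
  qed (auto simp: C_def sgn A_in_Rn)
  then show "C = A ` sph 1" by blast
qed

lemma connected_D: "connected D"
proof -
  have "connected (open_disc 2)"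
  proof (rule connected_star)
    fix x :: "nat \<Rightarrow> real" and k :: real assume x: "x \<in> open_disc 2" and k: "0 \<le> k" "k \<le> 1"
    have "sqnorm 2 (\<lambda>i. k * x i) = k\<^sup>2 * sqnorm 2 x"
      by (rule sqnorm_scale) simp
    also have "\<dots> \<le> 1 * sqnorm 2 x"
      using k sqnorm_nonneg[of 2 x] by (intro mult_right_mono) (simp_all add: power_le_one)
    finally show "(\<lambda>i. k * x i) \<in> open_disc 2"
      using x by (simp add: open_disc_sqnorm Rn_iff)
  qed
  then show ?thesis
    unfolding D_eq by (rule connected_continuous_image[OF continuous_on_A])
qed

lemma connected_C: "connected C"
  unfolding C_eq by (rule connected_continuous_image[OF continuous_on_A connected_sph]) simp

lemma C_nonempty: "C \<noteq> {}"
  unfolding C_eq using north_pole_sph by blast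

lemma continuous_on_G: "continuous_on S G"
  unfolding G_def [abs_def]
  by (intro continuous_on_diff continuous_on_mult continuous_on_power continuous_on_coord continuous_on_const)

lemma closed_E: "closed E"
proof -
  have "closed {x. 0 \<le> G x}"
    by (intro closed_Collect_le continuous_on_const continuous_on_G)
  then show ?thesis
    using closed_Int[OF closed_Rn[of 2]] by (simp add: E_def Collect_conj_eq)
qed

lemma E_subset: "E \<subseteq> Rn 2" and D_subset: "D \<subseteq> Rn 2" and C_subset: "C \<subseteq> Rn 2"
  by (auto simp: E_def D_def C_def)

lemma openin_D: "openin (Euclidean_space 2) D"
proof -
  have "open {x. 0 < G x}"
    by (intro open_Collect_less continuous_on_const continuous_on_G)
  moreover have "D = Rn 2 \<inter> {x. 0 < G x}"
    by (auto simp: D_def)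
  moreover have "Euclidean_space 2 = top_of_set (Rn 2)"
    by (simp add: Euclidean_space_eq)
  ultimately show ?thesis
    by (metis openin_open_Int)
qed

text \<open>Points are approached along rays from the centre with scales from \<open>I\<close> that
  tend to 1: from below to reach points of \<open>E\<close> out of \<open>D\<close>, from above to
  reach points of \<open>C\<close> out of the complement of \<open>E\<close>.\<close>

lemma radial_limit:
  assumes y: "y \<in> Rn 2" and T: "T = closure I" "\<And>\<tau>. \<tau> \<in> I \<Longrightarrow> A (\<lambda>i. \<tau> * y i) \<in> X" "1 \<in> T"
  shows "A y \<in> closure X"
proof -
  define p where "p \<tau> = A (\<lambda>i. \<tau> * y i)" for \<tau>
  have "continuous_on (closure I) p"
    unfolding p_def
    by (rule continuous_on_compose2[OF continuous_on_A _ subset_UNIV])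
       (intro continuous_on_coordinatewise_then_product continuous_on_mult continuous_on_id continuous_on_const)
  moreover have "p ` I \<subseteq> closure X"
    using T(2) closure_subset[of X] by (auto simp: p_def)
  ultimately have "p ` closure I \<subseteq> closure X"
    by (intro image_closure_subset closed_closure)
  moreover have "p 1 = A y" by (simp add: p_def)
  ultimately show ?thesis
    using T(1,3) by (metis image_subset_iff)
qed

lemma G_A_scale: "G (A (\<lambda>i. \<tau> * y i)) = rad\<^sup>2 * (1 - \<tau>\<^sup>2 * sqnorm 2 y)"
proof -
  have "sqnorm 2 (\<lambda>i. \<tau> * y i) = \<tau>\<^sup>2 * sqnorm 2 y"
    by (rule sqnorm_scale) simp
  then show ?thesis by (simp add: G_A)
qed

lemma closure_D: "Euclidean_space 2 closure_of D = E"
proof -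
  have "closure D = E"
  proof
    have "D \<subseteq> E" by (auto simp: D_def E_def)
    then show "closure D \<subseteq> E"
      using closed_E by (rule closure_minimal)
    show "E \<subseteq> closure D"
    proof
      fix x assume "x \<in> E"
      then obtain y where y: "y \<in> Rn 2" "x = A y" "0 \<le> G x"
        unfolding E_def using A_surj by blast
      then have "sqnorm 2 y \<le> 1"
        using rad_pos by (simp add: G_A zero_le_mult_iff)
      have "A (\<lambda>i. \<tau> * y i) \<in> D" if "\<tau> \<in> {0..<1}" for \<tau>
      proof -
        have "\<tau>\<^sup>2 * sqnorm 2 y \<le> \<tau>\<^sup>2 * 1"
          using \<open>sqnorm 2 y \<le> 1\<close> by (intro mult_left_mono) simp_all
        also have "\<dots> < 1"
          using that by (simp add: power_less_one_iff abs_square_less_1)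
        finally have "0 < rad\<^sup>2 * (1 - \<tau>\<^sup>2 * sqnorm 2 y)"
          using rad_pos by simp
        moreover have "(\<lambda>i. \<tau> * y i) \<in> Rn 2"
          using y(1) by (simp add: Rn_iff)
        ultimately show ?thesis
          by (simp only: D_def mem_Collect_eq A_in_Rn G_A_scale simp_thms)
      qed
      then have "A y \<in> closure D"
        by (intro radial_limit[OF y(1), of "{0..1}" "{0..<1}"]) simp_all
      then show "x \<in> closure D"
        using y(2) by simp
    qed
  qed
  then show ?thesis
    by (simp add: closure_of_Euclidean_space D_subset)
qed

lemma frontier_E: "Euclidean_space 2 frontier_of E = C"
proof -
  have "C \<subseteq> closure (Rn 2 - E)"
  proof
    fix x assume "x \<in> C"
    then obtain y where y: "y \<in> Rn 2" "x = A y" "G x = 0"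
      unfolding C_def using A_surj by blast
    then have "sqnorm 2 y = 1"
      using rad_pos by (simp add: G_A)
    have "A (\<lambda>i. \<tau> * y i) \<in> Rn 2 - E" if "\<tau> \<in> {1<..2}" for \<tau>
    proof -
      have "1 < \<tau>\<^sup>2" using that by (simp add: one_less_power)
      then have "rad\<^sup>2 * (1 - \<tau>\<^sup>2 * sqnorm 2 y) < 0"
        using rad_pos \<open>sqnorm 2 y = 1\<close> by (simp add: mult_pos_neg)
      then show ?thesis
        using y(1) by (simp add: E_def G_A_scale) (simp add: Rn_iff A_def)
    qed
    then have "A y \<in> closure (Rn 2 - E)"
      by (intro radial_limit[OF y(1), of "{1..2}" "{1<..2}"]) simp_all
    then show "x \<in> closure (Rn 2 - E)"
      using y(2) by simp
  qed
  moreover have "closure (Rn 2 - E) \<subseteq> {x. G x \<le> 0}"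
    by (rule closure_minimal)
       (auto simp: E_def intro: closed_Collect_le continuous_on_const continuous_on_G)
  ultimately have "E \<inter> closure (Rn 2 - E) = C"
    by (auto simp: E_def C_def)
  then show ?thesis
    using closure_of_Euclidean_space[of "Rn 2 - E" 2]
    by (simp add: frontier_of_closures closure_of_eq_closed[OF closed_E E_subset])
qed

lemma ellipsoid_boundary_C: "ellipsoid_boundary 2 C"
proof -
  \<comment> \<open>Ellipsoids are normalised by dividing by \<open>r\<close> itself, so
    \<open>r\<close> is the squared radius. The disc is already in this normal form, and the
    identity serves as the affine transformation.\<close>
  let ?a = "\<lambda>j::nat. if j = 0 then cen else 0" and ?r = "\<lambda>j::nat. rad\<^sup>2"
  have sum2: "(\<Sum>j<2. f j) = f 0 + f 1" for f :: "nat \<Rightarrow> real"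
    by (simp add: numeral_2_eq_2)
  have "(\<Sum>j<2. (x j - ?a j)\<^sup>2 / ?r j) \<le> 1 \<longleftrightarrow> 0 \<le> G x" for x
    using rad_pos by (simp add: sum2 G_eq divide_le_eq flip: add_divide_distrib)
  then have E: "{x \<in> Rn 2. (\<Sum>j<2. (x j - ?a j)\<^sup>2 / ?r j) \<le> 1} = E"
    by (simp add: E_def)
  let ?I = "\<lambda>i j :: nat. if i = j then 1 else 0 :: real"
  have "tuple 2 (\<lambda>i x. (\<Sum>j<2. ?I i j * x j)) x = x" if "x \<in> Rn 2" for x
  proof
    fix i
    show "tuple 2 (\<lambda>i x. (\<Sum>j<2. ?I i j * x j)) x i = x i"
      using that by (simp add: tuple_def Rn_iff if_distrib[of "\<lambda>u. u * _"] cong: if_cong)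
  qed
  note id = this
  have "linear_iso 2 ?I"
    unfolding linear_iso_def using id by (subst bij_betw_cong[where g = id]) simp_all
  then have "affine_transformation 2 id"
    unfolding affine_transformation_def
    using id by (intro exI[of _ ?I] exI[of _ "\<lambda>i. 0"]) simp
  then have "affinely_equivalent 2 E E"
    unfolding affinely_equivalent_def using E_subset by (intro conjI exI[of _ id]) simp_all
  then have "ellipsoid 2 E"
    unfolding ellipsoid_def using rad_pos E
    by (intro exI[of _ ?a] exI[of _ ?r]) simp
  then show ?thesis
    unfolding ellipsoid_boundary_def using frontier_E by (intro exI[of _ E]) simp
qed

lemma G_polynomial:
  obtains p where "poly_in 2 p" "total_deg p \<le> 2" "peval p = G"
proof -
  have coord: "polyfun 2 1 (\<lambda>x. x i)" if "i < 2" for i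
    using that by (rule polyfun.coord)
  \<comment> \<open>Differences are rewritten with factors -1, as \<open>polyfun\<close> is closed
    only under sums and products by its rules.\<close>
  have "polyfun 2 (1 + 1) (\<lambda>x. (x 0 + - \<alpha>) * (\<beta> + - 1 * x 0) + - 1 * (x 1 * x 1))"
  proof (rule polyfun.add, rule polyfun.mult)
    show "polyfun 2 1 (\<lambda>x. x 0 + - \<alpha>)"
      by (intro polyfun.add coord polyfun.const) simp
    \<comment> \<open>The constant factor is counted with degree 0, so the degree does not
      rise.\<close>
    have "polyfun 2 (0 + 1) (\<lambda>x. - 1 * x 0)"
      by (intro polyfun.mult coord polyfun.const) simp
    then show "polyfun 2 1 (\<lambda>x. \<beta> + - 1 * x 0)"
      by (intro polyfun.add polyfun.const) simp
    have "polyfun 2 (0 + (1 + 1)) (\<lambda>x. - 1 * (x 1 * x 1))"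
      by (intro polyfun.mult coord polyfun.const) simp_all
    then show "polyfun 2 (1 + 1) (\<lambda>x. - 1 * (x 1 * x 1))"
      by simp
  qed
  moreover have "(\<lambda>x. (x 0 + - \<alpha>) * (\<beta> + - 1 * x 0) + - 1 * (x 1 * x 1)) = G"
    by (auto simp: G_def power2_eq_square)
  ultimately have "polyfun 2 2 G" by (simp only: one_add_one)
  then show ?thesis
    using polyfun_peval that by blast
qed

text \<open>The gradient \<open>(a, b)\<close> of \<open>G\<close> is not 0 on the circle; the
  direction is the gradient scaled by \<open>\<omega>\<close> over its squared length.\<close>

lemma surjective_dG:
  assumes "x \<in> C"
  shows "\<exists>w\<in>Rn 2. ((\<lambda>t. G (\<lambda>i. x i + t * w i)) has_real_derivative \<omega>) (at 0)"
proof -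
  define a b where "a = - 2 * (x 0 - cen)" and "b = - 2 * x 1"
  have "(x 0 - cen)\<^sup>2 + (x 1)\<^sup>2 = rad\<^sup>2"
    using assms by (simp add: C_def G_eq)
  then have "x 0 - cen \<noteq> 0 \<or> x 1 \<noteq> 0"
    using rad_pos by auto
  then have "a \<noteq> 0 \<or> b \<noteq> 0"
    by (auto simp: a_def b_def)
  then have "a\<^sup>2 + b\<^sup>2 \<noteq> 0"
    by (simp add: sum_power2_eq_zero_iff)
  define k where "k = \<omega> / (a\<^sup>2 + b\<^sup>2)"
  define w where "w i = (if i = 0 then k * a else if i = 1 then k * b else 0)" for i :: nat
  have "((\<lambda>t. G (\<lambda>i. x i + t * w i)) has_real_derivative a * w 0 + b * w 1) (at 0)"
    unfolding G_eq by (rule derivative_eq_intros refl)+ (simp add: a_def b_def algebra_simps)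
  moreover have "a * w 0 + b * w 1 = \<omega>"
  proof -
    have "a * w 0 + b * w 1 = k * (a\<^sup>2 + b\<^sup>2)"
      by (simp add: w_def power2_eq_square algebra_simps)
    also have "\<dots> = \<omega>"
      by (simp only: k_def times_divide_eq_left nonzero_mult_div_cancel_right[OF \<open>a\<^sup>2 + b\<^sup>2 \<noteq> 0\<close>])
    finally show ?thesis .
  qed
  ultimately have "((\<lambda>t. G (\<lambda>i. x i + t * w i)) has_real_derivative \<omega>) (at 0)"
    by (simp only:)
  moreover have "w \<in> Rn 2"
    by (simp add: Rn_iff w_def)
  ultimately show ?thesis by blast
qed

lemma smooth_submanifold_C: "smooth_submanifold 2 1 1 C"
  unfolding smooth_submanifold_def
proof (intro conjI ballI C_subset)
  fix x assume x: "x \<in> C"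
  have "polynomial_fun 2 G"
    unfolding G_def [abs_def] by (intro polynomial_intros) simp_all
  then have "smooth_fun_on 2 (Rn 2) G"
    by (rule polynomial_fun_smooth)
  moreover have "diff_rank (Rn 2) (tuple 1 (\<lambda>_. G)) x = 1"
  proof (rule diff_rank_full_line)
    fix \<omega> :: "nat \<Rightarrow> real"
    show "\<exists>w\<in>Rn 2. \<forall>j<1. ((\<lambda>t. G (\<lambda>i. x i + t * w i)) has_real_derivative \<omega> j) (at 0)"
      using surjective_dG[OF x, of "\<omega> 0"] by auto
  qed (use x C_subset in blast)
  moreover have "x \<in> Rn 2" "G x = 0" "C \<inter> Rn 2 = {x \<in> Rn 2. G x = 0}"
    using x by (auto simp: C_def)
  ultimately show "\<exists>U s h. openin (Euclidean_space 2) U \<and> x \<in> U \<and> s \<le> 1 \<and>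
      (\<forall>j<2 - 1 + s. smooth_fun_on 2 U (h j) \<and> h j x = 0) \<and>
      diff_rank U (tuple (2 - 1 + s) h) x = 2 - 1 + s \<and>
      C \<inter> U = {x \<in> U. (\<forall>j<2 - 1. h j x = 0) \<and> (\<forall>j\<in>{2 - 1..<2 - 1 + s}. 0 \<le> h j x)}"
    by (intro exI[of _ "Rn 2"] exI[of _ "0::nat"] exI[of _ "\<lambda>_. G"]) simp
qed simp

text \<open>The zero set of the single polynomial is exactly the circle, so
  \<open>zeros 2 p - C\<close> is empty and transversality only concerns \<open>C\<close>
  itself.\<close>

lemma NCD_D:
  assumes p: "poly_in 2 p" "peval p = G"
  shows "NCD 2 D 1 (\<lambda>_. p) (\<lambda>_. C)" "C \<in> conn_comps 2 (zeros 2 p)"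
proof -
  have zeros: "zeros 2 p = C"
    using p by (auto simp: zero_set_def C_def)
  show comp: "C \<in> conn_comps 2 (zeros 2 p)"
    unfolding zeros by (rule connected_conn_comps[OF C_subset connected_C C_nonempty])
  have nonsing: "nonsingular_wrt 2 1 (\<lambda>_. p) C"
  proof (rule nonsingular_zero_set)
    show "peval p = (\<lambda>_. G) j" for j :: nat by (simp add: p)
    show "C = {x \<in> Rn 2. \<forall>j<1::nat. G x = 0}" by (auto simp: C_def)
    show "\<exists>w\<in>Rn 2. \<forall>j<1. ((\<lambda>t. G (\<lambda>i. x i + t * w i)) has_real_derivative \<omega> j) (at 0)"
      if "x \<in> C" for x and \<omega> :: "nat \<Rightarrow> real"
      using surjective_dG[OF that, of "\<omega> 0"] by auto
  qed (use p in simp)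
  then have manifold: "nonsingular_alg_manifold 2 (2 - 1) C"
    unfolding nonsingular_alg_manifold_def by (intro exI[of _ 1] exI[of _ "\<lambda>_. p"]) simp
  show "NCD 2 D 1 (\<lambda>_. p) (\<lambda>_. C)"
    unfolding NCD_def closure_D zeros
  proof (intro conjI allI impI)
    show "connectedin (Euclidean_space 2) D"
      by (simp add: connectedin_Euclidean_space D_subset connected_D)
    show "D = {x \<in> Rn 2. \<forall>j\<in>{1..1::nat}. 0 < peval p x}"
      by (simp add: D_def p)
    show "E = {x \<in> Rn 2. \<forall>j\<in>{1..1::nat}. 0 \<le> peval p x}"
      by (simp add: E_def p)
    show "\<forall>j\<in>{1..1::nat}. C \<in> conn_comps 2 C \<and> nonsingular_wrt 2 1 (\<lambda>_. p) C"
      using comp[unfolded zeros] nonsing by simp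
    show "\<forall>j\<in>{1..1::nat}. (C - C) \<inter> E = {} \<and> E \<subseteq> Rn 2 - (C - C) \<and> openin (Euclidean_space 2) (Rn 2 - (C - C))"
      using E_subset by simp
    fix \<Lambda> :: "nat set" assume "\<Lambda> \<subseteq> {1..1}" "\<Lambda> \<noteq> {}"
    then have "\<Lambda> = {1}" by auto
    then show "(\<Inter>j\<in>\<Lambda>. C) = {} \<or> (card \<Lambda> \<le> 2 \<and> nonsingular_alg_manifold 2 (2 - card \<Lambda>) (\<Inter>j\<in>\<Lambda>. C) \<and>
        (\<forall>p\<in>(\<Inter>j\<in>\<Lambda>. C). tangent_space (\<Inter>j\<in>\<Lambda>. C) p = (\<Inter>j\<in>\<Lambda>. tangent_space C p)))"
      using manifold by simp
  qed (use openin_D p in simp_all)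
qed

lemma E_minus_D: "E - D = C"
  by (auto simp: E_def D_def C_def)

end

text \<open>By the product rule only the product of the other differences survives at
  \<open>t j\<close>.\<close>

lemma simple_root_prod_linear:
  fixes t :: "'i \<Rightarrow> real"
  assumes "finite I" "j \<in> I" "inj_on t I"
  shows "poly (pderiv (\<Prod>i\<in>I. [:- t i, 1:])) (t j) \<noteq> 0"
proof -
  define r where "r = (\<Prod>i\<in>I - {j}. [:- t i, 1:])"
  have "(\<Prod>i\<in>I. [:- t i, 1:]) = [:- t j, 1:] * r"
    unfolding r_def using assms(1,2) by (rule prod.remove)
  then have "pderiv (\<Prod>i\<in>I. [:- t i, 1:]) = [:- t j, 1:] * pderiv r + r * pderiv [:- t j, 1:]"
    by (simp only: pderiv_mult)
  then have "poly (pderiv (\<Prod>i\<in>I. [:- t i, 1:])) (t j) = poly r (t j)"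
    by (simp add: pderiv_pCons)
  also have "\<dots> = (\<Prod>i\<in>I - {j}. t j - t i)"
    by (simp add: r_def poly_prod)
  also have "\<dots> \<noteq> 0"
    using assms by (auto simp: prod_zero_iff inj_on_def)
  finally show ?thesis .
qed

lemma image_filter: "T \<subseteq> f ` X \<Longrightarrow> f ` {x \<in> X. f x \<in> T} = T"
  by blast

theorem theorem2:
  fixes l :: nat and t :: "nat \<Rightarrow> real" and lam :: "nat \<Rightarrow> nat"
  assumes "l > 1"
    and "strict_mono_on {1..l} t"
    and "lam \<in> {1..l - 1} \<rightarrow> {0, 1}"
  shows "\<exists>n>1. \<exists>m0. \<forall>m>n. m \<ge> m0 \<longrightarrow>
    (\<exists>K M g.
       nonsingular_alg_manifold K m M \<and> connectedin (Euclidean_space K) M \<and>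
       real_algebraic_map K n M g \<and>
       (let f = (\<lambda>x. g x 0);
            fiber = (\<lambda>s. {x \<in> M. f x = s})
        in
          f ` M = {t 1..t l} \<and>
          f ` singular_points m 1 M (tuple 1 (\<lambda>_. f)) = t ` {1..l} \<and>
          (\<forall>j\<in>{1..l - 1}. \<forall>s\<in>{t j<..<t (j + 1)}.
             (lam j = 0 \<longrightarrow>
                compactin (Euclidean_space K) (fiber s) \<and>
                smooth_submanifold K (m - 1) 0 (fiber s) \<and>
                connectedin (Euclidean_space K) (fiber s)) \<and>
             (lam j = 1 \<longrightarrow>
                connectedin (Euclidean_space K) (fiber s) \<and>
                \<not> compactin (Euclidean_space K) (fiber s) \<and>
                smooth_submanifold K (m - 1) 0 (fiber s))) \<and>
          (\<forall>s\<in>f ` M.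
             connectedin (Euclidean_space K) (fiber s) \<and>
             (\<exists>Y :: (nat \<Rightarrow> real) topology. CW_complex_dim_le (m - 1) Y \<and>
                subtopology (Euclidean_space K) (fiber s) homeomorphic_space Y))) \<and>
       (\<exists>D k p S.
          NCD n D k p S \<and>
          g ` M = Euclidean_space n closure_of D \<and>
          (\<exists>\<P>. finite \<P> \<and> (Euclidean_space n closure_of D) - D = \<Union>\<P> \<and>
             (\<forall>P\<in>\<P>. smooth_submanifold n (n - 1) (n - 1) P \<and>
                connectedin (Euclidean_space n) P \<and> (\<exists>j\<in>{1..k}. P \<subseteq> S j))) \<and>
          (\<forall>j\<in>{1..k}. \<exists>q. poly_in n q \<and> total_deg q \<le> 2 \<and> S j \<in> conn_comps n (zeros n q)) \<and>
          (\<forall>j\<in>{1..k}.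
             affine_subspace n (S j) \<or>
             (\<exists>H. hyperbola_cylinder n H \<and> S j \<in> conn_comps n H) \<or>
             ellipsoid_boundary n (S j)) \<and>
          (\<forall>j0\<in>{1..k}. ellipsoid_boundary n (S j0) \<longrightarrow>
             (\<forall>j\<in>{1..k}. j \<noteq> j0 \<longrightarrow> S j \<inter> S j0 = {}))))"
proof -
  define \<alpha> \<beta> where "\<alpha> = t 1" and "\<beta> = t l"
  define Z where "Z = {j \<in> {1..l - 1}. lam j = 0}"
  \<comment> \<open>Adjacent members of \<open>Z\<close> share an end point, which becomes a double
    root, so \<open>c\<close> is negative on both sides of it.\<close>
  define c where "c = (\<Prod>j\<in>Z. [:- t j, 1:] * [:- t (j + 1), 1:])"
  \<comment> \<open>Only the inner values: \<open>t 1\<close> and \<open>t l\<close> become critical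
    as extrema of \<open>s\<close>.\<close>
  define q where "q = (\<Prod>j\<in>{2..<l}. [:- t j, 1:])"
  have mono: "t i < t j" if "1 \<le> i" "i < j" "j \<le> l" for i j
    using assms(2) that by (auto simp: strict_mono_on_def)
  have mono': "t i \<le> t j" if "1 \<le> i" "i \<le> j" "j \<le> l" for i j
    using mono[of i j] that by (cases "i = j") auto
  have inj: "inj_on t {1..l}"
    using assms(2) by (rule strict_mono_on_imp_inj_on)
  have c: "poly c s = (\<Prod>j\<in>Z. (s - t j) * (s - t (j + 1)))" for s
  proof -
    have "poly [:- a, 1:] s = s - a" for a by simp
    then show ?thesis
      by (simp only: c_def poly_prod poly_mult)
  qed
  have factor: "0 \<le> (s - t j) * (s - t (j + 1))" if "\<not> (t j < s \<and> s < t (j + 1))" "j \<in> Z" for s j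
  proof -
    have "t j < t (j + 1)"
      using that(2) assms(1) by (intro mono) (auto simp: Z_def)
    then show ?thesis
      using that(1) by (auto simp: zero_le_mult_iff)
  qed
  \<comment> \<open>Intervals with index \<open>j\<close> and \<open>k\<close> may share an end
    point, but \<open>s\<close> lies strictly inside the second one; hence strict
    inequalities.\<close>
  have other: "s < t j \<or> t (j + 1) < s"
    if "k \<in> {1..l - 1}" "t k < s" "s < t (k + 1)" "j \<in> Z" "j \<noteq> k" for s j k
  proof (cases "j < k")
    case True
    then have "t (j + 1) \<le> t k"
      using that(1,4) by (intro mono') (auto simp: Z_def)
    then show ?thesis using that(2) by simp
  next
    case False
    then have "t (k + 1) \<le> t j"
      using that(1,4,5) by (intro mono') (auto simp: Z_def)
    then show ?thesis using that(3) by simp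
  qed
  have c_nonneg: "0 \<le> poly c s" if "\<not> (\<alpha> < s \<and> s < \<beta>)" for s
    unfolding c
  proof (rule prod_nonneg, rule factor)
    fix j assume "j \<in> Z"
    then have "\<alpha> \<le> t j" "t (j + 1) \<le> \<beta>"
      unfolding \<alpha>_def \<beta>_def using assms(1) by (auto simp: Z_def intro!: mono')
    then show "\<not> (t j < s \<and> s < t (j + 1))" using that by auto
  qed
  have c_noncompact: "0 \<le> poly c s" if "k \<in> {1..l - 1}" "lam k = 1" "t k < s" "s < t (k + 1)" for k s
    unfolding c
  proof (rule prod_nonneg, rule factor)
    fix j assume "j \<in> Z"
    then have "j \<noteq> k" using that(2) by (auto simp: Z_def)
    from other[OF that(1,3,4) \<open>j \<in> Z\<close> this] show "\<not> (t j < s \<and> s < t (j + 1))"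
      by auto
  qed
  \<comment> \<open>Exactly one factor, the one with index \<open>k\<close>, is negative; by
    \<open>other\<close> all the rest are positive.\<close>
  have c_compact: "poly c s < 0" if "k \<in> {1..l - 1}" "lam k = 0" "t k < s" "s < t (k + 1)" for k s
  proof -
    have "k \<in> Z" "finite Z" using that by (auto simp: Z_def)
    then have "poly c s = (s - t k) * (s - t (k + 1)) * (\<Prod>j\<in>Z - {k}. (s - t j) * (s - t (j + 1)))"
      by (simp add: c prod.remove)
    moreover have "(s - t k) * (s - t (k + 1)) < 0"
      using that by (simp add: mult_pos_neg)
    moreover have "0 < (\<Prod>j\<in>Z - {k}. (s - t j) * (s - t (j + 1)))"
    proof (rule prod_pos)
      fix j assume j: "j \<in> Z - {k}"
      then have "t j < t (j + 1)"
        using assms(1) by (intro mono) (auto simp: Z_def)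
      then show "0 < (s - t j) * (s - t (j + 1))"
        using other[OF that(1,3,4), of j] j by (auto simp: zero_less_mult_iff)
    qed
    ultimately show ?thesis by (simp add: mult_neg_pos)
  qed
  have q: "poly q s = 0 \<longleftrightarrow> s \<in> t ` {2..<l}" for s
    by (auto simp: q_def poly_prod)
  have less: "\<alpha> < \<beta>"
    unfolding \<alpha>_def \<beta>_def using assms(1) by (intro mono) auto
  have q_root: "\<alpha> < s \<and> s < \<beta> \<and> poly (pderiv q) s \<noteq> 0" if root: "poly q s = 0" for s
  proof -
    obtain j where j: "j \<in> {2..<l}" "s = t j"
      using root q[of s] by blast
    have "inj_on t {2..<l}"
      using inj by (rule inj_on_subset) auto
    then have "poly (pderiv q) s \<noteq> 0"
      unfolding q_def j(2) using j(1) by (intro simple_root_prod_linear) simp_all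
    moreover have "t 1 < t j" "t j < t l"
      using j(1) by (auto intro: mono)
    ultimately show ?thesis
      by (simp add: \<alpha>_def \<beta>_def j(2))
  qed
  show ?thesis
  proof (rule exI[of _ 2], rule conjI, simp, rule exI[of _ 3], intro allI impI, goal_cases)
    case (1 m)
    then have m: "m > 2" by simp
    \<comment> \<open>The tail \<open>w\<close> has \<open>d + 1\<close> coordinates, at least two
      because \<open>m > 2\<close>.\<close>
    define d where "d = m - 2"
    have d: "0 < d" "m = d + 2" using m by (auto simp: d_def)
    interpret F: fibered_manifold \<alpha> \<beta> c q d
      by unfold_locales (use d less c_nonneg q_root in blast)+
    interpret P: plane_disc \<alpha> \<beta>
      by unfold_locales (rule less)
    have f: "F.g x 0 = x 0" for x
      by (simp add: F.g_def)
    have fib: "{x \<in> F.M. x 0 = s} = F.fiber s" for s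
      by (simp add: F.fiber_def)
    have fib_Rn: "F.fiber s \<subseteq> Rn (d + 4)" for s
      by (auto simp: F.fiber_def F.M_def)
    have "F.M \<subseteq> Rn (d + 4)"
      by (auto simp: F.M_def)
    then have conn: "connectedin (Euclidean_space (d + 4)) F.M"
      by (simp add: connectedin_Euclidean_space F.connected_M)
    have sing: "(\<lambda>x. x 0) ` singular_points m 1 F.M (tuple 1 (\<lambda>_ x. x 0)) = t ` {1..l}"
    proof -
      have crit: "(s = \<alpha> \<or> s = \<beta> \<or> poly q s = 0) \<longleftrightarrow> s \<in> t ` {1..l}" for s
      proof -
        have "{1..l} = insert 1 (insert l {2..<l})"
          using assms(1) by auto
        then show ?thesis
          by (simp add: q \<alpha>_def \<beta>_def)
      qed
      \<comment> \<open>The singular points are described by their value of \<open>s\<close>, so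
        each \<open>t j\<close> must also be shown to occur on \<open>M\<close>.\<close>
      have "t ` {1..l} \<subseteq> {\<alpha>..\<beta>}"
        using mono'[of 1] mono'[of _ l] by (auto simp: \<alpha>_def \<beta>_def)
      then have "t ` {1..l} \<subseteq> (\<lambda>x. x 0) ` F.M"
        by (simp only: F.image_coord0)
      then show ?thesis
        unfolding d(2) F.singular_points_M crit by (rule image_filter)
    qed
    have inner: "\<alpha> < s" "s < \<beta>" "poly q s \<noteq> 0"
      if "j \<in> {1..l - 1}" "s \<in> {t j<..<t (j + 1)}" for j s
    proof -
      have "\<alpha> \<le> t j" "t (j + 1) \<le> \<beta>"
        unfolding \<alpha>_def \<beta>_def using that(1) assms(1) by (auto intro!: mono')
      then show "\<alpha> < s" "s < \<beta>" using that(2) by auto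
      show "poly q s \<noteq> 0"
      proof
        assume "poly q s = 0"
        then obtain i where i: "i \<in> {2..<l}" "s = t i" using q by blast
        have "1 \<le> j" "j \<le> l" using that(1) by auto
        then show False
          using i that(2) mono'[of i j] mono'[of "j + 1" i] by (cases "i \<le> j") auto
      qed
    qed
    have fibers: "(lam j = 0 \<longrightarrow>
          compactin (Euclidean_space (d + 4)) (F.fiber s) \<and>
          smooth_submanifold (d + 4) (m - 1) 0 (F.fiber s) \<and>
          connectedin (Euclidean_space (d + 4)) (F.fiber s)) \<and>
        (lam j = 1 \<longrightarrow>
          connectedin (Euclidean_space (d + 4)) (F.fiber s) \<and>
          \<not> compactin (Euclidean_space (d + 4)) (F.fiber s) \<and>
          smooth_submanifold (d + 4) (m - 1) 0 (F.fiber s))"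
      if j: "j \<in> {1..l - 1}" and s: "s \<in> {t j<..<t (j + 1)}" for j s
    proof -
      note s' = inner[OF j s]
      have "smooth_submanifold (d + 4) (m - 1) 0 (F.fiber s)"
        using F.smooth_submanifold_fiber[OF s'] by (simp add: d(2))
      moreover have "connected (F.fiber s)"
        using s' by (intro F.connected_fiber) auto
      moreover have "compact (F.fiber s)" if "lam j = 0"
        using F.compact_fiber[OF s'(1,2) c_compact[OF j that]] s by simp
      moreover have "\<not> compact (F.fiber s)" if "lam j = 1"
        using F.not_compact_fiber[of s] s' c_noncompact[OF j that] s by simp
      ultimately show ?thesis
        by (simp add: connectedin_Euclidean_space compactin_Euclidean_space fib_Rn)
    qed
    have CW: "connectedin (Euclidean_space (d + 4)) (F.fiber s) \<and>
        (\<exists>Y :: (nat \<Rightarrow> real) topology. CW_complex_dim_le (m - 1) Y \<and>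
          subtopology (Euclidean_space (d + 4)) (F.fiber s) homeomorphic_space Y)"
      if "s \<in> {\<alpha>..\<beta>}" for s
    proof -
      have s: "\<alpha> \<le> s" "s \<le> \<beta>" using that by auto
      have "CW_complex_dim_le (m - 1) (top_of_set (F.fiber s))"
        using F.CW_structure_fiber[OF s] by (simp add: CW_complex_dim_le_def d(2))
      then show ?thesis
        using F.connected_fiber[OF s] fib_Rn
        by (auto simp: connectedin_Euclidean_space subtopology_Euclidean_space intro: homeomorphic_space_refl)
    qed
    have M: "nonsingular_alg_manifold (d + 4) m F.M"
      using F.nonsingular_alg_manifold_M by (simp add: d(2))
    obtain p where p: "poly_in 2 p" "total_deg p \<le> 2" "peval p = P.G"
      by (rule P.G_polynomial)
    have image: "F.g ` F.M = P.E"
      by (simp add: F.image_g P.E_def P.G_def F.b_def)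
    note NCD = P.NCD_D[OF p(1,3)]
    show ?case
      unfolding Let_def
    proof (rule exI[of _ "d + 4"], rule exI[of _ F.M], rule exI[of _ F.g],
        unfold f fib F.image_coord0, intro conjI M conn F.real_algebraic_map_g sing)
      show "{\<alpha>..\<beta>} = {t 1..t l}"
        by (simp only: \<alpha>_def \<beta>_def)
      show "\<forall>j\<in>{1..l - 1}. \<forall>s\<in>{t j<..<t (j + 1)}.
             (lam j = 0 \<longrightarrow>
                compactin (Euclidean_space (d + 4)) (F.fiber s) \<and>
                smooth_submanifold (d + 4) (m - 1) 0 (F.fiber s) \<and>
                connectedin (Euclidean_space (d + 4)) (F.fiber s)) \<and>
             (lam j = 1 \<longrightarrow>
                connectedin (Euclidean_space (d + 4)) (F.fiber s) \<and>
                \<not> compactin (Euclidean_space (d + 4)) (F.fiber s) \<and>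
                smooth_submanifold (d + 4) (m - 1) 0 (F.fiber s))"
        using fibers by blast
      show "\<forall>s\<in>{\<alpha>..\<beta>}. connectedin (Euclidean_space (d + 4)) (F.fiber s) \<and>
             (\<exists>Y :: (nat \<Rightarrow> real) topology. CW_complex_dim_le (m - 1) Y \<and>
                subtopology (Euclidean_space (d + 4)) (F.fiber s) homeomorphic_space Y)"
        using CW by blast
      show "(\<exists>D k p S.
          NCD 2 D k p S \<and>
          F.g ` F.M = Euclidean_space 2 closure_of D \<and>
          (\<exists>\<P>. finite \<P> \<and> (Euclidean_space 2 closure_of D) - D = \<Union>\<P> \<and>
             (\<forall>P\<in>\<P>. smooth_submanifold 2 (2 - 1) (2 - 1) P \<and>
                connectedin (Euclidean_space 2) P \<and> (\<exists>j\<in>{1..k}. P \<subseteq> S j))) \<and>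
          (\<forall>j\<in>{1..k}. \<exists>q. poly_in 2 q \<and> total_deg q \<le> 2 \<and> S j \<in> conn_comps 2 (zeros 2 q)) \<and>
          (\<forall>j\<in>{1..k}.
             affine_subspace 2 (S j) \<or>
             (\<exists>H. hyperbola_cylinder 2 H \<and> S j \<in> conn_comps 2 H) \<or>
             ellipsoid_boundary 2 (S j)) \<and>
          (\<forall>j0\<in>{1..k}. ellipsoid_boundary 2 (S j0) \<longrightarrow>
             (\<forall>j\<in>{1..k}. j \<noteq> j0 \<longrightarrow> S j \<inter> S j0 = {})))"
        \<comment> \<open>With \<open>k = 1\<close> the circle is the only hypersurface and the only
          piece of the boundary, and its disjointness from the other hypersurfaces is
          vacuous.\<close>
        using NCD p(1,2) P.C_subset P.connected_C P.smooth_submanifold_C P.ellipsoid_boundary_C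
        by (intro exI[of _ P.D] exI[of _ 1] exI[of _ "\<lambda>_. p"] exI[of _ "\<lambda>_. P.C"])
          (auto simp: image P.closure_D P.E_minus_D connectedin_Euclidean_space
            intro!: exI[of _ "{P.C}"] exI[of _ p])
    qed
  qed
qed

end
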